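(* Given a closed $\mathsf{MSO}$-formula $\varphi$, \[ \mathsf{FSO}\vdash\varphi^\circ \qquad\text{if and only if}\qquad \mathsf{MSO}\vdash\varphi . \]
   Context: Fix a finite non-empty HF-set $\mathcal D$ of tree directions. $\mathsf{MSO}=\mathsf{MSO}_{\mathcal D}$: two-sorted logic with Individuals ($\mathrm{Root}$, successors $\mathrm S_d$, $=$, $<$) and monadic Predicates, with tree axioms, equality, comprehension scheme and induction axiom. $\mathsf{FSO}=\mathsf{FSO}_{\mathcal D}$: same Individuals, plus a sort of hereditarily finite sets (over $V_\omega$, constants for HF-sets, HF-Function constants, only bounded quantification) and Function variables $F:K$ (maps from tree positions into HF-set $K$); axioms: equality, tree axioms, induction scheme, axioms on HF-sets (Skolem functions for $\forall\exists!$ statements provable in Skolemized $\mathsf{ZFC}$ without infinity), and Functional Choice Axioms (HF-Bounded Choice for HF-sets, for Functions, and Iterated HF-Bounded Choice $(\forall k\in K)(\exists F:L)\varphi(k,F)\to(\exists G:L^K)(\forall k\in K)\varphi(k,F)[G(k)/\!/F]$, where $[G(k)/\!/F]$ replaces each atom $F(t)=M$ by $(\exists f\in L^K)(G(t)=f\land f(k)=M)$). The translation $(-)^\circ:\mathsf{MSO}\to\mathsf{FSO}$ assigns a Function variable $F_X$ to each monadic variable $X$: $(X(t))^\circ=(F_X(t)=1)$, $(t=u)^\circ=(t=u)$, $(t\le u)^\circ=(t\le u)$, it commutes with $\lor,\lnot,\exists x$, and $((\exists X)\varphi)^\circ=(\exists F_X:2)\varphi^\circ$. *)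

theory Defs
  imports "HOL-Library.FSet"
begin

text \<open>
  All syntax is in de Bruijn form, with a separate index space for each sort of variables: a binder
  for one sort only shifts the indices of that sort.  Substitution is parallel.
  The connectives \<open>\<not>\<close>, \<open>\<or>\<close>, \<open>\<exists>\<close> are primitive, the others are
  abbreviations.  The three deduction systems (set theory, MSO, FSO) use the same classical natural
  deduction rules for \<open>\<not>\<close>, \<open>\<or>\<close>, \<open>\<exists>\<close>; side conditions keep all formulas of a
  derivation inside the respective language.
\<close>

section \<open>Hereditarily finite sets\<close>

text \<open>The set \<open>V\<^sub>\<omega>\<close>: the initial algebra of the finite powerset functor.\<close>

datatype hf = HF (elts: "hf fset")

definition hf_zero :: hf where "hf_zero = HF {||}"
definition hf_one :: hf where "hf_one = HF {|hf_zero|}"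
definition hf_two :: hf where "hf_two = HF {|hf_zero, hf_one|}"


section \<open>HF-terms and the language of set theory\<close>

text \<open>
  \<open>HFun \<phi> Ks\<close> is the application of the \<open>n\<close>-ary Skolem function
  \<open>g\<^sub>\<phi>\<close> to \<open>Ks\<close>, where \<open>n = length Ks\<close>.  The formula \<open>\<phi>\<close> is part of
  the name of the function symbol, hence is untouched by substitutions.  It describes the graph
  of the function: its index \<open>0\<close> is the value and its index \<open>i + 1\<close> is argument number
  \<open>i < n\<close>.  Since \<open>\<phi>\<close> may itself contain Skolem functions, the syntax covers iterated
  Skolemization.
\<close>

datatype hterm = HVar nat | HConst hf | HFun sform "hterm list"
and sform =
    SEq hterm hterm
  | SIn hterm hterm
  | SNot sform
  | SOr sform sform
  | SEx sform

primrec hsubst :: "(nat \<Rightarrow> hterm) \<Rightarrow> hterm \<Rightarrow> hterm" where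
  "hsubst \<tau> (HVar i) = \<tau> i"
| "hsubst \<tau> (HConst \<kappa>) = HConst \<kappa>"
| "hsubst \<tau> (HFun \<phi> Ks) = HFun \<phi> (map (hsubst \<tau>) Ks)"

abbreviation hlift :: "hterm \<Rightarrow> hterm" where
  "hlift \<equiv> hsubst (\<lambda>i. HVar (Suc i))"

definition hup :: "(nat \<Rightarrow> hterm) \<Rightarrow> nat \<Rightarrow> hterm" where
  "hup \<tau> = case_nat (HVar 0) (\<lambda>i. hlift (\<tau> i))"

primrec ssubst :: "(nat \<Rightarrow> hterm) \<Rightarrow> sform \<Rightarrow> sform" where
  "ssubst \<tau> (SEq K L) = SEq (hsubst \<tau> K) (hsubst \<tau> L)"
| "ssubst \<tau> (SIn K L) = SIn (hsubst \<tau> K) (hsubst \<tau> L)"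
| "ssubst \<tau> (SNot \<phi>) = SNot (ssubst \<tau> \<phi>)"
| "ssubst \<tau> (SOr \<phi> \<psi>) = SOr (ssubst \<tau> \<phi>) (ssubst \<tau> \<psi>)"
| "ssubst \<tau> (SEx \<phi>) = SEx (ssubst (hup \<tau>) \<phi>)"

abbreviation slift :: "sform \<Rightarrow> sform" where
  "slift \<equiv> ssubst (\<lambda>i. HVar (Suc i))"

abbreviation sinst :: "hterm \<Rightarrow> sform \<Rightarrow> sform" where
  "sinst K \<equiv> ssubst (case_nat K HVar)"

text \<open>All free indices are below \<open>n\<close>.\<close>

primrec hbound :: "nat \<Rightarrow> hterm \<Rightarrow> bool" where
  "hbound n (HVar i) \<longleftrightarrow> i < n"
| "hbound n (HConst \<kappa>) \<longleftrightarrow> True"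
| "hbound n (HFun \<phi> Ks) \<longleftrightarrow> list_all (hbound n) Ks"

primrec sbound :: "nat \<Rightarrow> sform \<Rightarrow> bool" where
  "sbound n (SEq K L) \<longleftrightarrow> hbound n K \<and> hbound n L"
| "sbound n (SIn K L) \<longleftrightarrow> hbound n K \<and> hbound n L"
| "sbound n (SNot \<phi>) \<longleftrightarrow> sbound n \<phi>"
| "sbound n (SOr \<phi> \<psi>) \<longleftrightarrow> sbound n \<phi> \<and> sbound n \<psi>"
| "sbound n (SEx \<phi>) \<longleftrightarrow> sbound (Suc n) \<phi>"

abbreviation SAnd :: "sform \<Rightarrow> sform \<Rightarrow> sform" where
  "SAnd \<phi> \<psi> \<equiv> SNot (SOr (SNot \<phi>) (SNot \<psi>))"
abbreviation SImp :: "sform \<Rightarrow> sform \<Rightarrow> sform" where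
  "SImp \<phi> \<psi> \<equiv> SOr (SNot \<phi>) \<psi>"
abbreviation SIff :: "sform \<Rightarrow> sform \<Rightarrow> sform" where
  "SIff \<phi> \<psi> \<equiv> SAnd (SImp \<phi> \<psi>) (SImp \<psi> \<phi>)"
abbreviation SAll :: "sform \<Rightarrow> sform" where
  "SAll \<phi> \<equiv> SNot (SEx (SNot \<phi>))"
abbreviation SBot :: sform where
  "SBot \<equiv> SNot (SEq (HConst hf_zero) (HConst hf_zero))"

definition SEx1 :: "sform \<Rightarrow> sform" where
  "SEx1 \<phi> = SEx (SAnd \<phi> (SAll (SImp
     (ssubst (case_nat (HVar 0) (\<lambda>i. HVar (i + 2))) \<phi>) (SEq (HVar 0) (HVar 1)))))"

definition SAlls :: "nat \<Rightarrow> sform \<Rightarrow> sform" where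
  "SAlls n \<phi> = (SAll ^^ n) \<phi>"


section \<open>Skolemized ZFC without infinity\<close>

text \<open>
  In the schemes, \<open>\<phi>\<close> ranges over formulas with arbitrary parameters.
  Separation: index \<open>0\<close> of \<open>\<phi>\<close> is the element.  Replacement: \<open>\<phi>\<close> relates
  index \<open>1\<close> (argument) to index \<open>0\<close> (value).
  The renamings move \<open>\<phi>\<close> under the quantifiers of the axiom.
\<close>

inductive zfc_ax :: "sform \<Rightarrow> bool" where
  eq_refl: "zfc_ax (SEq K K)"
| eq_subst: "zfc_ax (SImp (SEq K L) (SImp (sinst K \<phi>) (sinst L \<phi>)))"
| hf_constant:
    "set \<kappa>s = fset (elts \<kappa>) \<Longrightarrow>
     zfc_ax (SIff (SIn K (HConst \<kappa>)) (foldr (\<lambda>\<mu>. SOr (SEq K (HConst \<mu>))) \<kappa>s SBot))"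
| extensionality:
    "zfc_ax (SAll (SAll (SImp
       (SAll (SIff (SIn (HVar 0) (HVar 2)) (SIn (HVar 0) (HVar 1)))) (SEq (HVar 1) (HVar 0)))))"
| foundation:
    "zfc_ax (SAll (SImp (SEx (SIn (HVar 0) (HVar 1)))
       (SEx (SAnd (SIn (HVar 0) (HVar 1))
          (SNot (SEx (SAnd (SIn (HVar 0) (HVar 1)) (SIn (HVar 0) (HVar 2)))))))))"
| pairing:
    "zfc_ax (SAll (SAll (SEx (SAll (SIff (SIn (HVar 0) (HVar 1))
       (SOr (SEq (HVar 0) (HVar 3)) (SEq (HVar 0) (HVar 2))))))))"
| union:
    "zfc_ax (SAll (SEx (SAll (SIff (SIn (HVar 0) (HVar 1))
       (SEx (SAnd (SIn (HVar 0) (HVar 3)) (SIn (HVar 1) (HVar 0))))))))"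
| powerset:
    "zfc_ax (SAll (SEx (SAll (SIff (SIn (HVar 0) (HVar 1))
       (SAll (SImp (SIn (HVar 0) (HVar 1)) (SIn (HVar 0) (HVar 3))))))))"
| separation:
    "zfc_ax (SAll (SEx (SAll (SIff (SIn (HVar 0) (HVar 1))
       (SAnd (SIn (HVar 0) (HVar 2))
         (ssubst (case_nat (HVar 0) (\<lambda>i. HVar (i + 3))) \<phi>))))))"
| replacement:
    "zfc_ax (SImp
       (SAll (SAll (SAll (SImp
          (SAnd (ssubst (case_nat (HVar 1) (case_nat (HVar 2) (\<lambda>i. HVar (i + 3)))) \<phi>)
                (ssubst (case_nat (HVar 0) (case_nat (HVar 2) (\<lambda>i. HVar (i + 3)))) \<phi>))
          (SEq (HVar 1) (HVar 0))))))
       (SAll (SEx (SAll (SIff (SIn (HVar 0) (HVar 1))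
          (SEx (SAnd (SIn (HVar 0) (HVar 3))
            (ssubst (case_nat (HVar 1) (case_nat (HVar 0) (\<lambda>i. HVar (i + 4)))) \<phi>))))))))"
| choice: \<comment> \<open>a family of non-empty, pairwise disjoint sets has a transversal\<close>
    "zfc_ax (SAll (SImp
       (SAnd
         (SAll (SImp (SIn (HVar 0) (HVar 1)) (SEx (SIn (HVar 0) (HVar 1)))))
         (SAll (SAll (SImp
           (SAnd (SAnd (SIn (HVar 1) (HVar 2)) (SIn (HVar 0) (HVar 2)))
                 (SEx (SAnd (SIn (HVar 0) (HVar 2)) (SIn (HVar 0) (HVar 1)))))
           (SEq (HVar 1) (HVar 0))))))
       (SEx (SAll (SImp (SIn (HVar 0) (HVar 2))
          (SEx1 (SAnd (SIn (HVar 0) (HVar 2)) (SIn (HVar 0) (HVar 1)))))))))"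

definition skolem_inst :: "sform \<Rightarrow> hterm list \<Rightarrow> nat \<Rightarrow> hterm" where
  "skolem_inst \<phi> Ks =
     case_nat (HFun \<phi> Ks) (\<lambda>i. if i < length Ks then Ks ! i else HVar i)"

text \<open>
  Terms and formulas of the language of Skolemized ZFC without infinity are generated
  simultaneously with its theorems: \<open>g\<^sub>\<phi>\<close> is a function symbol only if
  \<open>\<forall>k\<^sub>1 \<dots> k\<^sub>n. \<exists>!l. \<phi>\<close> is a theorem.  The HF-terms of FSO are the terms satisfying
  \<open>hf_term\<close>.
\<close>

inductive hf_term :: "hterm \<Rightarrow> bool"
  and sk_form :: "sform \<Rightarrow> bool"
  and sk_prf :: "sform list \<Rightarrow> sform \<Rightarrow> bool" (infix \<open>\<turnstile>\<^sub>S\<close> 50)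
where
  hf_var: "hf_term (HVar i)"
| hf_const: "hf_term (HConst \<kappa>)"
| hf_fun:
    "sk_form \<phi> \<Longrightarrow> sbound (Suc (length Ks)) \<phi> \<Longrightarrow> [] \<turnstile>\<^sub>S SAlls (length Ks) (SEx1 \<phi>) \<Longrightarrow>
     \<forall>K \<in> set Ks. hf_term K \<Longrightarrow> hf_term (HFun \<phi> Ks)"

| sk_eq: "hf_term K \<Longrightarrow> hf_term L \<Longrightarrow> sk_form (SEq K L)"
| sk_in: "hf_term K \<Longrightarrow> hf_term L \<Longrightarrow> sk_form (SIn K L)"
| sk_not: "sk_form \<phi> \<Longrightarrow> sk_form (SNot \<phi>)"
| sk_or: "sk_form \<phi> \<Longrightarrow> sk_form \<psi> \<Longrightarrow> sk_form (SOr \<phi> \<psi>)"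
| sk_ex: "sk_form \<phi> \<Longrightarrow> sk_form (SEx \<phi>)"

| sk_hyp: "\<phi> \<in> set \<Gamma> \<Longrightarrow> \<forall>\<psi> \<in> set \<Gamma>. sk_form \<psi> \<Longrightarrow> \<Gamma> \<turnstile>\<^sub>S \<phi>"
| sk_zfc: "zfc_ax \<phi> \<Longrightarrow> sk_form \<phi> \<Longrightarrow> \<forall>\<psi> \<in> set \<Gamma>. sk_form \<psi> \<Longrightarrow> \<Gamma> \<turnstile>\<^sub>S \<phi>"
| sk_skolem:
    "hf_term (HFun \<phi> Ks) \<Longrightarrow> sk_form \<phi> \<Longrightarrow> \<forall>\<psi> \<in> set \<Gamma>. sk_form \<psi> \<Longrightarrow>
     \<Gamma> \<turnstile>\<^sub>S ssubst (skolem_inst \<phi> Ks) \<phi>"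
| sk_orI1: "\<Gamma> \<turnstile>\<^sub>S \<phi> \<Longrightarrow> sk_form \<psi> \<Longrightarrow> \<Gamma> \<turnstile>\<^sub>S SOr \<phi> \<psi>"
| sk_orI2: "\<Gamma> \<turnstile>\<^sub>S \<psi> \<Longrightarrow> sk_form \<phi> \<Longrightarrow> \<Gamma> \<turnstile>\<^sub>S SOr \<phi> \<psi>"
| sk_orE: "\<Gamma> \<turnstile>\<^sub>S SOr \<phi> \<psi> \<Longrightarrow> \<phi> # \<Gamma> \<turnstile>\<^sub>S \<chi> \<Longrightarrow> \<psi> # \<Gamma> \<turnstile>\<^sub>S \<chi> \<Longrightarrow> \<Gamma> \<turnstile>\<^sub>S \<chi>"
| sk_notI: "\<phi> # \<Gamma> \<turnstile>\<^sub>S \<psi> \<Longrightarrow> \<phi> # \<Gamma> \<turnstile>\<^sub>S SNot \<psi> \<Longrightarrow> \<Gamma> \<turnstile>\<^sub>S SNot \<phi>"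
| sk_ccontr: "SNot \<phi> # \<Gamma> \<turnstile>\<^sub>S \<psi> \<Longrightarrow> SNot \<phi> # \<Gamma> \<turnstile>\<^sub>S SNot \<psi> \<Longrightarrow> \<Gamma> \<turnstile>\<^sub>S \<phi>"
| sk_exI: "hf_term K \<Longrightarrow> \<Gamma> \<turnstile>\<^sub>S sinst K \<phi> \<Longrightarrow> \<Gamma> \<turnstile>\<^sub>S SEx \<phi>"
| sk_exE: "\<Gamma> \<turnstile>\<^sub>S SEx \<phi> \<Longrightarrow> \<phi> # map slift \<Gamma> \<turnstile>\<^sub>S slift \<psi> \<Longrightarrow> \<Gamma> \<turnstile>\<^sub>S \<psi>"


section \<open>The HF-Functions \<open>L\<^sup>K\<close> and \<open>f(k)\<close>\<close>

definition s_upair :: "hterm \<Rightarrow> hterm \<Rightarrow> hterm \<Rightarrow> sform" where \<comment> \<open>\<open>z = {a, b}\<close>\<close>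
  "s_upair z a b = SAll (SIff (SIn (HVar 0) (hlift z))
     (SOr (SEq (HVar 0) (hlift a)) (SEq (HVar 0) (hlift b))))"

definition s_opair :: "hterm \<Rightarrow> hterm \<Rightarrow> hterm \<Rightarrow> sform" where \<comment> \<open>\<open>p = {{a}, {a, b}}\<close>\<close>
  "s_opair p a b = SAll (SIff (SIn (HVar 0) (hlift p))
     (SOr (s_upair (HVar 0) (hlift a) (hlift a)) (s_upair (HVar 0) (hlift a) (hlift b))))"

definition s_graph :: "hterm \<Rightarrow> hterm \<Rightarrow> hterm \<Rightarrow> sform" where \<comment> \<open>\<open>(a, b) \<in> f\<close>\<close>
  "s_graph f a b = SEx (SAnd (SIn (HVar 0) (hlift f)) (s_opair (HVar 0) (hlift a) (hlift b)))"

text \<open>\<open>f\<close> is a function from \<open>K\<close> to \<open>L\<close>: every element of \<open>f\<close> is a pair in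
  \<open>K \<times> L\<close>, and each element of \<open>K\<close> has exactly one value.\<close>

definition s_function :: "hterm \<Rightarrow> hterm \<Rightarrow> hterm \<Rightarrow> sform" where
  "s_function f K L = SAnd
     (SAll (SImp (SIn (HVar 0) (hlift f))
        (SEx (SAnd (SIn (HVar 0) (hlift (hlift K)))
           (SEx (SAnd (SIn (HVar 0) (hlift (hlift (hlift L))))
              (s_opair (HVar 2) (HVar 1) (HVar 0))))))))
     (SAll (SImp (SIn (HVar 0) (hlift K))
        (SEx1 (s_graph (hlift (hlift f)) (HVar 1) (HVar 0)))))"

text \<open>Graph of \<open>(L, K) \<mapsto> L\<^sup>K\<close>.\<close>

definition s_exp :: sform where
  "s_exp = SAll (SIff (SIn (HVar 0) (HVar 1)) (s_function (HVar 0) (HVar 3) (HVar 2)))"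

text \<open>Graph of \<open>(f, k) \<mapsto> f(k)\<close>, with value \<open>\<emptyset>\<close> if \<open>k\<close> does not have exactly one
  image under \<open>f\<close>.\<close>

definition s_app :: sform where
  "s_app = SOr
     (SAnd (s_graph (HVar 1) (HVar 2) (HVar 0)) (SEx1 (s_graph (HVar 2) (HVar 3) (HVar 0))))
     (SAnd (SNot (SEx1 (s_graph (HVar 2) (HVar 3) (HVar 0))))
           (SAll (SNot (SIn (HVar 0) (HVar 1)))))"

definition hexp :: "hterm \<Rightarrow> hterm \<Rightarrow> hterm" where
  "hexp L K = HFun s_exp [L, K]"

definition happ :: "hterm \<Rightarrow> hterm \<Rightarrow> hterm" where
  "happ f k = HFun s_app [f, k]"


section \<open>Individuals\<close>

datatype iterm = IVar nat | Root | Succ hf iterm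

primrec isubst :: "(nat \<Rightarrow> iterm) \<Rightarrow> iterm \<Rightarrow> iterm" where
  "isubst \<sigma> (IVar i) = \<sigma> i"
| "isubst \<sigma> Root = Root"
| "isubst \<sigma> (Succ d t) = Succ d (isubst \<sigma> t)"

definition iup :: "(nat \<Rightarrow> iterm) \<Rightarrow> nat \<Rightarrow> iterm" where
  "iup \<sigma> = case_nat (IVar 0) (\<lambda>i. isubst (\<lambda>j. IVar (Suc j)) (\<sigma> i))"

primrec ibound :: "nat \<Rightarrow> iterm \<Rightarrow> bool" where
  "ibound n (IVar i) \<longleftrightarrow> i < n"
| "ibound n Root \<longleftrightarrow> True"
| "ibound n (Succ d t) \<longleftrightarrow> ibound n t"

text \<open>Terms over the directions in \<open>D\<close>.\<close>

primrec dir_term :: "hf \<Rightarrow> iterm \<Rightarrow> bool" where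
  "dir_term D (IVar i) \<longleftrightarrow> True"
| "dir_term D Root \<longleftrightarrow> True"
| "dir_term D (Succ d t) \<longleftrightarrow> d |\<in>| elts D \<and> dir_term D t"

text \<open>Lifting of a renaming of Predicate or Function variables under a binder.\<close>

definition rup :: "(nat \<Rightarrow> nat) \<Rightarrow> nat \<Rightarrow> nat" where
  "rup \<rho> = case_nat 0 (\<lambda>i. Suc (\<rho> i))"


section \<open>MSO\<close>

text \<open>\<open>MExI\<close> quantifies over Individuals, \<open>MExP\<close> over Predicates.\<close>

datatype mso =
    MPred nat iterm
  | MEq iterm iterm
  | MLess iterm iterm
  | MNot mso
  | MOr mso mso
  | MExI mso
  | MExP mso

primrec msubst :: "(nat \<Rightarrow> iterm) \<Rightarrow> (nat \<Rightarrow> nat) \<Rightarrow> mso \<Rightarrow> mso" where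
  "msubst \<sigma> \<rho> (MPred X t) = MPred (\<rho> X) (isubst \<sigma> t)"
| "msubst \<sigma> \<rho> (MEq t u) = MEq (isubst \<sigma> t) (isubst \<sigma> u)"
| "msubst \<sigma> \<rho> (MLess t u) = MLess (isubst \<sigma> t) (isubst \<sigma> u)"
| "msubst \<sigma> \<rho> (MNot \<phi>) = MNot (msubst \<sigma> \<rho> \<phi>)"
| "msubst \<sigma> \<rho> (MOr \<phi> \<psi>) = MOr (msubst \<sigma> \<rho> \<phi>) (msubst \<sigma> \<rho> \<psi>)"
| "msubst \<sigma> \<rho> (MExI \<phi>) = MExI (msubst (iup \<sigma>) \<rho> \<phi>)"
| "msubst \<sigma> \<rho> (MExP \<phi>) = MExP (msubst \<sigma> (rup \<rho>) \<phi>)"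

abbreviation mliftI :: "mso \<Rightarrow> mso" where
  "mliftI \<equiv> msubst (\<lambda>i. IVar (Suc i)) id"
abbreviation mliftP :: "mso \<Rightarrow> mso" where
  "mliftP \<equiv> msubst IVar Suc"
abbreviation minstI :: "iterm \<Rightarrow> mso \<Rightarrow> mso" where
  "minstI t \<equiv> msubst (case_nat t IVar) id"
abbreviation minstP :: "nat \<Rightarrow> mso \<Rightarrow> mso" where
  "minstP X \<equiv> msubst IVar (case_nat X id)"

abbreviation MAnd :: "mso \<Rightarrow> mso \<Rightarrow> mso" where
  "MAnd \<phi> \<psi> \<equiv> MNot (MOr (MNot \<phi>) (MNot \<psi>))"
abbreviation MImp :: "mso \<Rightarrow> mso \<Rightarrow> mso" where
  "MImp \<phi> \<psi> \<equiv> MOr (MNot \<phi>) \<psi>"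
abbreviation MIff :: "mso \<Rightarrow> mso \<Rightarrow> mso" where
  "MIff \<phi> \<psi> \<equiv> MAnd (MImp \<phi> \<psi>) (MImp \<psi> \<phi>)"
abbreviation MAllI :: "mso \<Rightarrow> mso" where
  "MAllI \<phi> \<equiv> MNot (MExI (MNot \<phi>))"
abbreviation MAllP :: "mso \<Rightarrow> mso" where
  "MAllP \<phi> \<equiv> MNot (MExP (MNot \<phi>))"
abbreviation MLeq :: "iterm \<Rightarrow> iterm \<Rightarrow> mso" where
  "MLeq t u \<equiv> MOr (MLess t u) (MEq t u)"

text \<open>Formulas over the directions in \<open>D\<close>.\<close>

primrec mso_form :: "hf \<Rightarrow> mso \<Rightarrow> bool" where
  "mso_form D (MPred X t) \<longleftrightarrow> dir_term D t"
| "mso_form D (MEq t u) \<longleftrightarrow> dir_term D t \<and> dir_term D u"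
| "mso_form D (MLess t u) \<longleftrightarrow> dir_term D t \<and> dir_term D u"
| "mso_form D (MNot \<phi>) \<longleftrightarrow> mso_form D \<phi>"
| "mso_form D (MOr \<phi> \<psi>) \<longleftrightarrow> mso_form D \<phi> \<and> mso_form D \<psi>"
| "mso_form D (MExI \<phi>) \<longleftrightarrow> mso_form D \<phi>"
| "mso_form D (MExP \<phi>) \<longleftrightarrow> mso_form D \<phi>"

text \<open>Free Individual indices are below \<open>m\<close>, free Predicate indices below \<open>n\<close>.\<close>

primrec mbound :: "nat \<Rightarrow> nat \<Rightarrow> mso \<Rightarrow> bool" where
  "mbound m n (MPred X t) \<longleftrightarrow> X < n \<and> ibound m t"
| "mbound m n (MEq t u) \<longleftrightarrow> ibound m t \<and> ibound m u"
| "mbound m n (MLess t u) \<longleftrightarrow> ibound m t \<and> ibound m u"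
| "mbound m n (MNot \<phi>) \<longleftrightarrow> mbound m n \<phi>"
| "mbound m n (MOr \<phi> \<psi>) \<longleftrightarrow> mbound m n \<phi> \<and> mbound m n \<psi>"
| "mbound m n (MExI \<phi>) \<longleftrightarrow> mbound (Suc m) n \<phi>"
| "mbound m n (MExP \<phi>) \<longleftrightarrow> mbound m (Suc n) \<phi>"

definition mso_closed :: "mso \<Rightarrow> bool" where
  "mso_closed \<phi> \<longleftrightarrow> mbound 0 0 \<phi>"

text \<open>
  Axioms are taken for arbitrary terms in place of universally quantified Individuals.  The finite
  conjunction over the directions in the induction axiom is a nested implication along any
  enumeration \<open>ds\<close> of \<open>D\<close>.
\<close>

inductive mso_ax :: "hf \<Rightarrow> mso \<Rightarrow> bool" for D :: hf where
  eq_refl: "mso_ax D (MEq t t)"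
| eq_subst: "mso_ax D (MImp (MEq t u) (MImp (minstI t \<phi>) (minstI u \<phi>)))"
| succ_root: "mso_ax D (MNot (MEq (Succ d t) Root))"
| succ_inj: "mso_ax D (MImp (MEq (Succ d t) (Succ d u)) (MEq t u))"
| succ_distinct: "d \<noteq> e \<Longrightarrow> mso_ax D (MNot (MEq (Succ d t) (Succ e u)))"
| less_irrefl: "mso_ax D (MNot (MLess t t))"
| less_trans: "mso_ax D (MImp (MLess t u) (MImp (MLess u v) (MLess t v)))"
| less_root: "mso_ax D (MNot (MLess t Root))"
| less_succ: "mso_ax D (MIff (MLess t (Succ d u)) (MLeq t u))"
| comprehension:
    "mso_ax D (MExP (MAllI (MIff (MPred 0 (IVar 0)) (mliftP \<phi>))))"
| induction:
    "set ds = fset (elts D) \<Longrightarrow>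
     mso_ax D (MAllP (MImp (MPred 0 Root)
       (foldr (\<lambda>d. MImp (MAllI (MImp (MPred 0 (IVar 0)) (MPred 0 (Succ d (IVar 0)))))) ds
         (MAllI (MPred 0 (IVar 0))))))"

inductive mso_prf :: "hf \<Rightarrow> mso list \<Rightarrow> mso \<Rightarrow> bool" for D :: hf where
  hyp: "\<phi> \<in> set \<Gamma> \<Longrightarrow> \<forall>\<psi> \<in> set \<Gamma>. mso_form D \<psi> \<Longrightarrow> mso_prf D \<Gamma> \<phi>"
| ax: "mso_ax D \<phi> \<Longrightarrow> mso_form D \<phi> \<Longrightarrow> \<forall>\<psi> \<in> set \<Gamma>. mso_form D \<psi> \<Longrightarrow> mso_prf D \<Gamma> \<phi>"
| orI1: "mso_prf D \<Gamma> \<phi> \<Longrightarrow> mso_form D \<psi> \<Longrightarrow> mso_prf D \<Gamma> (MOr \<phi> \<psi>)"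
| orI2: "mso_prf D \<Gamma> \<psi> \<Longrightarrow> mso_form D \<phi> \<Longrightarrow> mso_prf D \<Gamma> (MOr \<phi> \<psi>)"
| orE: "mso_prf D \<Gamma> (MOr \<phi> \<psi>) \<Longrightarrow> mso_prf D (\<phi> # \<Gamma>) \<chi> \<Longrightarrow> mso_prf D (\<psi> # \<Gamma>) \<chi> \<Longrightarrow>
    mso_prf D \<Gamma> \<chi>"
| notI: "mso_prf D (\<phi> # \<Gamma>) \<psi> \<Longrightarrow> mso_prf D (\<phi> # \<Gamma>) (MNot \<psi>) \<Longrightarrow> mso_prf D \<Gamma> (MNot \<phi>)"
| ccontr: "mso_prf D (MNot \<phi> # \<Gamma>) \<psi> \<Longrightarrow> mso_prf D (MNot \<phi> # \<Gamma>) (MNot \<psi>) \<Longrightarrow> mso_prf D \<Gamma> \<phi>"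
| exI_I: "dir_term D t \<Longrightarrow> mso_prf D \<Gamma> (minstI t \<phi>) \<Longrightarrow> mso_prf D \<Gamma> (MExI \<phi>)"
| exI_E: "mso_prf D \<Gamma> (MExI \<phi>) \<Longrightarrow> mso_prf D (\<phi> # map mliftI \<Gamma>) (mliftI \<psi>) \<Longrightarrow> mso_prf D \<Gamma> \<psi>"
| exP_I: "mso_prf D \<Gamma> (minstP X \<phi>) \<Longrightarrow> mso_prf D \<Gamma> (MExP \<phi>)"
| exP_E: "mso_prf D \<Gamma> (MExP \<phi>) \<Longrightarrow> mso_prf D (\<phi> # map mliftP \<Gamma>) (mliftP \<psi>) \<Longrightarrow> mso_prf D \<Gamma> \<psi>"

definition mso_provable :: "hf \<Rightarrow> mso \<Rightarrow> bool" where
  "mso_provable D \<phi> \<longleftrightarrow> mso_prf D [] \<phi>"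


section \<open>FSO\<close>

text \<open>
  \<open>FFun F t M\<close> is the atom \<open>F(t) = M\<close>; \<open>FHEq\<close> and \<open>FHIn\<close> are equality and
  membership of HF-sets; \<open>FExI \<phi>\<close> is \<open>(\<exists>x)\<phi>\<close>, \<open>FExH K \<phi>\<close> is
  \<open>(\<exists>k \<in> K)\<phi>\<close> and \<open>FExF K \<phi>\<close> is \<open>(\<exists>F : K)\<phi>\<close>.  The bound \<open>K\<close> is
  outside the scope of the variable which it bounds.
\<close>

datatype fso =
    FEq iterm iterm
  | FLess iterm iterm
  | FFun nat iterm hterm
  | FHEq hterm hterm
  | FHIn hterm hterm
  | FNot fso
  | FOr fso fso
  | FExI fso
  | FExH hterm fso
  | FExF hterm fso

primrec fsubst :: "(nat \<Rightarrow> iterm) \<Rightarrow> (nat \<Rightarrow> hterm) \<Rightarrow> (nat \<Rightarrow> nat) \<Rightarrow> fso \<Rightarrow> fso" where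
  "fsubst \<sigma> \<tau> \<rho> (FEq t u) = FEq (isubst \<sigma> t) (isubst \<sigma> u)"
| "fsubst \<sigma> \<tau> \<rho> (FLess t u) = FLess (isubst \<sigma> t) (isubst \<sigma> u)"
| "fsubst \<sigma> \<tau> \<rho> (FFun F t M) = FFun (\<rho> F) (isubst \<sigma> t) (hsubst \<tau> M)"
| "fsubst \<sigma> \<tau> \<rho> (FHEq K L) = FHEq (hsubst \<tau> K) (hsubst \<tau> L)"
| "fsubst \<sigma> \<tau> \<rho> (FHIn K L) = FHIn (hsubst \<tau> K) (hsubst \<tau> L)"
| "fsubst \<sigma> \<tau> \<rho> (FNot \<phi>) = FNot (fsubst \<sigma> \<tau> \<rho> \<phi>)"
| "fsubst \<sigma> \<tau> \<rho> (FOr \<phi> \<psi>) = FOr (fsubst \<sigma> \<tau> \<rho> \<phi>) (fsubst \<sigma> \<tau> \<rho> \<psi>)"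
| "fsubst \<sigma> \<tau> \<rho> (FExI \<phi>) = FExI (fsubst (iup \<sigma>) \<tau> \<rho> \<phi>)"
| "fsubst \<sigma> \<tau> \<rho> (FExH K \<phi>) = FExH (hsubst \<tau> K) (fsubst \<sigma> (hup \<tau>) \<rho> \<phi>)"
| "fsubst \<sigma> \<tau> \<rho> (FExF K \<phi>) = FExF (hsubst \<tau> K) (fsubst \<sigma> \<tau> (rup \<rho>) \<phi>)"

abbreviation fliftI :: "fso \<Rightarrow> fso" where
  "fliftI \<equiv> fsubst (\<lambda>i. IVar (Suc i)) HVar id"
abbreviation fliftH :: "fso \<Rightarrow> fso" where
  "fliftH \<equiv> fsubst IVar (\<lambda>i. HVar (Suc i)) id"
abbreviation fliftF :: "fso \<Rightarrow> fso" where
  "fliftF \<equiv> fsubst IVar HVar Suc"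
abbreviation finstI :: "iterm \<Rightarrow> fso \<Rightarrow> fso" where
  "finstI t \<equiv> fsubst (case_nat t IVar) HVar id"
abbreviation finstH :: "hterm \<Rightarrow> fso \<Rightarrow> fso" where
  "finstH K \<equiv> fsubst IVar (case_nat K HVar) id"
abbreviation finstF :: "nat \<Rightarrow> fso \<Rightarrow> fso" where
  "finstF F \<equiv> fsubst IVar HVar (case_nat F id)"

abbreviation FAnd :: "fso \<Rightarrow> fso \<Rightarrow> fso" where
  "FAnd \<phi> \<psi> \<equiv> FNot (FOr (FNot \<phi>) (FNot \<psi>))"
abbreviation FImp :: "fso \<Rightarrow> fso \<Rightarrow> fso" where
  "FImp \<phi> \<psi> \<equiv> FOr (FNot \<phi>) \<psi>"
abbreviation FIff :: "fso \<Rightarrow> fso \<Rightarrow> fso" where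
  "FIff \<phi> \<psi> \<equiv> FAnd (FImp \<phi> \<psi>) (FImp \<psi> \<phi>)"
abbreviation FAllI :: "fso \<Rightarrow> fso" where
  "FAllI \<phi> \<equiv> FNot (FExI (FNot \<phi>))"
abbreviation FAllH :: "hterm \<Rightarrow> fso \<Rightarrow> fso" where
  "FAllH K \<phi> \<equiv> FNot (FExH K (FNot \<phi>))"
abbreviation FLeq :: "iterm \<Rightarrow> iterm \<Rightarrow> fso" where
  "FLeq t u \<equiv> FOr (FLess t u) (FEq t u)"
abbreviation FBot :: fso where
  "FBot \<equiv> FNot (FHEq (HConst hf_zero) (HConst hf_zero))"

text \<open>The typing \<open>F : K\<close> of a Function variable, i.e.
  \<open>(\<forall>x)(\<exists>k \<in> K) F(x) = k\<close>.\<close>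

definition FTyped :: "nat \<Rightarrow> hterm \<Rightarrow> fso" where
  "FTyped F K = FAllI (FExH K (FFun F (IVar 0) (HVar 0)))"

primrec fso_form :: "hf \<Rightarrow> fso \<Rightarrow> bool" where
  "fso_form D (FEq t u) \<longleftrightarrow> dir_term D t \<and> dir_term D u"
| "fso_form D (FLess t u) \<longleftrightarrow> dir_term D t \<and> dir_term D u"
| "fso_form D (FFun F t M) \<longleftrightarrow> dir_term D t \<and> hf_term M"
| "fso_form D (FHEq K L) \<longleftrightarrow> hf_term K \<and> hf_term L"
| "fso_form D (FHIn K L) \<longleftrightarrow> hf_term K \<and> hf_term L"
| "fso_form D (FNot \<phi>) \<longleftrightarrow> fso_form D \<phi>"
| "fso_form D (FOr \<phi> \<psi>) \<longleftrightarrow> fso_form D \<phi> \<and> fso_form D \<psi>"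
| "fso_form D (FExI \<phi>) \<longleftrightarrow> fso_form D \<phi>"
| "fso_form D (FExH K \<phi>) \<longleftrightarrow> hf_term K \<and> fso_form D \<phi>"
| "fso_form D (FExF K \<phi>) \<longleftrightarrow> hf_term K \<and> fso_form D \<phi>"

text \<open>\<open>hf_formula \<phi> \<psi>\<close>: the FSO-formula \<open>\<phi>\<close> only speaks about HF-sets, and
  \<open>\<psi>\<close> is the same formula (all of whose quantifiers are bounded) in the language of set
  theory.\<close>

inductive hf_formula :: "fso \<Rightarrow> sform \<Rightarrow> bool" where
  "hf_formula (FHEq K L) (SEq K L)"
| "hf_formula (FHIn K L) (SIn K L)"
| "hf_formula \<phi> \<psi> \<Longrightarrow> hf_formula (FNot \<phi>) (SNot \<psi>)"
| "hf_formula \<phi> \<psi> \<Longrightarrow> hf_formula \<phi>' \<psi>' \<Longrightarrow> hf_formula (FOr \<phi> \<phi>') (SOr \<psi> \<psi>')"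
| "hf_formula \<phi> \<psi> \<Longrightarrow>
   hf_formula (FExH K \<phi>) (SEx (SAnd (SIn (HVar 0) (hlift K)) \<psi>))"

text \<open>
  \<open>fun_repl e E k \<phi>\<close> is \<open>\<phi>[G(k)//F]\<close>, where \<open>E\<close> is \<open>L\<^sup>K\<close> and where
  \<open>G\<close> takes over the index \<open>e\<close> of \<open>F\<close>: each atom \<open>F(t) = M\<close> becomes
  \<open>(\<exists>f \<in> L\<^sup>K)(G(t) = f \<and> f(k) = M)\<close>.
\<close>

primrec fun_repl :: "nat \<Rightarrow> hterm \<Rightarrow> hterm \<Rightarrow> fso \<Rightarrow> fso" where
  "fun_repl e E k (FEq t u) = FEq t u"
| "fun_repl e E k (FLess t u) = FLess t u"
| "fun_repl e E k (FFun F t M) =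
    (if F = e
     then FExH E (FAnd (FFun e t (HVar 0)) (FHEq (happ (HVar 0) (hlift k)) (hlift M)))
     else FFun F t M)"
| "fun_repl e E k (FHEq K L) = FHEq K L"
| "fun_repl e E k (FHIn K L) = FHIn K L"
| "fun_repl e E k (FNot \<phi>) = FNot (fun_repl e E k \<phi>)"
| "fun_repl e E k (FOr \<phi> \<psi>) = FOr (fun_repl e E k \<phi>) (fun_repl e E k \<psi>)"
| "fun_repl e E k (FExI \<phi>) = FExI (fun_repl e E k \<phi>)"
| "fun_repl e E k (FExH K \<phi>) = FExH K (fun_repl e (hlift E) (hlift k) \<phi>)"
| "fun_repl e E k (FExF K \<phi>) = FExF K (fun_repl (Suc e) E k \<phi>)"

text \<open>
  In \<open>hf_skolem\<close>, the function symbol \<open>g\<^sub>\<psi>\<close> exists for every provable statement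
  \<open>\<forall>k\<^sub>1 \<dots> k\<^sub>n. \<exists>!l. \<psi>\<close>, but its defining property is an axiom of FSO only if it is
  a formula of FSO, that is, if \<open>\<psi>\<close> is bounded.  Properties of a \<open>g\<^sub>\<psi>\<close> with
  unbounded \<open>\<psi>\<close> are axioms nevertheless: a bounded theorem \<open>\<theta>\<close> of Skolemized ZFC without
  infinity, which may contain \<open>g\<^sub>\<psi>\<close>, yields the provable statement
  \<open>\<exists>!l. l = \<emptyset> \<and> \<theta>\<close>.

  In the choice axioms, index \<open>0\<close> of \<open>\<phi>\<close> is the existentially quantified variable of the
  premise; the other quantified variable of the premise is HF-index \<open>1\<close>
  (\<open>choice_hf\<close>), Individual index \<open>0\<close> (\<open>choice_fun\<close>) or HF-index \<open>0\<close>
  (\<open>choice_iter\<close>).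
\<close>

inductive fso_ax :: "hf \<Rightarrow> fso \<Rightarrow> bool" for D :: hf where
  eq_refl: "fso_ax D (FEq t t)"
| eq_subst: "fso_ax D (FImp (FEq t u) (FImp (finstI t \<phi>) (finstI u \<phi>)))"
| hf_eq_refl: "fso_ax D (FHEq K K)"
| hf_eq_subst: "fso_ax D (FImp (FHEq K L) (FImp (finstH K \<phi>) (finstH L \<phi>)))"
| fun_eq: "fso_ax D (FImp (FFun F t K) (FImp (FFun F t L) (FHEq K L)))"
| succ_root: "fso_ax D (FNot (FEq (Succ d t) Root))"
| succ_inj: "fso_ax D (FImp (FEq (Succ d t) (Succ d u)) (FEq t u))"
| succ_distinct: "d \<noteq> e \<Longrightarrow> fso_ax D (FNot (FEq (Succ d t) (Succ e u)))"
| less_irrefl: "fso_ax D (FNot (FLess t t))"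
| less_trans: "fso_ax D (FImp (FLess t u) (FImp (FLess u v) (FLess t v)))"
| less_root: "fso_ax D (FNot (FLess t Root))"
| less_succ: "fso_ax D (FIff (FLess t (Succ d u)) (FLeq t u))"
| induction:
    "set ds = fset (elts D) \<Longrightarrow>
     fso_ax D (FImp (finstI Root \<phi>)
       (foldr (\<lambda>d. FImp (FAllI (FImp \<phi>
           (fsubst (case_nat (Succ d (IVar 0)) (\<lambda>i. IVar (Suc i))) HVar id \<phi>)))) ds
         (FAllI \<phi>)))"
| hf_constant:
    "set \<kappa>s = fset (elts \<kappa>) \<Longrightarrow>
     fso_ax D (FIff (FHIn K (HConst \<kappa>)) (foldr (\<lambda>\<mu>. FOr (FHEq K (HConst \<mu>))) \<kappa>s FBot))"
| hf_skolem:
    "hf_formula \<phi> \<psi> \<Longrightarrow> hf_term (HFun \<psi> Ks) \<Longrightarrow>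
     fso_ax D (fsubst IVar (skolem_inst \<psi> Ks) id \<phi>)"
| choice_hf:
    "fso_ax D (FImp (FAllH K (FExH (hlift L) \<phi>))
       (FExH (hexp L K) (FAllH (hlift K)
         (fsubst IVar
           (case_nat (happ (HVar 1) (HVar 0)) (case_nat (HVar 0) (\<lambda>i. HVar (i + 2)))) id \<phi>))))"
| choice_fun:
    "fso_ax D (FImp (FAllI (FExH K \<phi>))
       (FExF K (FAllI (FExH K (FAnd (FFun 0 (IVar 0) (HVar 0)) (fliftF \<phi>))))))"
| choice_iter:
    "fso_ax D (FImp (FAllH K (FExF (hlift L) \<phi>))
       (FExF (hexp L K) (FAllH K (fun_repl 0 (hlift (hexp L K)) (HVar 0) \<phi>))))"

inductive fso_prf :: "hf \<Rightarrow> fso list \<Rightarrow> fso \<Rightarrow> bool" for D :: hf where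
  hyp: "\<phi> \<in> set \<Gamma> \<Longrightarrow> \<forall>\<psi> \<in> set \<Gamma>. fso_form D \<psi> \<Longrightarrow> fso_prf D \<Gamma> \<phi>"
| ax: "fso_ax D \<phi> \<Longrightarrow> fso_form D \<phi> \<Longrightarrow> \<forall>\<psi> \<in> set \<Gamma>. fso_form D \<psi> \<Longrightarrow> fso_prf D \<Gamma> \<phi>"
| orI1: "fso_prf D \<Gamma> \<phi> \<Longrightarrow> fso_form D \<psi> \<Longrightarrow> fso_prf D \<Gamma> (FOr \<phi> \<psi>)"
| orI2: "fso_prf D \<Gamma> \<psi> \<Longrightarrow> fso_form D \<phi> \<Longrightarrow> fso_prf D \<Gamma> (FOr \<phi> \<psi>)"
| orE: "fso_prf D \<Gamma> (FOr \<phi> \<psi>) \<Longrightarrow> fso_prf D (\<phi> # \<Gamma>) \<chi> \<Longrightarrow> fso_prf D (\<psi> # \<Gamma>) \<chi> \<Longrightarrow>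
    fso_prf D \<Gamma> \<chi>"
| notI: "fso_prf D (\<phi> # \<Gamma>) \<psi> \<Longrightarrow> fso_prf D (\<phi> # \<Gamma>) (FNot \<psi>) \<Longrightarrow> fso_prf D \<Gamma> (FNot \<phi>)"
| ccontr: "fso_prf D (FNot \<phi> # \<Gamma>) \<psi> \<Longrightarrow> fso_prf D (FNot \<phi> # \<Gamma>) (FNot \<psi>) \<Longrightarrow> fso_prf D \<Gamma> \<phi>"
| exI_I: "dir_term D t \<Longrightarrow> fso_prf D \<Gamma> (finstI t \<phi>) \<Longrightarrow> fso_prf D \<Gamma> (FExI \<phi>)"
| exI_E: "fso_prf D \<Gamma> (FExI \<phi>) \<Longrightarrow> fso_prf D (\<phi> # map fliftI \<Gamma>) (fliftI \<psi>) \<Longrightarrow> fso_prf D \<Gamma> \<psi>"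
| exH_I: "fso_prf D \<Gamma> (FHIn K L) \<Longrightarrow> fso_prf D \<Gamma> (finstH K \<phi>) \<Longrightarrow> fso_prf D \<Gamma> (FExH L \<phi>)"
| exH_E: "fso_prf D \<Gamma> (FExH L \<phi>) \<Longrightarrow>
    fso_prf D (FHIn (HVar 0) (hlift L) # \<phi> # map fliftH \<Gamma>) (fliftH \<psi>) \<Longrightarrow> fso_prf D \<Gamma> \<psi>"
| exF_I: "fso_prf D \<Gamma> (FTyped F L) \<Longrightarrow> fso_prf D \<Gamma> (finstF F \<phi>) \<Longrightarrow> fso_prf D \<Gamma> (FExF L \<phi>)"
| exF_E: "fso_prf D \<Gamma> (FExF L \<phi>) \<Longrightarrow>
    fso_prf D (FTyped 0 L # \<phi> # map fliftF \<Gamma>) (fliftF \<psi>) \<Longrightarrow> fso_prf D \<Gamma> \<psi>"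

definition fso_provable :: "hf \<Rightarrow> fso \<Rightarrow> bool" where
  "fso_provable D \<phi> \<longleftrightarrow> fso_prf D [] \<phi>"


section \<open>The translation from MSO to FSO\<close>

text \<open>The Function variable \<open>F\<^sub>X\<close> has the index of \<open>X\<close>.\<close>

primrec mso_to_fso :: "mso \<Rightarrow> fso" where
  "mso_to_fso (MPred X t) = FFun X t (HConst hf_one)"
| "mso_to_fso (MEq t u) = FEq t u"
| "mso_to_fso (MLess t u) = FLess t u"
| "mso_to_fso (MNot \<phi>) = FNot (mso_to_fso \<phi>)"
| "mso_to_fso (MOr \<phi> \<psi>) = FOr (mso_to_fso \<phi>) (mso_to_fso \<psi>)"
| "mso_to_fso (MExI \<phi>) = FExI (mso_to_fso \<phi>)"
| "mso_to_fso (MExP \<phi>) = FExF (HConst hf_two) (mso_to_fso \<phi>)"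

end

theory Submission
  imports Defs "HOL-Library.Countable_Set"
begin

text \<open>
  Conservativity is proved semantically.  By a Henkin construction, an unprovable formula of MSO
  fails in a model whose individuals are terms and whose Predicates are variables.  Such a model
  interprets FSO: HF-terms are evaluated in \<open>V\<^sub>\<omega>\<close>, where Skolemized set theory without
  infinity is sound, and the Functions into \<open>K\<close> are the maps \<open>f\<close> from the individuals to
  \<open>K\<close> such that every fibre \<open>{t. f t = k}\<close> is a Predicate.  Coding a Function by its finitely
  many fibres shows that sets definable in FSO are Predicates, whence induction and the choice axioms.

  Conversely, an MSO-derivation is translated rule by rule under the assumptions
  \<open>F\<^sub>0 : 2, \<dots>, F\<^sub>n : 2\<close>, since Functions are typed but Predicates are not; comprehension is
  choice of the characteristic function.  The assumptions are discharged at the end because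
  some Function of type \<open>2\<close> exists.
\<close>

section \<open>Set theory in the hereditarily finite sets\<close>

text \<open>The obstacle to reading FSO back into MSO is that the number of Predicates needed for
  \<open>F : K\<close> depends on the value of \<open>K\<close>, an HF-term which may contain bound
  HF-variables. A translation by recursion on formulas would have to carry these values along.
  Semantically they can be fixed first: under a given HF-environment, \<open>K\<close> is a concrete
  finite set, HF-terms behave as constants, and bounded HF-quantifiers are finite disjunctions. This
  relies on the HF-sort being interpreted by the genuine \<open>V\<^sub>\<omega>\<close>, while only
  the tree sorts come from the Henkin model. In the choice axioms the chosen Function must itself
  have Predicates as fibres, so over the individuals, of which there are infinitely many, the choice
  has to be made definably; over the elements of an HF-set it may be arbitrary. In the other
  direction, the obstacle is the introduction of a Predicate quantifier: its witness may be a
  variable that occurs neither in the hypotheses nor in the conclusion, so the typings that a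
  derivation needs cannot be read off its end formula.\<close>

text \<open>
  The free indices of \<open>\<phi>\<close> beyond the arguments in \<open>HFun \<phi> Ks\<close> are junk; giving them a constant
  value makes evaluation commute with substitution even for ill-formed terms.
\<close>

primrec heval :: "(nat \<Rightarrow> hf) \<Rightarrow> hterm \<Rightarrow> hf"
  and seval :: "(nat \<Rightarrow> hf) \<Rightarrow> sform \<Rightarrow> bool"
where
  "heval e (HVar i) = e i"
| "heval e (HConst \<kappa>) = \<kappa>"
| "heval e (HFun \<phi> Ks) =
    (THE v. seval (case_nat v (\<lambda>i. if i < length Ks then map (heval e) Ks ! i else hf_zero)) \<phi>)"
| "seval e (SEq K L) \<longleftrightarrow> heval e K = heval e L"
| "seval e (SIn K L) \<longleftrightarrow> heval e K |\<in>| elts (heval e L)"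
| "seval e (SNot \<phi>) \<longleftrightarrow> \<not> seval e \<phi>"
| "seval e (SOr \<phi> \<psi>) \<longleftrightarrow> seval e \<phi> \<or> seval e \<psi>"
| "seval e (SEx \<phi>) \<longleftrightarrow> (\<exists>v. seval (case_nat v e) \<phi>)"

lemma heval_case_nat [simp]: "(\<lambda>i. heval e (case_nat a g i)) = case_nat (heval e a) (\<lambda>i. heval e (g i))"
  by (rule ext) (simp split: nat.split)

lemma heval_hsubst [simp]: "heval e (hsubst \<tau> K) = heval (\<lambda>i. heval e (\<tau> i)) K"
proof (induction K rule: hterm.induct[where ?P2.0="\<lambda>_. True"])
  case (HFun \<phi> Ks)
  then have *: "map (heval e) (map (hsubst \<tau>) Ks) = map (heval (\<lambda>i. heval e (\<tau> i))) Ks"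
    by simp
  show ?case by (simp only: hsubst.simps heval.simps * length_map)
qed (simp_all)

lemma heval_hup [simp]: "(\<lambda>i. heval (case_nat v e) (hup \<tau> i)) = case_nat v (\<lambda>i. heval e (\<tau> i))"
  by (rule ext) (simp add: hup_def split: nat.split)

lemma seval_ssubst [simp]: "seval e (ssubst \<tau> \<phi>) = seval (\<lambda>i. heval e (\<tau> i)) \<phi>"
  by (induction \<phi> arbitrary: e \<tau> rule: sform.induct[where ?P1.0="\<lambda>_. True"]) simp_all

lemma seval_SEx1 [simp]: "seval e (SEx1 \<phi>) \<longleftrightarrow> (\<exists>!v. seval (case_nat v e) \<phi>)"
  unfolding SEx1_def by simp blast

lemma seval_abbrevs:
  "seval e (SAll \<phi>) \<longleftrightarrow> (\<forall>v. seval (case_nat v e) \<phi>)"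
  "seval e (SImp \<phi> \<psi>) \<longleftrightarrow> (seval e \<phi> \<longrightarrow> seval e \<psi>)"
  "seval e (SAnd \<phi> \<psi>) \<longleftrightarrow> (seval e \<phi> \<and> seval e \<psi>)"
  by auto

lemmas seval_axiom = seval_abbrevs seval.simps(5) iff_conv_conj_imp[symmetric]

lemma heval_cong: "hbound n K \<Longrightarrow> (\<And>i. i < n \<Longrightarrow> e i = e' i) \<Longrightarrow> heval e K = heval e' K"
proof (induction K rule: hterm.induct[where ?P2.0="\<lambda>_. True"])
  case (HFun \<phi> Ks)
  then have *: "map (heval e) Ks = map (heval e') Ks"
    by (auto simp: list_all_iff)
  show ?case by (simp only: heval.simps *)
qed (simp_all)

lemma seval_cong: "sbound n \<phi> \<Longrightarrow> (\<And>i. i < n \<Longrightarrow> e i = e' i) \<Longrightarrow> seval e \<phi> = seval e' \<phi>"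
proof (induction \<phi> arbitrary: n e e' rule: sform.induct[where ?P1.0="\<lambda>_. True"])
  case (SEx \<phi>)
  have "seval (case_nat v e) \<phi> = seval (case_nat v e') \<phi>" for v
    using SEx by (intro SEx.IH[of "Suc n"]) (auto split: nat.split)
  then show ?case by simp
next
  case (SEq K L) then show ?case using heval_cong[of n _ e e'] by simp
next
  case (SIn K L) then show ?case using heval_cong[of n _ e e'] by simp
next
  case (SNot \<phi>) then show ?case by (metis sbound.simps(3) seval.simps(3))
next
  case (SOr \<phi> \<psi>) then show ?case by (metis sbound.simps(4) seval.simps(4))
qed simp_all

text \<open>The outermost quantifier binds the highest index; the induction therefore instantiates
  it first, with \<open>g n\<close> for \<open>Suc n\<close> quantifiers, and passes that value on
  inside the environment.\<close>

lemma seval_SAlls: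
  "seval e (SAlls n \<phi>) \<Longrightarrow> seval (\<lambda>i. if i < n then g i else e (i - n)) \<phi>"
proof (induction n arbitrary: e)
  case (Suc n)
  then have "seval (case_nat (g n) e) (SAlls n \<phi>)"
    by (simp add: SAlls_def)
  from Suc.IH[OF this]
  have "seval (\<lambda>i. if i < n then g i else case_nat (g n) e (i - n)) \<phi>" .
  moreover have "(\<lambda>i. if i < n then g i else case_nat (g n) e (i - n)) =
      (\<lambda>i. if i < Suc n then g i else e (i - Suc n))"
    by (rule ext) (auto split: nat.split simp: less_Suc_eq, metis Suc_diff_Suc diff_Suc_1' linorder_less_linear nat.inject not_less_eq)
  ultimately show ?case by simp
qed (simp add: SAlls_def)

subsection \<open>Pairs and functions\<close>

definition hpair :: "hf \<Rightarrow> hf \<Rightarrow> hf" where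
  "hpair a b = HF {|HF {|a|}, HF {|a, b|}|}"

lemma hpair_inject [simp]: "hpair a b = hpair c d \<longleftrightarrow> a = c \<and> b = d"
  unfolding hpair_def by (auto simp: fset_inject[symmetric] doubleton_eq_iff)

lemma elts_eq_iff: "K = L \<longleftrightarrow> (\<forall>x. x |\<in>| elts K \<longleftrightarrow> x |\<in>| elts L)"
  by (metis fset_eqI hf.expand)

lemma seval_upair [simp]:
  "seval e (s_upair z a b) \<longleftrightarrow> heval e z = HF {|heval e a, heval e b|}"
  unfolding s_upair_def elts_eq_iff[of "heval e z"] by auto

lemma seval_opair [simp]:
  "seval e (s_opair p a b) \<longleftrightarrow> heval e p = hpair (heval e a) (heval e b)"
  unfolding s_opair_def hpair_def elts_eq_iff[of "heval e p"] by auto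

lemma seval_graph [simp]:
  "seval e (s_graph f a b) \<longleftrightarrow> hpair (heval e a) (heval e b) |\<in>| elts (heval e f)"
  unfolding s_graph_def by simp

definition hfun :: "hf \<Rightarrow> hf \<Rightarrow> hf \<Rightarrow> bool" where
  "hfun f K L \<longleftrightarrow>
    (\<forall>p. p |\<in>| elts f \<longrightarrow> (\<exists>a b. a |\<in>| elts K \<and> b |\<in>| elts L \<and> p = hpair a b)) \<and>
    (\<forall>a. a |\<in>| elts K \<longrightarrow> (\<exists>!b. hpair a b |\<in>| elts f))"

lemma seval_function [simp]:
  "seval e (s_function f K L) \<longleftrightarrow> hfun (heval e f) (heval e K) (heval e L)"
  unfolding s_function_def hfun_def by auto

text \<open>\<open>hexp\<close> evaluates to a definite description, so its value is known only
  after a set with the right members has been exhibited; extensionality then gives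
  uniqueness.\<close>

lemma mem_hexp [simp]:
  "f |\<in>| elts (heval e (hexp L K)) \<longleftrightarrow> hfun f (heval e K) (heval e L)"
proof -
  let ?K = "heval e K" and ?L = "heval e L"
  \<comment> \<open>The \<open>ffUnion\<close> is the product of \<open>?K\<close> and
    \<open>?L\<close>. Every function between them is a subset of it, so filtering its power set
    loses nothing.\<close>
  define E where
    "E = HF (ffilter (\<lambda>f. hfun f ?K ?L) (HF |`| fPow (ffUnion ((\<lambda>a. hpair a |`| elts ?L) |`| elts ?K))))"
  have E: "f |\<in>| elts E \<longleftrightarrow> hfun f ?K ?L" for f
  proof -
    have "f \<in> HF ` fset (fPow (ffUnion ((\<lambda>a. hpair a |`| elts ?L) |`| elts ?K)))" if "hfun f ?K ?L"
    proof (rule image_eqI[of _ _ "elts f"])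
      have "p |\<in>| ffUnion ((\<lambda>a. hpair a |`| elts ?L) |`| elts ?K)" if "p |\<in>| elts f" for p
      proof -
        from that \<open>hfun f ?K ?L\<close> obtain a b where "a |\<in>| elts ?K" "b |\<in>| elts ?L" "p = hpair a b"
          unfolding hfun_def by blast
        then show ?thesis by (auto simp: ffUnion.rep_eq)
      qed
      then show "elts f \<in> fset (fPow (ffUnion ((\<lambda>a. hpair a |`| elts ?L) |`| elts ?K)))"
        by (auto intro!: fPowI)
    qed simp
    then show ?thesis unfolding E_def by auto
  qed
  have "(\<forall>f. f |\<in>| elts v \<longleftrightarrow> hfun f ?K ?L) \<longleftrightarrow> v = E" for v
    unfolding elts_eq_iff[of v E] E ..
  then have "heval e (hexp L K) = E"
    unfolding hexp_def heval.simps s_exp_def seval_axiom by simp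
  then show ?thesis using E by simp
qed

lemma heval_happ_eq:
  assumes "\<exists>!b. hpair (heval e k) b |\<in>| elts (heval e f)"
    and "hpair (heval e k) b |\<in>| elts (heval e f)"
  shows "heval e (happ f k) = b"
  using assms unfolding happ_def
  by (simp add: s_app_def) blast

definition hgraph :: "(hf \<Rightarrow> hf) \<Rightarrow> hf \<Rightarrow> hf" where
  "hgraph g K = HF ((\<lambda>k. hpair k (g k)) |`| elts K)"

lemma hfun_hgraph: "(\<And>k. k |\<in>| elts K \<Longrightarrow> g k |\<in>| elts L) \<Longrightarrow> hfun (hgraph g K) K L"
  unfolding hfun_def hgraph_def by auto

lemma hgraph_eq_iff: "hgraph g K = hgraph h K \<longleftrightarrow> (\<forall>k. k |\<in>| elts K \<longrightarrow> g k = h k)"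
proof
  assume eq: "hgraph g K = hgraph h K"
  show "\<forall>k. k |\<in>| elts K \<longrightarrow> g k = h k"
  proof (intro allI impI)
    fix k assume "k |\<in>| elts K"
    then have "hpair k (g k) |\<in>| elts (hgraph h K)"
      unfolding eq[symmetric] by (auto simp: hgraph_def)
    then show "g k = h k" by (auto simp: hgraph_def)
  qed
next
  assume "\<forall>k. k |\<in>| elts K \<longrightarrow> g k = h k"
  then show "hgraph g K = hgraph h K"
    unfolding hgraph_def hf.inject by (intro fset.map_cong0) simp
qed

lemma heval_happ_hgraph:
  "heval e f = hgraph g K \<Longrightarrow> heval e k |\<in>| elts K \<Longrightarrow> heval e (happ f k) = g (heval e k)"
  by (rule heval_happ_eq) (auto simp: hgraph_def)

subsection \<open>Soundness of Skolemized set theory\<close>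

lemma wf_mem: "wf {(x, y). x |\<in>| elts y}"
proof (rule wfUNIVI)
  fix P and x :: hf
  assume IH: "\<forall>x. (\<forall>y. (y, x) \<in> {(x, y). x |\<in>| elts y} \<longrightarrow> P y) \<longrightarrow> P x"
  show "P x"
    by (induction x) (rule IH[rule_format], simp)
qed

lemma mem_irrefl: "x |\<notin>| elts x"
  using wf_mem by (auto dest: wf_not_refl)

lemma seval_enum:
  "seval e (foldr (\<lambda>\<mu>. SOr (SEq K (HConst \<mu>))) \<kappa>s SBot) \<longleftrightarrow> heval e K \<in> set \<kappa>s"
  by (induction \<kappa>s) auto

text \<open>Finite sets are closed under all the set existence axioms listed: each witness is built
  by an operation on \<open>fset\<close>, and foundation is \<open>wf_mem\<close>. Infinity, which
  fails here, is not among them.\<close>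

lemma seval_zfc: "zfc_ax \<phi> \<Longrightarrow> seval e \<phi>"
proof (induction rule: zfc_ax.induct)
  case (hf_constant \<kappa>s \<kappa> K)
  then show ?case by (auto simp: seval_enum)
next
  case foundation
  have "\<exists>y. y |\<in>| elts x \<and> (\<forall>z. z |\<in>| elts y \<longrightarrow> z |\<notin>| elts x)" if "w |\<in>| elts x" for x w
    using wfE_min'[OF wf_mem, of "fset (elts x)"] that by auto
  then show ?case unfolding seval_axiom by simp blast
next
  case pairing
  have "\<exists>z. \<forall>w. w |\<in>| elts z \<longleftrightarrow> w = x \<or> w = y" for x y :: hf
    by (rule exI[of _ "HF {|x, y|}"]) auto
  then show ?case unfolding seval_axiom by simp
next
  case union
  have "\<exists>z. \<forall>w. w |\<in>| elts z \<longleftrightarrow> (\<exists>y. y |\<in>| elts x \<and> w |\<in>| elts y)" for x :: hf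
    by (rule exI[of _ "HF (ffUnion (elts |`| elts x))"]) (auto simp: ffUnion.rep_eq)
  then show ?case unfolding seval_axiom by simp
next
  case powerset
  have "\<exists>z. \<forall>w. w |\<in>| elts z \<longleftrightarrow> (\<forall>y. y |\<in>| elts w \<longrightarrow> y |\<in>| elts x)" for x :: hf
  proof (rule exI[of _ "HF (HF |`| fPow (elts x))"], intro allI)
    fix w
    have "w |\<in>| HF |`| fPow (elts x) \<longleftrightarrow> elts w |\<subseteq>| elts x"
      by (metis fPowD fPowI fimageE fimage_eqI hf.collapse hf.sel)
    then show "w |\<in>| elts (HF (HF |`| fPow (elts x))) \<longleftrightarrow> (\<forall>y. y |\<in>| elts w \<longrightarrow> y |\<in>| elts x)"
      by auto
  qed
  then show ?case unfolding seval_axiom by simp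
next
  case (separation \<phi>)
  have "\<exists>z. \<forall>w. w |\<in>| elts z \<longleftrightarrow> w |\<in>| elts x \<and> P w" for x P
    by (rule exI[of _ "HF (ffilter P (elts x))"]) auto
  from this[of _ "\<lambda>w. seval (case_nat w e) \<phi>"] show ?case
    unfolding seval_axiom by (simp add: numeral_eq_Suc)
next
  case (replacement \<phi>)
  have "\<exists>z. \<forall>w. w |\<in>| elts z \<longleftrightarrow> (\<exists>y. y |\<in>| elts x \<and> P y w)"
    if "\<And>a b c. P a b \<Longrightarrow> P a c \<Longrightarrow> b = c" for x P
  \<comment> \<open>The relation may be partial; the filter removes the \<open>y\<close> without a
    value before \<open>THE\<close> is applied.\<close>
  proof (rule exI[of _ "HF ((\<lambda>y. THE w. P y w) |`| ffilter (\<lambda>y. \<exists>w. P y w) (elts x))"], intro allI)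
    fix w
    have "(THE w. P y w) = w'" if "P y w'" for y w'
      using that \<open>\<And>a b c. P a b \<Longrightarrow> P a c \<Longrightarrow> b = c\<close> by blast
    then show "w |\<in>| elts (HF ((\<lambda>y. THE w. P y w) |`| ffilter (\<lambda>y. \<exists>w. P y w) (elts x))) \<longleftrightarrow>
        (\<exists>y. y |\<in>| elts x \<and> P y w)"
      by (auto simp: image_iff)
  qed
  note * = this[of "\<lambda>y w. seval (case_nat w (case_nat y e)) \<phi>"]
  show ?case unfolding seval_axiom using * by (simp add: numeral_eq_Suc)
next
  case choice
  have "\<exists>t. \<forall>x. x |\<in>| elts F \<longrightarrow> (\<exists>!w. w |\<in>| elts t \<and> w |\<in>| elts x)"
    if ne: "\<And>x. x |\<in>| elts F \<Longrightarrow> \<exists>w. w |\<in>| elts x"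
      and disj: "\<And>x y w. x |\<in>| elts F \<Longrightarrow> y |\<in>| elts F \<Longrightarrow> w |\<in>| elts x \<Longrightarrow> w |\<in>| elts y \<Longrightarrow> x = y" for F
  \<comment> \<open>A set of representatives; pairwise disjointness keeps the representative of any
    other member out of \<open>x\<close>.\<close>
  proof (rule exI[of _ "HF ((\<lambda>x. SOME w. w |\<in>| elts x) |`| elts F)"], intro allI impI)
    fix x assume x: "x |\<in>| elts F"
    have sm: "(SOME w. w |\<in>| elts y) |\<in>| elts y" if "y |\<in>| elts F" for y
      using ne[OF that] by (rule someI_ex)
    show "\<exists>!w. w |\<in>| elts (HF ((\<lambda>x. SOME w. w |\<in>| elts x) |`| elts F)) \<and> w |\<in>| elts x"
    proof (rule ex1I[of _ "SOME w. w |\<in>| elts x"])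
      show "(SOME w. w |\<in>| elts x) |\<in>| elts (HF ((\<lambda>x. SOME w. w |\<in>| elts x) |`| elts F)) \<and>
          (SOME w. w |\<in>| elts x) |\<in>| elts x"
        using sm[OF x] x by auto
    next
      fix w assume "w |\<in>| elts (HF ((\<lambda>x. SOME w. w |\<in>| elts x) |`| elts F)) \<and> w |\<in>| elts x"
      then obtain y where "y |\<in>| elts F" "w = (SOME w. w |\<in>| elts y)" "w |\<in>| elts x" by auto
      with sm disj x show "w = (SOME w. w |\<in>| elts x)" by metis
    qed
  qed
  then have "\<forall>F. (\<forall>x. x |\<in>| elts F \<longrightarrow> (\<exists>w. w |\<in>| elts x)) \<and>
      (\<forall>x y. x |\<in>| elts F \<and> y |\<in>| elts F \<and> (\<exists>w. w |\<in>| elts x \<and> w |\<in>| elts y) \<longrightarrow> x = y) \<longrightarrow>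
      (\<exists>t. \<forall>x. x |\<in>| elts F \<longrightarrow> (\<exists>!w. w |\<in>| elts t \<and> w |\<in>| elts x))"
    by (intro allI impI) blast
  then show ?case unfolding seval_axiom by simp
next
  case extensionality
  have "\<forall>x y. (\<forall>z. z |\<in>| elts x \<longleftrightarrow> z |\<in>| elts y) \<longrightarrow> x = y"
    using elts_eq_iff by blast
  then show ?case unfolding seval_axiom by simp
next
  case eq_refl
  show ?case by simp
next
  case eq_subst
  show ?case by auto
qed

text \<open>\<open>heval\<close> gives missing arguments the value \<open>hf_zero\<close>, whereas
  \<open>skolem_inst\<close> leaves those indices as variables; by \<open>sbound\<close>,
  \<open>\<phi>\<close> cannot tell the two environments apart.\<close>

lemma seval_skolem_inst:
  assumes b: "sbound (Suc (length Ks)) \<phi>"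
    and total: "\<And>g. \<exists>!v. seval (case_nat v (\<lambda>i. if i < length Ks then g i else hf_zero)) \<phi>"
  shows "seval (\<lambda>i. heval e (skolem_inst \<phi> Ks i)) \<phi>"
proof -
  let ?e = "\<lambda>i. if i < length Ks then map (heval e) Ks ! i else hf_zero"
  have "seval (case_nat (heval e (HFun \<phi> Ks)) ?e) \<phi>"
    unfolding heval.simps by (rule theI'[OF total])
  then show ?thesis
    unfolding skolem_inst_def by (subst seval_cong[OF b]) (auto split: nat.split)
qed

text \<open>Function symbols and theorems are generated together, so both facts need one induction:
  soundness of the derivation of \<open>SEx1 \<phi>\<close> justifies the definite description that
  evaluates \<open>HFun \<phi> Ks\<close>, and this in turn validates the Skolem axiom. The argument
  values \<open>g\<close> are arbitrary because the derivation is universally quantified.\<close>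

lemma sk_sound:
  "hf_term K \<Longrightarrow> \<forall>\<phi> Ks g. K = HFun \<phi> Ks \<longrightarrow> sbound (Suc (length Ks)) \<phi> \<and>
     (\<exists>!v. seval (case_nat v (\<lambda>i. if i < length Ks then g i else hf_zero)) \<phi>)"
  "sk_form \<phi> \<Longrightarrow> True"
  "\<Gamma> \<turnstile>\<^sub>S \<phi> \<Longrightarrow> \<forall>e. (\<forall>\<psi> \<in> set \<Gamma>. seval e \<psi>) \<longrightarrow> seval e \<phi>"
proof (induction K and \<phi> and \<Gamma> \<phi> rule: hf_term_sk_form_sk_prf.inducts)
  case (hf_fun \<phi> Ks)
  have "\<exists>!v. seval (case_nat v (\<lambda>i. if i < length Ks then g i else hf_zero)) \<phi>" for g
  proof -
    \<comment> \<open>The constant environment produces the same \<open>hf_zero\<close> padding that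
      \<open>heval\<close> uses.\<close>
    have "seval (\<lambda>_. hf_zero) (SAlls (length Ks) (SEx1 \<phi>))"
      using hf_fun by simp
    from seval_SAlls[OF this, of g] show ?thesis by simp
  qed
  with hf_fun show ?case by auto
next
  case (sk_zfc \<phi> \<Gamma>)
  then show ?case using seval_zfc by simp
next
  case (sk_skolem \<phi> Ks \<Gamma>)
  from sk_skolem.IH(1)[rule_format, OF refl] show ?case
    unfolding seval_ssubst by (intro allI impI seval_skolem_inst) simp_all
next
  case (sk_orE \<Gamma> \<phi> \<psi> \<chi>) then show ?case by (simp, metis)
next
  case (sk_notI \<phi> \<Gamma> \<psi>) then show ?case by (simp, metis)
next
  case (sk_ccontr \<phi> \<Gamma> \<psi>) then show ?case by (simp, metis)
next
  case (sk_exI K \<Gamma> \<phi>) then show ?case by auto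
next
  case (sk_exE \<Gamma> \<phi> \<psi>)
  show ?case
  proof (intro allI impI)
    fix e assume \<Gamma>: "\<forall>\<psi> \<in> set \<Gamma>. seval e \<psi>"
    with sk_exE obtain v where "seval (case_nat v e) \<phi>" by auto
    then have "\<forall>\<chi> \<in> set (\<phi> # map slift \<Gamma>). seval (case_nat v e) \<chi>" using \<Gamma> by simp
    then have "seval (case_nat v e) (slift \<psi>)" using sk_exE.IH(2) by blast
    then show "seval e \<psi>" by simp
  qed
qed auto

lemma seval_skolem:
  assumes "hf_term (HFun \<phi> Ks)"
  shows "seval (\<lambda>i. heval e (skolem_inst \<phi> Ks i)) \<phi>"
  using sk_sound(1)[OF assms, rule_format, OF refl] by (intro seval_skolem_inst) simp_all

text \<open>Every set occurs at some level \<open>V n\<close> of the cumulative hierarchy, and all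
  these levels are finite. Since HF-sets name the successors, this is what makes formulas enumerable
  for the Henkin construction; \<open>to_nat\<close> on HF-sets later also orders candidate values
  and codes fibres.\<close>

lemma countable_hf: "countable (UNIV :: hf set)"
proof -
  define V where "V n = ((\<lambda>A. HF ` {S. fset S \<subseteq> A}) ^^ n) {}" for n
  have fin: "finite (V n)" for n
  proof (induction n)
    case (Suc n)
    have "{S. fset S \<subseteq> V n} = Abs_fset ` Pow (V n)"
      using Suc by (auto simp: image_iff finite_subset Abs_fset_inverse intro!: exI[of _ "fset _"] fset_inverse[symmetric])
    with Suc show ?case by (simp add: V_def)
  qed (simp add: V_def)
  have mono: "V n \<subseteq> V (Suc n)" for n
    by (induction n) (auto simp: V_def)
  have "\<exists>n. x \<in> V n" for x
  proof (induction x)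
    case (HF S)
    then obtain n where n: "\<And>y. y \<in> fset S \<Longrightarrow> y \<in> V (n y)" by metis
    have "y \<in> V (Max (n ` fset S))" if "y \<in> fset S" for y
      using n[OF that] lift_Suc_mono_le[of V, OF mono, of "n y" "Max (n ` fset S)"] that by auto
    then have "HF S \<in> V (Suc (Max (n ` fset S)))" by (auto simp: V_def)
    then show ?case by blast
  qed
  then have "UNIV = (\<Union>n. V n)" by auto
  moreover have "countable (\<Union>n. V n)"
    using fin by (intro countable_UN) (auto intro: countable_finite)
  ultimately show ?thesis by simp
qed

section \<open>Completeness of MSO for term models\<close>

instance hf :: countable
proof
  show "\<exists>f :: hf \<Rightarrow> nat. inj f"
    using countable_hf by (auto simp: countable_def)
qed

instance iterm :: countable by countable_datatype
instance mso :: countable by countable_datatype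

subsection \<open>Substitutions\<close>

lemma isubst_isubst [simp]: "isubst \<sigma> (isubst \<tau> t) = isubst (\<lambda>i. isubst \<sigma> (\<tau> i)) t"
  by (induction t) auto

lemma isubst_IVar [simp]: "isubst IVar t = t"
  by (induction t) auto

lemma isubst_case_nat [simp]:
  "(\<lambda>i. isubst \<sigma> (case_nat t \<tau> i)) = case_nat (isubst \<sigma> t) (\<lambda>i. isubst \<sigma> (\<tau> i))"
  by (rule ext) (simp split: nat.split)

lemma iup_simps [simp]: "iup \<sigma> 0 = IVar 0" "iup \<sigma> (Suc i) = isubst (\<lambda>j. IVar (Suc j)) (\<sigma> i)"
  by (simp_all add: iup_def)

lemma isubst_iup [simp]: "(\<lambda>i. isubst (case_nat t \<sigma>) (iup \<tau> i)) = case_nat t (\<lambda>i. isubst \<sigma> (\<tau> i))"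
  by (rule ext) (simp add: iup_def split: nat.split)

lemma iup_iup [simp]: "(\<lambda>i. isubst (iup \<sigma>) (iup \<tau> i)) = iup (\<lambda>i. isubst \<sigma> (\<tau> i))"
  by (rule ext) (simp add: iup_def split: nat.split)

lemma iup_IVar [simp]: "iup IVar = IVar"
  by (rule ext) (simp add: iup_def split: nat.split)

lemma rup_simps [simp]: "rup \<rho> 0 = 0" "rup \<rho> (Suc i) = Suc (\<rho> i)"
  by (simp_all add: rup_def)

lemma case_nat_rup [simp]: "(\<lambda>i. case_nat a f (rup \<rho> i)) = case_nat a (\<lambda>i. f (\<rho> i))"
  by (rule ext) (simp add: rup_def split: nat.split)

lemma rup_rup [simp]: "(\<lambda>i. rup \<rho> (rup \<rho>' i)) = rup (\<lambda>i. \<rho> (\<rho>' i))"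
  by (rule ext) (simp add: rup_def split: nat.split)

lemma rup_id [simp]: "rup id = id" "rup (\<lambda>i. i) = (\<lambda>i. i)"
  by (auto simp: rup_def split: nat.split)

lemma msubst_msubst [simp]:
  "msubst \<sigma> \<rho> (msubst \<tau> \<rho>' \<phi>) = msubst (\<lambda>i. isubst \<sigma> (\<tau> i)) (\<lambda>i. \<rho> (\<rho>' i)) \<phi>"
  by (induction \<phi> arbitrary: \<sigma> \<tau> \<rho> \<rho>') auto

lemma msubst_id [simp]: "msubst IVar id \<phi> = \<phi>" "msubst IVar (\<lambda>i. i) \<phi> = \<phi>"
  by (induction \<phi>) (auto simp: id_def)

lemma msubst_minstI:
  "msubst \<sigma> \<rho> (minstI t \<phi>) = minstI (isubst \<sigma> t) (msubst (iup \<sigma>) \<rho> \<phi>)"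
  by simp

lemma case_nat_comp: "(\<lambda>i. f (case_nat a g i)) = case_nat (f a) (\<lambda>i. f (g i))"
  by (rule ext) (simp split: nat.split)

lemma msubst_minstP:
  "msubst \<sigma> \<rho> (minstP X \<phi>) = minstP (\<rho> X) (msubst \<sigma> (rup \<rho>) \<phi>)"
  by (simp add: case_nat_comp[of \<rho>])

lemma dir_term_isubst: "(\<And>i. dir_term D (\<sigma> i)) \<Longrightarrow> dir_term D (isubst \<sigma> t) \<longleftrightarrow> dir_term D t"
  by (induction t) auto

lemma dir_term_iup: "(\<And>i. dir_term D (\<sigma> i)) \<Longrightarrow> dir_term D (iup \<sigma> i)"
  by (cases i) (auto simp: dir_term_isubst)

lemma dir_term_case_nat: "dir_term D t \<Longrightarrow> (\<And>i. dir_term D (\<sigma> i)) \<Longrightarrow> dir_term D (case_nat t \<sigma> i)"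
  by (cases i) auto

lemma mso_form_msubst:
  "(\<And>i. dir_term D (\<sigma> i)) \<Longrightarrow> mso_form D (msubst \<sigma> \<rho> \<phi>) \<longleftrightarrow> mso_form D \<phi>"
  by (induction \<phi> arbitrary: \<sigma> \<rho>) (auto simp: dir_term_isubst dir_term_iup)

lemma mso_form_lift_inst [simp]:
  "mso_form D (mliftI \<phi>) \<longleftrightarrow> mso_form D \<phi>"
  "mso_form D (msubst IVar \<rho> \<phi>) \<longleftrightarrow> mso_form D \<phi>"
  "dir_term D t \<Longrightarrow> mso_form D (minstI t \<phi>) \<longleftrightarrow> mso_form D \<phi>"
  by (simp_all add: mso_form_msubst dir_term_case_nat)

subsection \<open>Structural properties of derivations\<close>

lemma mso_prf_form: "mso_prf D \<Gamma> \<phi> \<Longrightarrow> mso_form D \<phi> \<and> (\<forall>\<psi> \<in> set \<Gamma>. mso_form D \<psi>)"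
  by (induction rule: mso_prf.induct) auto

lemma mso_prf_mono:
  "mso_prf D \<Gamma> \<phi> \<Longrightarrow> set \<Gamma> \<subseteq> set \<Delta> \<Longrightarrow> \<forall>\<psi> \<in> set \<Delta>. mso_form D \<psi> \<Longrightarrow> mso_prf D \<Delta> \<phi>"
proof (induction arbitrary: \<Delta> rule: mso_prf.induct)
  case (hyp \<phi> \<Gamma>)
  then show ?case by (auto intro: mso_prf.hyp)
next
  case (ax \<phi> \<Gamma>)
  then show ?case by (auto intro: mso_prf.ax)
next
  case (orI1 \<Gamma> \<phi> \<psi>)
  then show ?case by (auto intro: mso_prf.orI1)
next
  case (orI2 \<Gamma> \<phi> \<psi>)
  then show ?case by (auto intro: mso_prf.orI2)
next
  case (orE \<Gamma> \<phi> \<psi> \<chi>)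
  then have "mso_form D \<phi>" "mso_form D \<psi>" using mso_prf_form by fastforce+
  with orE.prems show ?case
    by (intro mso_prf.orE[OF orE.IH(1) orE.IH(2) orE.IH(3)]) auto
next
  case (notI \<phi> \<Gamma> \<psi>)
  then have "mso_form D \<phi>" using mso_prf_form by fastforce
  with notI.prems show ?case
    by (intro mso_prf.notI[OF notI.IH]) auto
next
  case (ccontr \<phi> \<Gamma> \<psi>)
  then have "mso_form D \<phi>" using mso_prf_form by fastforce
  with ccontr.prems show ?case
    by (intro mso_prf.ccontr[OF ccontr.IH]) auto
next
  case (exI_I t \<Gamma> \<phi>)
  then show ?case by (auto intro: mso_prf.exI_I)
next
  case (exI_E \<Gamma> \<phi> \<psi>)
  then have "mso_form D \<phi>" using mso_prf_form by fastforce
  with exI_E.prems show ?case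
    by (intro mso_prf.exI_E[OF exI_E.IH]) auto
next
  case (exP_I \<Gamma> X \<phi>)
  then show ?case by (auto intro: mso_prf.exP_I)
next
  case (exP_E \<Gamma> \<phi> \<psi>)
  then have "mso_form D \<phi>" using mso_prf_form by fastforce
  with exP_E.prems show ?case
    by (intro mso_prf.exP_E[OF exP_E.IH]) auto
qed

lemma mso_prf_Cons: "mso_prf D \<Gamma> \<phi> \<Longrightarrow> mso_form D \<psi> \<Longrightarrow> mso_prf D (\<psi> # \<Gamma>) \<phi>"
  by (rule mso_prf_mono) (auto dest: mso_prf_form)

lemma msubst_foldr:
  "msubst \<sigma> \<rho> (foldr (\<lambda>d. MImp (A d)) ds \<phi>) = foldr (\<lambda>d. MImp (msubst \<sigma> \<rho> (A d))) ds (msubst \<sigma> \<rho> \<phi>)"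
  by (induction ds) auto

lemma mso_ax_msubst: "mso_ax D \<phi> \<Longrightarrow> mso_ax D (msubst \<sigma> \<rho> \<phi>)"
proof (induction rule: mso_ax.induct)
  case (eq_subst t u \<phi>)
  show ?case
    using mso_ax.eq_subst[of D "isubst \<sigma> t" "isubst \<sigma> u" "msubst (iup \<sigma>) \<rho> \<phi>"] by simp
next
  case (comprehension \<phi>)
  show ?case
    using mso_ax.comprehension[of D "msubst (iup \<sigma>) \<rho> \<phi>"] by simp
next
  case (induction ds)
  then show ?case
    using mso_ax.induction[of ds D] by (simp add: msubst_foldr)
qed (auto intro: mso_ax.intros)

text \<open>Allows a fresh variable to be renamed to the index \<open>0\<close> that the elimination
  rules expect. The quantifier cases go through because substituting under a binder commutes with
  lifting the hypotheses.\<close>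

lemma mso_prf_msubst:
  "mso_prf D \<Gamma> \<phi> \<Longrightarrow> (\<And>i. dir_term D (\<sigma> i)) \<Longrightarrow>
    mso_prf D (map (msubst \<sigma> \<rho>) \<Gamma>) (msubst \<sigma> \<rho> \<phi>)"
proof (induction arbitrary: \<sigma> \<rho> rule: mso_prf.induct)
  case (hyp \<phi> \<Gamma>)
  then show ?case by (auto intro!: mso_prf.hyp simp: mso_form_msubst)
next
  case (ax \<phi> \<Gamma>)
  then show ?case by (auto intro!: mso_prf.ax mso_ax_msubst simp: mso_form_msubst)
next
  case (orI1 \<Gamma> \<phi> \<psi>)
  then show ?case by (auto intro: mso_prf.orI1 simp: mso_form_msubst)
next
  case (orI2 \<Gamma> \<phi> \<psi>)
  then show ?case by (auto intro: mso_prf.orI2 simp: mso_form_msubst)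
next
  case (orE \<Gamma> \<phi> \<psi> \<chi>)
  show ?case
    using orE.IH[of \<sigma> \<rho>] orE.prems by (auto intro: mso_prf.orE)
next
  case (notI \<phi> \<Gamma> \<psi>)
  show ?case
    using notI.IH[of \<sigma> \<rho>] notI.prems by (auto intro: mso_prf.notI)
next
  case (ccontr \<phi> \<Gamma> \<psi>)
  show ?case
    using ccontr.IH[of \<sigma> \<rho>] ccontr.prems by (auto intro: mso_prf.ccontr)
next
  case (exI_I t \<Gamma> \<phi>)
  have "mso_prf D (map (msubst \<sigma> \<rho>) \<Gamma>) (minstI (isubst \<sigma> t) (msubst (iup \<sigma>) \<rho> \<phi>))"
    using exI_I.IH[OF exI_I.prems] unfolding msubst_minstI .
  with exI_I show ?case
    unfolding msubst.simps by (intro mso_prf.exI_I[of D "isubst \<sigma> t"]) (auto simp: dir_term_isubst)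
next
  case (exI_E \<Gamma> \<phi> \<psi>)
  have "mso_prf D (map (msubst (iup \<sigma>) \<rho>) (\<phi> # map mliftI \<Gamma>)) (msubst (iup \<sigma>) \<rho> (mliftI \<psi>))"
    by (rule exI_E.IH(2)) (simp add: dir_term_iup exI_E.prems)
  then show ?case
    by (intro mso_prf.exI_E[OF exI_E.IH(1)[OF exI_E.prems, unfolded msubst.simps]]) (simp add: comp_def)
next
  case (exP_I \<Gamma> X \<phi>)
  have "mso_prf D (map (msubst \<sigma> \<rho>) \<Gamma>) (minstP (\<rho> X) (msubst \<sigma> (rup \<rho>) \<phi>))"
    using exP_I.IH[OF exP_I.prems] unfolding msubst_minstP .
  then show ?case
    unfolding msubst.simps by (rule mso_prf.exP_I)
next
  case (exP_E \<Gamma> \<phi> \<psi>)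
  have "mso_prf D (map (msubst \<sigma> (rup \<rho>)) (\<phi> # map mliftP \<Gamma>)) (msubst \<sigma> (rup \<rho>) (mliftP \<psi>))"
    by (rule exP_E.IH(2)) (simp add: exP_E.prems)
  then show ?case
    by (intro mso_prf.exP_E[OF exP_E.IH(1)[OF exP_E.prems, unfolded msubst.simps]]) (simp add: comp_def)
qed

section \<open>Bounds on free indices, as a source of fresh variables\<close>

lemma isubst_cong: "ibound m t \<Longrightarrow> (\<And>i. i < m \<Longrightarrow> \<sigma> i = \<sigma>' i) \<Longrightarrow> isubst \<sigma> t = isubst \<sigma>' t"
  by (induction t) auto

lemma msubst_cong:
  "mbound m n \<phi> \<Longrightarrow> (\<And>i. i < m \<Longrightarrow> \<sigma> i = \<sigma>' i) \<Longrightarrow> (\<And>i. i < n \<Longrightarrow> \<rho> i = \<rho>' i) \<Longrightarrow>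
    msubst \<sigma> \<rho> \<phi> = msubst \<sigma>' \<rho>' \<phi>"
proof (induction \<phi> arbitrary: m n \<sigma> \<sigma>' \<rho> \<rho>')
  case (MExI \<phi>)
  have "msubst (iup \<sigma>) \<rho> \<phi> = msubst (iup \<sigma>') \<rho>' \<phi>"
    using MExI.prems by (intro MExI.IH[of "Suc m" n]) (auto simp: iup_def split: nat.split)
  then show ?case by simp
next
  case (MExP \<phi>)
  have "msubst \<sigma> (rup \<rho>) \<phi> = msubst \<sigma>' (rup \<rho>') \<phi>"
    using MExP.prems by (intro MExP.IH[of m "Suc n"]) (auto simp: rup_def split: nat.split)
  then show ?case by simp
next
  case (MNot \<phi>)
  show ?case using MNot.IH[of m n \<sigma> \<sigma>' \<rho> \<rho>'] MNot.prems by simp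
next
  case (MOr \<phi> \<psi>)
  show ?case using MOr.IH(1,2)[of m n \<sigma> \<sigma>' \<rho> \<rho>'] MOr.prems by simp
qed (auto intro: isubst_cong)

lemma ibound_mono: "ibound m t \<Longrightarrow> m \<le> m' \<Longrightarrow> ibound m' t"
  by (induction t) auto

lemma mbound_mono: "mbound m n \<phi> \<Longrightarrow> m \<le> m' \<Longrightarrow> n \<le> n' \<Longrightarrow> mbound m' n' \<phi>"
  by (induction \<phi> arbitrary: m n m' n') (auto intro: ibound_mono simp: Suc_le_mono)

lemma ex_ibound: "\<exists>m. ibound m t"
  by (induction t) auto

lemma ex_ibound2: "\<exists>m. ibound m t \<and> ibound m u"
proof -
  obtain m n where "ibound m t" "ibound n u" using ex_ibound by blast
  then have "ibound (max m n) t \<and> ibound (max m n) u" by (auto intro: ibound_mono)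
  then show ?thesis by blast
qed

lemma ex_mbound: "\<exists>n. mbound n n \<phi>"
proof (induction \<phi>)
  case (MPred X t)
  obtain m where "ibound m t" using ex_ibound by blast
  then have "mbound (max m (Suc X)) (max m (Suc X)) (MPred X t)" by (auto intro: ibound_mono)
  then show ?case by blast
next
  case (MOr \<phi> \<psi>)
  then obtain m n where "mbound m m \<phi>" "mbound n n \<psi>" by blast
  then have "mbound (max m n) (max m n) (MOr \<phi> \<psi>)" by (auto intro: mbound_mono)
  then show ?case by blast
next
  case (MExI \<phi>)
  then obtain n where "mbound n n \<phi>" by blast
  then have "mbound n n (MExI \<phi>)" by (auto intro: mbound_mono)
  then show ?case by blast
next
  case (MExP \<phi>)
  then obtain n where "mbound n n \<phi>" by blast
  then have "mbound n n (MExP \<phi>)" by (auto intro: mbound_mono)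
  then show ?case by blast
qed (auto intro: ex_ibound2)

lemma ex_mbound_list: "\<exists>n. \<forall>\<phi> \<in> set \<Gamma>. mbound n n \<phi>"
proof (induction \<Gamma>)
  case (Cons \<phi> \<Gamma>)
  then obtain m n where "\<forall>\<phi> \<in> set \<Gamma>. mbound m m \<phi>" "mbound n n \<phi>" using ex_mbound by blast
  then have "\<forall>\<psi> \<in> set (\<phi> # \<Gamma>). mbound (max m n) (max m n) \<psi>" by (auto intro: mbound_mono)
  then show ?case by blast
qed simp

subsection \<open>Henkin extension\<close>

definition mso_con :: "hf \<Rightarrow> mso list \<Rightarrow> bool" where
  "mso_con D \<Gamma> \<longleftrightarrow> (\<forall>\<phi> \<in> set \<Gamma>. mso_form D \<phi>) \<and> \<not> (\<exists>\<psi>. mso_prf D \<Gamma> \<psi> \<and> mso_prf D \<Gamma> (MNot \<psi>))"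

lemma mso_explosion:
  assumes "mso_prf D \<Gamma> \<psi>" "mso_prf D \<Gamma> (MNot \<psi>)" "mso_form D \<chi>"
  shows "mso_prf D \<Gamma> \<chi>"
  using assms mso_prf_form[OF assms(1)]
  by (intro mso_prf.ccontr[of D \<chi> \<Gamma> \<psi>]) (auto intro: mso_prf_Cons)

lemma not_con_witness:
  assumes "\<not> mso_con D (\<phi> # \<Gamma>)" "mso_con D \<Gamma>" "mso_form D \<phi>" "mso_form D \<chi>"
  shows "mso_prf D (\<phi> # \<Gamma>) \<chi>"
  using assms unfolding mso_con_def by (auto intro: mso_explosion)

text \<open>A closed formula: the contradictory pair \<open>MTrue\<close>, \<open>MNot MTrue\<close>
  survives every renaming and can leave the scope of an existential elimination.\<close>

abbreviation MTrue :: mso where "MTrue \<equiv> MEq Root Root"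

lemma con_witness_I:
  assumes con: "mso_con D \<Gamma>" and mem: "MExI \<phi> \<in> set \<Gamma>"
  shows "\<exists>t. dir_term D t \<and> mso_con D (minstI t \<phi> # \<Gamma>)"
proof -
  have form: "\<forall>\<psi> \<in> set \<Gamma>. mso_form D \<psi>" using con by (simp add: mso_con_def)
  obtain n where n: "\<And>\<psi>. \<psi> \<in> set \<Gamma> \<Longrightarrow> mbound n n \<psi>" using ex_mbound_list by blast
  \<comment> \<open>\<open>n\<close> is fresh for \<open>\<Gamma>\<close>. Sending it to
    \<open>0\<close> and shifting the other indices turns the context with a named witness into the
    context required by \<open>exI_E\<close>.\<close>
  define \<sigma> where "\<sigma> i = (if i = n then IVar 0 else IVar (Suc i))" for i
  have *: "map (msubst \<sigma> id) (minstI (IVar n) \<phi> # \<Gamma>) = \<phi> # map mliftI \<Gamma>"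
  proof -
    have "msubst \<sigma> id \<psi> = mliftI \<psi>" if "\<psi> \<in> set \<Gamma>" for \<psi>
      using n[OF that] by (rule msubst_cong) (auto simp: \<sigma>_def)
    moreover have "msubst \<sigma> id (minstI (IVar n) \<phi>) = msubst IVar id \<phi>"
      unfolding msubst_msubst
      by (rule msubst_cong[of "Suc n" n]) (use n[OF mem] in \<open>auto simp: \<sigma>_def split: nat.split\<close>)
    ultimately show ?thesis by simp
  qed
  have "mso_con D (minstI (IVar n) \<phi> # \<Gamma>)"
  proof (rule HOL.ccontr)
    assume "\<not> ?thesis"
    have **: "mso_prf D \<Gamma> \<chi>" if \<chi>: "mso_form D \<chi>" "mliftI \<chi> = \<chi>" "msubst \<sigma> id \<chi> = \<chi>" for \<chi>
    proof (rule mso_prf.exI_E)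
      show "mso_prf D \<Gamma> (MExI \<phi>)" using mem form by (rule mso_prf.hyp)
      have f: "mso_form D \<phi>" using form mem by fastforce
      then have "mso_prf D (minstI (IVar n) \<phi> # \<Gamma>) \<chi>"
        using \<open>\<not> _\<close> con \<chi>(1) by (intro not_con_witness) auto
      then have "mso_prf D (map (msubst \<sigma> id) (minstI (IVar n) \<phi> # \<Gamma>)) (msubst \<sigma> id \<chi>)"
        by (rule mso_prf_msubst) (simp add: \<sigma>_def)
      then show "mso_prf D (\<phi> # map mliftI \<Gamma>) (mliftI \<chi>)"
        unfolding * \<chi>(2,3) .
    qed
    have "mso_prf D \<Gamma> MTrue" "mso_prf D \<Gamma> (MNot MTrue)"
      by (rule **; simp)+
    with con show False unfolding mso_con_def by blast
  qed
  then show ?thesis by (intro exI[of _ "IVar n"]) simp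
qed

lemma con_witness_P:
  assumes con: "mso_con D \<Gamma>" and mem: "MExP \<phi> \<in> set \<Gamma>"
  shows "\<exists>X. mso_con D (minstP X \<phi> # \<Gamma>)"
proof -
  have form: "\<forall>\<psi> \<in> set \<Gamma>. mso_form D \<psi>" using con by (simp add: mso_con_def)
  obtain n where n: "\<And>\<psi>. \<psi> \<in> set \<Gamma> \<Longrightarrow> mbound n n \<psi>" using ex_mbound_list by blast
  define \<rho> where "\<rho> i = (if i = n then 0 else Suc i)" for i
  have *: "map (msubst IVar \<rho>) (minstP n \<phi> # \<Gamma>) = \<phi> # map mliftP \<Gamma>"
  proof -
    have "msubst IVar \<rho> \<psi> = mliftP \<psi>" if "\<psi> \<in> set \<Gamma>" for \<psi>
      using n[OF that] by (rule msubst_cong) (auto simp: \<rho>_def)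
    moreover have "msubst IVar \<rho> (minstP n \<phi>) = msubst IVar id \<phi>"
      unfolding msubst_msubst
      by (rule msubst_cong[of n "Suc n"]) (use n[OF mem] in \<open>auto simp: \<rho>_def split: nat.split\<close>)
    ultimately show ?thesis by simp
  qed
  have "mso_con D (minstP n \<phi> # \<Gamma>)"
  proof (rule HOL.ccontr)
    assume "\<not> ?thesis"
    have **: "mso_prf D \<Gamma> \<chi>" if \<chi>: "mso_form D \<chi>" "mliftP \<chi> = \<chi>" "msubst IVar \<rho> \<chi> = \<chi>" for \<chi>
    proof (rule mso_prf.exP_E)
      show "mso_prf D \<Gamma> (MExP \<phi>)" using mem form by (rule mso_prf.hyp)
      have f: "mso_form D \<phi>" using form mem by fastforce
      then have "mso_prf D (minstP n \<phi> # \<Gamma>) \<chi>"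
        using \<open>\<not> _\<close> con \<chi>(1) by (intro not_con_witness) auto
      then have "mso_prf D (map (msubst IVar \<rho>) (minstP n \<phi> # \<Gamma>)) (msubst IVar \<rho> \<chi>)"
        by (rule mso_prf_msubst) simp
      then show "mso_prf D (\<phi> # map mliftP \<Gamma>) (mliftP \<chi>)"
        unfolding * \<chi>(2,3) .
    qed
    have "mso_prf D \<Gamma> MTrue" "mso_prf D \<Gamma> (MNot MTrue)"
      by (rule **; simp)+
    with con show False unfolding mso_con_def by blast
  qed
  then show ?thesis by blast
qed

lemma con_decide:
  assumes con: "mso_con D \<Gamma>" and form: "mso_form D \<phi>"
  shows "mso_con D (\<phi> # \<Gamma>) \<or> mso_con D (MNot \<phi> # \<Gamma>)"
proof (rule HOL.ccontr)
  assume *: "\<not> ?thesis"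
  have "mso_prf D (\<phi> # \<Gamma>) MTrue" "mso_prf D (\<phi> # \<Gamma>) (MNot MTrue)"
    "mso_prf D (MNot \<phi> # \<Gamma>) MTrue" "mso_prf D (MNot \<phi> # \<Gamma>) (MNot MTrue)"
    using * by (auto intro!: not_con_witness con form)
  then have "mso_prf D \<Gamma> (MNot \<phi>)" "mso_prf D \<Gamma> \<phi>"
    by (blast intro: mso_prf.notI mso_prf.ccontr)+
  with con show False unfolding mso_con_def by blast
qed

definition decides :: "hf \<Rightarrow> mso set \<Rightarrow> mso \<Rightarrow> bool" where
  "decides D S \<phi> \<longleftrightarrow> MNot \<phi> \<in> S \<or> \<phi> \<in> S \<and>
     (\<forall>\<psi>. \<phi> = MExI \<psi> \<longrightarrow> (\<exists>t. dir_term D t \<and> minstI t \<psi> \<in> S)) \<and>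
     (\<forall>\<psi>. \<phi> = MExP \<psi> \<longrightarrow> (\<exists>X. minstP X \<psi> \<in> S))"

lemma decides_mono: "decides D S \<phi> \<Longrightarrow> S \<subseteq> T \<Longrightarrow> decides D T \<phi>"
  unfolding decides_def by blast

lemma con_extend:
  assumes con: "mso_con D \<Gamma>" and form: "mso_form D \<phi>"
  shows "\<exists>\<Delta>. mso_con D \<Delta> \<and> set \<Gamma> \<subseteq> set \<Delta> \<and> decides D (set \<Delta>) \<phi>"
proof (cases "mso_con D (\<phi> # \<Gamma>)")
  case True
  consider (I) \<psi> where "\<phi> = MExI \<psi>" | (P) \<psi> where "\<phi> = MExP \<psi>"
    | (N) "\<forall>\<psi>. \<phi> \<noteq> MExI \<psi> \<and> \<phi> \<noteq> MExP \<psi>" by blast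
  then show ?thesis
  proof cases
    case I
    with con_witness_I[OF True, of \<psi>] obtain t where "dir_term D t" "mso_con D (minstI t \<psi> # \<phi> # \<Gamma>)" by auto
    then show ?thesis
      by (intro exI[of _ "minstI t \<psi> # \<phi> # \<Gamma>"]) (use I in \<open>auto simp: decides_def\<close>)
  next
    case P
    with con_witness_P[OF True, of \<psi>] obtain X where "mso_con D (minstP X \<psi> # \<phi> # \<Gamma>)" by auto
    then show ?thesis
      by (intro exI[of _ "minstP X \<psi> # \<phi> # \<Gamma>"]) (use P in \<open>auto simp: decides_def\<close>)
  next
    case N
    with True show ?thesis by (intro exI[of _ "\<phi> # \<Gamma>"]) (auto simp: decides_def)
  qed
next
  case False
  with con_decide[OF assms] show ?thesis
    by (intro exI[of _ "MNot \<phi> # \<Gamma>"]) (auto simp: decides_def)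
qed

lemma henkin_set:
  assumes con: "mso_con D \<Gamma>"
  obtains H where "set \<Gamma> \<subseteq> H" "\<And>\<phi>. mso_form D \<phi> \<Longrightarrow> decides D H \<phi>"
    "\<And>\<Delta>. set \<Delta> \<subseteq> H \<Longrightarrow> mso_con D \<Delta>"
proof -
  have "\<exists>S. S 0 = \<Gamma> \<and> (\<forall>n. mso_con D (S n) \<and> set (S n) \<subseteq> set (S (Suc n)) \<and>
      (mso_form D (from_nat n) \<longrightarrow> decides D (set (S (Suc n))) (from_nat n)))"
  proof -
    \<comment> \<open>\<open>dependent_nat_choice\<close> only maintains an invariant, so the
      starting value \<open>\<Gamma>\<close> has to enter through the clause for
      \<open>n = 0\<close>.\<close>
    have "\<exists>S. \<forall>n. (mso_con D (S n) \<and> (n = 0 \<longrightarrow> S n = \<Gamma>)) \<and> (set (S n) \<subseteq> set (S (Suc n)) \<and>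
      (mso_form D (from_nat n) \<longrightarrow> decides D (set (S (Suc n))) (from_nat n)))"
    proof (rule dependent_nat_choice)
      fix \<Gamma>' and n :: nat assume "mso_con D \<Gamma>' \<and> (n = 0 \<longrightarrow> \<Gamma>' = \<Gamma>)"
      then show "\<exists>\<Delta>. (mso_con D \<Delta> \<and> (Suc n = 0 \<longrightarrow> \<Delta> = \<Gamma>)) \<and> (set \<Gamma>' \<subseteq> set \<Delta> \<and>
          (mso_form D (from_nat n) \<longrightarrow> decides D (set \<Delta>) (from_nat n)))"
        using con_extend[of D \<Gamma>' "from_nat n"] by auto
    qed (use con in auto)
    then show ?thesis by blast
  qed
  then obtain S where S: "S 0 = \<Gamma>" "\<And>n. mso_con D (S n)" "\<And>n. set (S n) \<subseteq> set (S (Suc n))"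
    "\<And>n. mso_form D (from_nat n) \<Longrightarrow> decides D (set (S (Suc n))) (from_nat n)"
    by blast
  have mono: "set (S m) \<subseteq> set (S n)" if "m \<le> n" for m n
    using S(3) that by (rule lift_Suc_mono_le)
  \<comment> \<open>A list of hypotheses is finite and hence contained in one stage; this carries
    consistency over to the union.\<close>
  have fin: "\<exists>n. set \<Delta> \<subseteq> set (S n)" if "set \<Delta> \<subseteq> (\<Union>n. set (S n))" for \<Delta>
    using that
  proof (induction \<Delta>)
    case (Cons \<phi> \<Delta>)
    then obtain m n where "set \<Delta> \<subseteq> set (S m)" "\<phi> \<in> set (S n)" by auto
    then have "set (\<phi> # \<Delta>) \<subseteq> set (S (max m n))"
      using mono[of m "max m n"] mono[of n "max m n"] by auto
    then show ?case by blast
  qed simp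
  show thesis
  proof (rule that)
    show "set \<Gamma> \<subseteq> (\<Union>n. set (S n))" using S(1) by blast
  next
    fix \<phi> assume "mso_form D \<phi>"
    with S(4)[of "to_nat \<phi>"] show "decides D (\<Union>n. set (S n)) \<phi>"
      by (auto elim!: decides_mono)
  next
    fix \<Delta> assume "set \<Delta> \<subseteq> (\<Union>n. set (S n))"
    then obtain n where n: "set \<Delta> \<subseteq> set (S n)" using fin by blast
    with S(2)[of n] show "mso_con D \<Delta>"
      unfolding mso_con_def using mso_prf_mono[OF _ n] by blast
  qed
qed

subsection \<open>Term models\<close>

text \<open>Individuals are terms and Predicates are indices; equality may be a proper congruence.\<close>

locale term_structure =
  fixes D :: hf
    and P :: "nat \<Rightarrow> iterm \<Rightarrow> bool"
    and E L :: "iterm \<Rightarrow> iterm \<Rightarrow> bool"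
begin

primrec sat :: "(nat \<Rightarrow> iterm) \<Rightarrow> (nat \<Rightarrow> nat) \<Rightarrow> mso \<Rightarrow> bool" where
  "sat \<sigma> \<pi> (MPred X t) \<longleftrightarrow> P (\<pi> X) (isubst \<sigma> t)"
| "sat \<sigma> \<pi> (MEq t u) \<longleftrightarrow> E (isubst \<sigma> t) (isubst \<sigma> u)"
| "sat \<sigma> \<pi> (MLess t u) \<longleftrightarrow> L (isubst \<sigma> t) (isubst \<sigma> u)"
| "sat \<sigma> \<pi> (MNot \<phi>) \<longleftrightarrow> \<not> sat \<sigma> \<pi> \<phi>"
| "sat \<sigma> \<pi> (MOr \<phi> \<psi>) \<longleftrightarrow> sat \<sigma> \<pi> \<phi> \<or> sat \<sigma> \<pi> \<psi>"
| "sat \<sigma> \<pi> (MExI \<phi>) \<longleftrightarrow> (\<exists>t. dir_term D t \<and> sat (case_nat t \<sigma>) \<pi> \<phi>)"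
| "sat \<sigma> \<pi> (MExP \<phi>) \<longleftrightarrow> (\<exists>X. sat \<sigma> (case_nat X \<pi>) \<phi>)"

lemma sat_msubst [simp]:
  "sat \<sigma> \<pi> (msubst \<tau> \<rho> \<phi>) \<longleftrightarrow> sat (\<lambda>i. isubst \<sigma> (\<tau> i)) (\<lambda>i. \<pi> (\<rho> i)) \<phi>"
  by (induction \<phi> arbitrary: \<sigma> \<pi> \<tau> \<rho>) auto

end

text \<open>A general model: the Predicates need not exhaust the sets of individuals, and
  comprehension is what closes them under definability. Terms with variables are individuals too, so
  the tree need not be the standard one.\<close>

locale term_model = term_structure +
  assumes sat_ax:
    "mso_ax D \<phi> \<Longrightarrow> mso_form D \<phi> \<Longrightarrow> (\<And>i. dir_term D (\<sigma> i)) \<Longrightarrow> sat \<sigma> \<pi> \<phi>"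

theorem mso_completeness:
  assumes "mso_form D \<phi>" "\<not> mso_prf D [] \<phi>"
  obtains P E L where "term_model D P E L" "\<not> term_structure.sat D P E L IVar id \<phi>"
proof -
  have "mso_con D [MNot \<phi>]"
    using assms unfolding mso_con_def by (auto intro: mso_prf.ccontr)
  then obtain H where H: "MNot \<phi> \<in> H" and dec: "\<And>\<phi>. mso_form D \<phi> \<Longrightarrow> decides D H \<phi>"
    and con: "\<And>\<Delta>. set \<Delta> \<subseteq> H \<Longrightarrow> mso_con D \<Delta>"
    by (rule henkin_set) simp
  \<comment> \<open>Otherwise \<open>\<psi>\<close> would be decided negatively and a finite part of
    \<open>H\<close> would be inconsistent.\<close>
  have closed: "\<psi> \<in> H" if "mso_prf D \<Delta> \<psi>" "set \<Delta> \<subseteq> H" for \<Delta> \<psi>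
  proof (rule HOL.ccontr)
    assume "\<psi> \<notin> H"
    with that dec[of \<psi>] have "MNot \<psi> \<in> H" by (auto simp: decides_def dest: mso_prf_form)
    then have *: "mso_con D (MNot \<psi> # \<Delta>)" using that by (intro con) auto
    then have "mso_prf D (MNot \<psi> # \<Delta>) \<psi>" "mso_prf D (MNot \<psi> # \<Delta>) (MNot \<psi>)"
      using that(1) by (auto simp: mso_con_def intro!: mso_prf_Cons mso_prf.hyp[of "MNot \<psi>"])
    with * show False unfolding mso_con_def by blast
  qed
  have self: "mso_prf D [\<psi>] \<psi>" if "mso_form D \<psi>" for \<psi>
    using that by (auto intro: mso_prf.hyp)
  have neg_iff: "MNot \<psi> \<in> H \<longleftrightarrow> \<psi> \<notin> H" if "mso_form D \<psi>" for \<psi>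
  proof
    assume "MNot \<psi> \<in> H"
    then show "\<psi> \<notin> H"
      using con[of "[\<psi>, MNot \<psi>]"] that mso_prf.hyp[of _ "[\<psi>, MNot \<psi>]" D]
      by (auto simp: mso_con_def)
  qed (use dec[OF that] in \<open>auto simp: decides_def\<close>)
  have or_iff: "MOr \<psi> \<chi> \<in> H \<longleftrightarrow> \<psi> \<in> H \<or> \<chi> \<in> H" if f: "mso_form D \<psi>" "mso_form D \<chi>" for \<psi> \<chi>
  proof
    assume or: "MOr \<psi> \<chi> \<in> H"
    show "\<psi> \<in> H \<or> \<chi> \<in> H"
    proof (rule HOL.ccontr)
      let ?\<Gamma> = "[MOr \<psi> \<chi>, MNot \<chi>]"
      assume *: "\<not> (\<psi> \<in> H \<or> \<chi> \<in> H)"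
      then have "MNot \<chi> \<in> H" using neg_iff f by auto
      moreover have "mso_prf D ?\<Gamma> \<psi>"
      proof (rule mso_prf.orE)
        show "mso_prf D ?\<Gamma> (MOr \<psi> \<chi>)" "mso_prf D (\<psi> # ?\<Gamma>) \<psi>"
          using f by (auto intro!: mso_prf.hyp)
        show "mso_prf D (\<chi> # ?\<Gamma>) \<psi>"
          by (rule mso_explosion[of D _ \<chi>]) (use f in \<open>auto intro!: mso_prf.hyp\<close>)
      qed
      ultimately show False using closed[of ?\<Gamma> \<psi>] or * by simp
    qed
  next
    assume "\<psi> \<in> H \<or> \<chi> \<in> H"
    then show "MOr \<psi> \<chi> \<in> H"
      using closed[OF mso_prf.orI1[OF self[of \<psi>], of \<chi>]] closed[OF mso_prf.orI2[OF self[of \<chi>], of \<psi>]] f by auto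
  qed
  have exI_iff: "MExI \<psi> \<in> H \<longleftrightarrow> (\<exists>t. dir_term D t \<and> minstI t \<psi> \<in> H)" if f: "mso_form D \<psi>" for \<psi>
  proof
    assume "MExI \<psi> \<in> H"
    with dec[of "MExI \<psi>"] neg_iff[of "MExI \<psi>"] f show "\<exists>t. dir_term D t \<and> minstI t \<psi> \<in> H"
      by (auto simp: decides_def)
  next
    assume "\<exists>t. dir_term D t \<and> minstI t \<psi> \<in> H"
    then show "MExI \<psi> \<in> H"
      using closed[OF mso_prf.exI_I[OF _ self]] f by auto
  qed
  have exP_iff: "MExP \<psi> \<in> H \<longleftrightarrow> (\<exists>X. minstP X \<psi> \<in> H)" if f: "mso_form D \<psi>" for \<psi>
  proof
    assume "MExP \<psi> \<in> H"
    with dec[of "MExP \<psi>"] neg_iff[of "MExP \<psi>"] f show "\<exists>X. minstP X \<psi> \<in> H"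
      by (auto simp: decides_def)
  next
    assume "\<exists>X. minstP X \<psi> \<in> H"
    then show "MExP \<psi> \<in> H"
      using closed[OF mso_prf.exP_I[OF self]] f by auto
  qed
  let ?P = "\<lambda>X t. MPred X t \<in> H" and ?E = "\<lambda>t u. MEq t u \<in> H" and ?L = "\<lambda>t u. MLess t u \<in> H"
  interpret term_structure D ?P ?E ?L .
  \<comment> \<open>Individuals are terms, so substitutions double as assignments. They are
    generalised in the induction: a witness is absorbed into \<open>\<sigma>\<close> or
    \<open>\<pi>\<close> while the formula stays a subformula.\<close>
  have truth: "sat \<sigma> \<pi> \<psi> \<longleftrightarrow> msubst \<sigma> \<pi> \<psi> \<in> H"
    if "mso_form D \<psi>" "\<And>i. dir_term D (\<sigma> i)" for \<sigma> \<pi> \<psi>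
    using that
  proof (induction \<psi> arbitrary: \<sigma> \<pi>)
    case (MExI \<psi>)
    then have "msubst \<sigma> \<pi> (MExI \<psi>) \<in> H \<longleftrightarrow> (\<exists>t. dir_term D t \<and> minstI t (msubst (iup \<sigma>) \<pi> \<psi>) \<in> H)"
      by (simp del: msubst_msubst add: exI_iff mso_form_msubst dir_term_iup)
    moreover have "sat (case_nat t \<sigma>) \<pi> \<psi> \<longleftrightarrow> minstI t (msubst (iup \<sigma>) \<pi> \<psi>) \<in> H"
      if "dir_term D t" for t
      using MExI.IH[of "case_nat t \<sigma>" \<pi>] MExI.prems that by (simp add: dir_term_case_nat)
    ultimately show ?case by auto
  next
    case (MExP \<psi>)
    then have "msubst \<sigma> \<pi> (MExP \<psi>) \<in> H \<longleftrightarrow> (\<exists>X. minstP X (msubst \<sigma> (rup \<pi>) \<psi>) \<in> H)"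
      by (simp del: msubst_msubst add: exP_iff mso_form_msubst)
    moreover have "sat \<sigma> (case_nat X \<pi>) \<psi> \<longleftrightarrow> minstP X (msubst \<sigma> (rup \<pi>) \<psi>) \<in> H" for X
      using MExP.IH[of \<sigma> "case_nat X \<pi>"] MExP.prems by simp
    ultimately show ?case by auto
  qed (auto simp: neg_iff or_iff mso_form_msubst)
  show thesis
  proof (rule that)
    show "term_model D ?P ?E ?L"
    proof unfold_locales
      fix \<psi> and \<sigma> :: "nat \<Rightarrow> iterm" and \<pi> assume *: "mso_ax D \<psi>" "mso_form D \<psi>" "\<And>i. dir_term D (\<sigma> i)"
      then have "mso_prf D [] (msubst \<sigma> \<pi> \<psi>)"
        by (intro mso_prf.ax mso_ax_msubst) (auto simp: mso_form_msubst)
      then show "sat \<sigma> \<pi> \<psi>" using truth * closed[of "[]"] by simp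
    qed
    show "\<not> sat IVar id \<phi>"
      using truth[of \<phi> IVar id] assms(1) H neg_iff by simp
  qed
qed

section \<open>FSO in a term model of MSO\<close>

lemma hup_HVar [simp]: "hup HVar = HVar"
  by (rule ext) (simp add: hup_def split: nat.split)

lemma hf_term_HFun:
  "hf_term (HFun \<phi> Ks) \<longleftrightarrow> sk_form \<phi> \<and> sbound (Suc (length Ks)) \<phi> \<and>
    [] \<turnstile>\<^sub>S SAlls (length Ks) (SEx1 \<phi>) \<and> (\<forall>K \<in> set Ks. hf_term K)"
  by (subst hf_term.simps) auto

lemma hf_term_simps [simp]: "hf_term (HVar i)" "hf_term (HConst \<kappa>)"
  by (auto intro: hf_var hf_const)

lemma hf_term_hsubst: "(\<And>i. hf_term (\<tau> i)) \<Longrightarrow> hf_term (hsubst \<tau> K) \<longleftrightarrow> hf_term K"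
  by (induction K rule: hterm.induct[where ?P2.0="\<lambda>_. True"]) (auto simp: hf_term_HFun)

lemma hf_term_hup: "(\<And>i. hf_term (\<tau> i)) \<Longrightarrow> hf_term (hup \<tau> i)"
  by (simp add: hup_def hf_term_hsubst split: nat.split)

lemma hf_term_case_nat: "hf_term K \<Longrightarrow> hf_term (case_nat K HVar i)"
  by (simp split: nat.split)

lemma fso_form_fsubst:
  "(\<And>i. dir_term D (\<sigma> i)) \<Longrightarrow> (\<And>i. hf_term (\<tau> i)) \<Longrightarrow>
    fso_form D (fsubst \<sigma> \<tau> \<rho> \<phi>) \<longleftrightarrow> fso_form D \<phi>"
  by (induction \<phi> arbitrary: \<sigma> \<tau> \<rho>)
    (auto simp: dir_term_isubst dir_term_iup hf_term_hsubst hf_term_hup)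

lemma fso_form_lift_inst [simp]:
  "fso_form D (fliftI \<phi>) \<longleftrightarrow> fso_form D \<phi>"
  "fso_form D (fliftH \<phi>) \<longleftrightarrow> fso_form D \<phi>"
  "fso_form D (fsubst IVar HVar \<rho> \<phi>) \<longleftrightarrow> fso_form D \<phi>"
  "dir_term D t \<Longrightarrow> fso_form D (finstI t \<phi>) \<longleftrightarrow> fso_form D \<phi>"
  "hf_term K \<Longrightarrow> fso_form D (finstH K \<phi>) \<longleftrightarrow> fso_form D \<phi>"
  by (simp_all add: fso_form_fsubst dir_term_case_nat hf_term_case_nat)

lemma fso_form_foldr:
  "fso_form D (foldr (\<lambda>d. FImp (A d)) ds \<phi>) \<longleftrightarrow> (\<forall>d\<in>set ds. fso_form D (A d)) \<and> fso_form D \<phi>"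
  by (induction ds) auto

context term_model
begin

abbreviation valid :: "(nat \<Rightarrow> iterm) \<Rightarrow> bool" where
  "valid \<sigma> \<equiv> (\<forall>i. dir_term D (\<sigma> i))"

lemma valid_case_nat: "valid \<sigma> \<Longrightarrow> dir_term D t \<Longrightarrow> valid (case_nat t \<sigma>)"
  by (simp add: dir_term_case_nat)

subsection \<open>Definable relations\<close>

text \<open>Relations on assignments replace the explicit MSO formulas and their index shifts; the
  closure lemmas below stand in for the connectives.\<close>

definition definable :: "((nat \<Rightarrow> iterm) \<Rightarrow> (nat \<Rightarrow> nat) \<Rightarrow> bool) \<Rightarrow> bool" where
  "definable R \<longleftrightarrow> (\<exists>\<psi>. mso_form D \<psi> \<and> (\<forall>\<sigma> \<pi>. valid \<sigma> \<longrightarrow> (R \<sigma> \<pi> \<longleftrightarrow> sat \<sigma> \<pi> \<psi>)))"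

lemma definable_sat: "mso_form D \<psi> \<Longrightarrow> definable (\<lambda>\<sigma> \<pi>. sat \<sigma> \<pi> \<psi>)"
  unfolding definable_def by blast

lemma definable_not: "definable R \<Longrightarrow> definable (\<lambda>\<sigma> \<pi>. \<not> R \<sigma> \<pi>)"
  unfolding definable_def by (metis mso_form.simps(4) sat.simps(4))

lemma definable_or: "definable R \<Longrightarrow> definable S \<Longrightarrow> definable (\<lambda>\<sigma> \<pi>. R \<sigma> \<pi> \<or> S \<sigma> \<pi>)"
  unfolding definable_def by (metis mso_form.simps(5) sat.simps(5))

lemma definable_and: "definable R \<Longrightarrow> definable S \<Longrightarrow> definable (\<lambda>\<sigma> \<pi>. R \<sigma> \<pi> \<and> S \<sigma> \<pi>)"
  using definable_not[OF definable_or[OF definable_not definable_not]] by simp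

lemma definable_const: "definable (\<lambda>\<sigma> \<pi>. b)"
proof -
  have "definable (\<lambda>\<sigma> \<pi>. True)"
    unfolding definable_def
    using sat_ax[OF mso_ax.eq_refl[of D Root]] by (intro exI[of _ "MEq Root Root"]) (simp del: sat.simps)
  then show ?thesis using definable_not[of "\<lambda>_ _. True"] by (cases b) auto
qed

lemma definable_exI: "definable R \<Longrightarrow> definable (\<lambda>\<sigma> \<pi>. \<exists>t. dir_term D t \<and> R (case_nat t \<sigma>) \<pi>)"
proof -
  assume "definable R"
  then obtain \<psi> where "mso_form D \<psi>" "\<And>\<sigma> \<pi>. valid \<sigma> \<Longrightarrow> R \<sigma> \<pi> \<longleftrightarrow> sat \<sigma> \<pi> \<psi>"
    unfolding definable_def by blast
  then show ?thesis
    unfolding definable_def by (intro exI[of _ "MExI \<psi>"]) (auto simp: dir_term_case_nat)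
qed

lemma definable_allI: "definable R \<Longrightarrow> definable (\<lambda>\<sigma> \<pi>. \<forall>t. dir_term D t \<longrightarrow> R (case_nat t \<sigma>) \<pi>)"
  using definable_not[OF definable_exI[OF definable_not]] by simp

lemma definable_exP: "definable R \<Longrightarrow> definable (\<lambda>\<sigma> \<pi>. \<exists>X. R \<sigma> (case_nat X \<pi>))"
proof -
  assume "definable R"
  then obtain \<psi> where "mso_form D \<psi>" "\<And>\<sigma> \<pi>. valid \<sigma> \<Longrightarrow> R \<sigma> \<pi> \<longleftrightarrow> sat \<sigma> \<pi> \<psi>"
    unfolding definable_def by blast
  then show ?thesis
    unfolding definable_def by (intro exI[of _ "MExP \<psi>"]) auto
qed

definition prepend :: "nat \<Rightarrow> (nat \<Rightarrow> nat) \<Rightarrow> (nat \<Rightarrow> nat) \<Rightarrow> nat \<Rightarrow> nat" where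
  "prepend n \<pi>' \<pi> i = (if i < n then \<pi>' i else \<pi> (i - n))"

lemma definable_exPs: "definable R \<Longrightarrow> definable (\<lambda>\<sigma> \<pi>. \<exists>\<pi>'. R \<sigma> (prepend n \<pi>' \<pi>))"
proof (induction n arbitrary: R)
  case 0
  have "prepend 0 \<pi>' \<pi> = \<pi>" for \<pi>' \<pi> by (rule ext) (simp add: prepend_def)
  with 0 show ?case by simp
next
  case (Suc n)
  have "case_nat X (prepend n \<pi>' \<pi>) = prepend (Suc n) (case_nat X \<pi>') \<pi>" for X \<pi>' \<pi>
    by (rule ext) (auto simp: prepend_def split: nat.split)
  moreover have "prepend (Suc n) \<pi>' \<pi> = case_nat (\<pi>' 0) (prepend n (\<lambda>i. \<pi>' (Suc i)) \<pi>)" for \<pi>' \<pi>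
    by (rule ext) (auto simp: prepend_def split: nat.split)
  ultimately have "(\<exists>\<pi>'. R \<sigma> (prepend (Suc n) \<pi>' \<pi>)) \<longleftrightarrow> (\<exists>\<pi>' X. R \<sigma> (case_nat X (prepend n \<pi>' \<pi>)))" for \<sigma> \<pi>
    by metis
  with Suc.IH[OF definable_exP[OF Suc.prems]] show ?case by simp
qed

lemma definable_Bex:
  "finite A \<Longrightarrow> (\<And>a. a \<in> A \<Longrightarrow> definable (R a)) \<Longrightarrow> definable (\<lambda>\<sigma> \<pi>. \<exists>a\<in>A. R a \<sigma> \<pi>)"
  by (induction rule: finite_induct) (auto intro: definable_const definable_or)

lemma definable_Ball:
  "finite A \<Longrightarrow> (\<And>a. a \<in> A \<Longrightarrow> definable (R a)) \<Longrightarrow> definable (\<lambda>\<sigma> \<pi>. \<forall>a\<in>A. R a \<sigma> \<pi>)"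
  by (induction rule: finite_induct) (auto intro: definable_const definable_and)

subsection \<open>Sets of individuals which are Predicates\<close>

definition predicate :: "(iterm \<Rightarrow> bool) \<Rightarrow> bool" where
  "predicate Q \<longleftrightarrow> (\<exists>X. \<forall>t. dir_term D t \<longrightarrow> (P X t \<longleftrightarrow> Q t))"

lemma predicate_cong: "(\<And>t. dir_term D t \<Longrightarrow> Q t \<longleftrightarrow> Q' t) \<Longrightarrow> predicate Q \<longleftrightarrow> predicate Q'"
  unfolding predicate_def by auto

text \<open>An instance of comprehension, in which \<open>mliftP\<close> keeps the new Predicate out
  of the defining formula.\<close>

lemma predicate_sat:
  assumes "mso_form D \<psi>" "valid \<sigma>"
  shows "predicate (\<lambda>t. sat (case_nat t \<sigma>) \<pi> \<psi>)"
  using sat_ax[OF mso_ax.comprehension[of D \<psi>], of \<sigma> \<pi>] assms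
  unfolding predicate_def by auto

lemma predicate_definable:
  assumes "definable R" "valid \<sigma>"
  shows "predicate (\<lambda>t. R (case_nat t \<sigma>) \<pi>)"
proof -
  from assms(1) obtain \<psi> where "mso_form D \<psi>" "\<And>\<sigma> \<pi>. valid \<sigma> \<Longrightarrow> R \<sigma> \<pi> \<longleftrightarrow> sat \<sigma> \<pi> \<psi>"
    unfolding definable_def by blast
  with predicate_sat[of \<psi> \<sigma> \<pi>] assms(2) show ?thesis
    by (subst predicate_cong) (auto simp: dir_term_case_nat)
qed

lemma valid_Root: "valid (\<lambda>_. Root)" by simp

lemma predicate_const: "predicate (\<lambda>t. b)"
  using predicate_definable[OF definable_const valid_Root] .

lemma predicate_not: "predicate Q \<Longrightarrow> predicate (\<lambda>t. \<not> Q t)"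
proof -
  assume "predicate Q"
  then obtain X where "\<And>t. dir_term D t \<Longrightarrow> P X t \<longleftrightarrow> Q t"
    unfolding predicate_def by blast
  then show ?thesis
    using predicate_sat[of "MNot (MPred 0 (IVar 0))" "\<lambda>_. Root" "\<lambda>_. X"]
    by (subst predicate_cong) auto
qed

lemma predicate_and:
  assumes "predicate Q" "predicate Q'"
  shows "predicate (\<lambda>t. Q t \<and> Q' t)"
proof -
  from assms obtain X Y where "\<And>t. dir_term D t \<Longrightarrow> P X t \<longleftrightarrow> Q t" "\<And>t. dir_term D t \<Longrightarrow> P Y t \<longleftrightarrow> Q' t"
    unfolding predicate_def by blast
  then show ?thesis
    using predicate_sat[of "MAnd (MPred 0 (IVar 0)) (MPred 1 (IVar 0))" "\<lambda>_. Root" "case_nat X (\<lambda>_. Y)"]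
    by (subst predicate_cong) auto
qed

lemma predicate_Ball:
  "finite A \<Longrightarrow> (\<And>a. a \<in> A \<Longrightarrow> predicate (Q a)) \<Longrightarrow> predicate (\<lambda>t. \<forall>a\<in>A. Q a t)"
  by (induction rule: finite_induct) (auto intro: predicate_const predicate_and)

subsection \<open>Interpretation of FSO\<close>

text \<open>All \<open>k\<close> are quantified, not only those of some type: a value that is never
  taken has the empty fibre. Free Function variables thus remain untyped, and a type enters only in
  the clause for \<open>FExF\<close>.\<close>

definition adm :: "(iterm \<Rightarrow> hf) \<Rightarrow> bool" where
  "adm f \<longleftrightarrow> (\<forall>k. predicate (\<lambda>t. f t = k))"

primrec fsat :: "(nat \<Rightarrow> iterm) \<Rightarrow> (nat \<Rightarrow> hf) \<Rightarrow> (nat \<Rightarrow> iterm \<Rightarrow> hf) \<Rightarrow> fso \<Rightarrow> bool" where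
  "fsat \<sigma> e \<rho> (FEq t u) \<longleftrightarrow> E (isubst \<sigma> t) (isubst \<sigma> u)"
| "fsat \<sigma> e \<rho> (FLess t u) \<longleftrightarrow> L (isubst \<sigma> t) (isubst \<sigma> u)"
| "fsat \<sigma> e \<rho> (FFun F t M) \<longleftrightarrow> \<rho> F (isubst \<sigma> t) = heval e M"
| "fsat \<sigma> e \<rho> (FHEq K M) \<longleftrightarrow> heval e K = heval e M"
| "fsat \<sigma> e \<rho> (FHIn K M) \<longleftrightarrow> heval e K |\<in>| elts (heval e M)"
| "fsat \<sigma> e \<rho> (FNot \<phi>) \<longleftrightarrow> \<not> fsat \<sigma> e \<rho> \<phi>"
| "fsat \<sigma> e \<rho> (FOr \<phi> \<psi>) \<longleftrightarrow> fsat \<sigma> e \<rho> \<phi> \<or> fsat \<sigma> e \<rho> \<psi>"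
| "fsat \<sigma> e \<rho> (FExI \<phi>) \<longleftrightarrow> (\<exists>t. dir_term D t \<and> fsat (case_nat t \<sigma>) e \<rho> \<phi>)"
| "fsat \<sigma> e \<rho> (FExH K \<phi>) \<longleftrightarrow> (\<exists>v. v |\<in>| elts (heval e K) \<and> fsat \<sigma> (case_nat v e) \<rho> \<phi>)"
| "fsat \<sigma> e \<rho> (FExF K \<phi>) \<longleftrightarrow>
    (\<exists>f. adm f \<and> (\<forall>t. dir_term D t \<longrightarrow> f t |\<in>| elts (heval e K)) \<and> fsat \<sigma> e (case_nat f \<rho>) \<phi>)"

lemma fsat_fsubst [simp]:
  "fsat \<sigma> e \<rho> (fsubst \<sigma>' \<tau> \<rho>' \<phi>) \<longleftrightarrow>
    fsat (\<lambda>i. isubst \<sigma> (\<sigma>' i)) (\<lambda>i. heval e (\<tau> i)) (\<lambda>i. \<rho> (\<rho>' i)) \<phi>"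
  by (induction \<phi> arbitrary: \<sigma> e \<rho> \<sigma>' \<tau> \<rho>') auto

text \<open>The symbolic part \<open>c\<close> names an MSO index for each fibre, and
  \<open>\<pi>\<close> supplies the Predicate found there. A formula obtained from \<open>c\<close>
  then serves for all \<open>\<pi>\<close> and \<open>\<rho>\<close> at once.\<close>

definition codes :: "(nat \<Rightarrow> hf \<Rightarrow> nat) \<Rightarrow> (nat \<Rightarrow> nat) \<Rightarrow> (nat \<Rightarrow> iterm \<Rightarrow> hf) \<Rightarrow> bool" where
  "codes c \<pi> \<rho> \<longleftrightarrow> (\<forall>F k t. dir_term D t \<longrightarrow> (P (\<pi> (c F k)) t \<longleftrightarrow> \<rho> F t = k))"

text \<open>\<open>R\<close> is chosen after the HF-environment \<open>e\<close> but before
  \<open>\<sigma>\<close>, \<open>\<pi>\<close> and \<open>\<rho>\<close>. The bound of a Function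
  quantifier is therefore a known finite set when \<open>R\<close> is built.\<close>

definition represents ::
  "((nat \<Rightarrow> iterm) \<Rightarrow> (nat \<Rightarrow> nat) \<Rightarrow> bool) \<Rightarrow> (nat \<Rightarrow> hf \<Rightarrow> nat) \<Rightarrow> (nat \<Rightarrow> hf) \<Rightarrow> fso \<Rightarrow> bool" where
  "represents R c e \<phi> \<longleftrightarrow> definable R \<and>
    (\<forall>\<sigma> \<pi> \<rho>. valid \<sigma> \<and> codes c \<pi> \<rho> \<longrightarrow> (fsat \<sigma> e \<rho> \<phi> \<longleftrightarrow> R \<sigma> \<pi>))"

text \<open>
  A quantifier over Functions into a set with \<open>m\<close> elements becomes a quantifier over
  \<open>m + 1\<close> Predicates: a partition into \<open>m\<close> fibres, and the empty set as the fibre over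
  everything else.
\<close>

lemma represents_FExF:
  assumes IH: "\<And>c. \<exists>R. represents R c e \<phi>"
  shows "\<exists>R. represents R c e (FExF K \<phi>)"
proof -
  let ?\<kappa> = "heval e K"
  let ?A = "fset (elts ?\<kappa>)"
  obtain h and m :: nat where h: "bij_betw h ?A {..<m}"
    using ex_bij_betw_finite_nat[of ?A] by (auto simp: atLeast0LessThan)
  \<comment> \<open>The new Function has index \<open>0\<close>: its fibre over
    \<open>k \<in> ?A\<close> is held by Predicate \<open>h k\<close>, and all other fibres share
    Predicate \<open>m\<close>. The older codes move past the \<open>Suc m\<close> new
    Predicates.\<close>
  define c' where
    "c' = case_nat (\<lambda>k. if k \<in> ?A then h k else m) (\<lambda>F k. c F k + Suc m)"
  obtain S where S: "represents S c' e \<phi>" using IH by blast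
  \<comment> \<open>Since \<open>j = m\<close> is always among the excluded indices, this states
    both that the first \<open>m\<close> Predicates form a partition and that Predicate
    \<open>m\<close> is empty.\<close>
  define good where "good \<pi> \<longleftrightarrow> (\<forall>t. dir_term D t \<longrightarrow>
      (\<exists>i\<in>{..<m}. P (\<pi> i) t \<and> (\<forall>j\<in>{..m} - {i}. \<not> P (\<pi> j) t)))" for \<pi>
  have "definable (\<lambda>\<sigma> \<pi>. P (\<pi> j) (\<sigma> 0))" for j
    using definable_sat[of "MPred j (IVar 0)"] by simp
  then have "definable (\<lambda>\<sigma> \<pi>. \<exists>i\<in>{..<m}. P (\<pi> i) (\<sigma> 0) \<and> (\<forall>j\<in>{..m} - {i}. \<not> P (\<pi> j) (\<sigma> 0)))"
    by (intro definable_Bex definable_and definable_Ball definable_not) auto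
  from definable_allI[OF this] have "definable (\<lambda>\<sigma> \<pi>. good \<pi>)"
    by (simp add: good_def)
  then have "definable (\<lambda>\<sigma> \<pi>. good \<pi> \<and> S \<sigma> \<pi>)"
    using S by (intro definable_and) (auto simp: represents_def)
  then have "definable (\<lambda>\<sigma> \<pi>. \<exists>\<pi>'. good (prepend (Suc m) \<pi>' \<pi>) \<and> S \<sigma> (prepend (Suc m) \<pi>' \<pi>))"
    by (rule definable_exPs)
  moreover have "fsat \<sigma> e \<rho> (FExF K \<phi>) \<longleftrightarrow>
      (\<exists>\<pi>'. good (prepend (Suc m) \<pi>' \<pi>) \<and> S \<sigma> (prepend (Suc m) \<pi>' \<pi>))"
    if \<sigma>: "valid \<sigma>" and \<rho>: "codes c \<pi> \<rho>" for \<sigma> \<pi> \<rho>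
  proof
    assume "fsat \<sigma> e \<rho> (FExF K \<phi>)"
    then obtain f where f: "adm f" "\<And>t. dir_term D t \<Longrightarrow> f t \<in> ?A" "fsat \<sigma> e (case_nat f \<rho>) \<phi>"
      by auto
    from f(1) obtain X where X: "\<And>k t. dir_term D t \<Longrightarrow> P (X k) t \<longleftrightarrow> f t = k"
      unfolding adm_def predicate_def by metis
    \<comment> \<open>Index \<open>m\<close> needs an empty Predicate, and the fibre over
      \<open>?\<kappa>\<close> itself is one: \<open>f\<close> takes its values in
      \<open>?\<kappa>\<close>, and no set is an element of itself.\<close>
    define \<pi>' where "\<pi>' i = (if i < m then X (inv_into ?A h i) else X ?\<kappa>)" for i
    have h_inv: "inv_into ?A h (h k) = k" if "k \<in> ?A" for k
      using h that by (auto simp: bij_betw_def)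
    have h_less: "h k < m" if "k \<in> ?A" for k
      using h that by (auto simp: bij_betw_def)
    have \<kappa>: "\<not> P (X ?\<kappa>) t" if "dir_term D t" for t
      using X[OF that, of ?\<kappa>] f(2)[OF that] mem_irrefl by metis
    have "good (prepend (Suc m) \<pi>' \<pi>)"
      unfolding good_def
    proof (intro allI impI)
      fix t assume t: "dir_term D t"
      note ft = f(2)[OF t]
      have "\<not> P (\<pi>' j) t" if "j \<le> m" "j \<noteq> h (f t)" for j
      proof (cases "j < m")
        case True
        then have "inv_into ?A h j \<in> ?A" "h (inv_into ?A h j) = j"
          using h by (auto simp: bij_betw_def intro: inv_into_into f_inv_into_f)
        with that True X[OF t] show ?thesis by (auto simp: \<pi>'_def)
      qed (use \<kappa>[OF t] in \<open>simp add: \<pi>'_def\<close>)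
      moreover have "P (\<pi>' (h (f t))) t"
        using h_less[OF ft] h_inv[OF ft] X[OF t] by (simp add: \<pi>'_def)
      ultimately show "\<exists>i\<in>{..<m}. P (prepend (Suc m) \<pi>' \<pi> i) t \<and>
          (\<forall>j\<in>{..m} - {i}. \<not> P (prepend (Suc m) \<pi>' \<pi> j) t)"
        using h_less[OF ft] by (intro bexI[of _ "h (f t)"]) (auto simp: prepend_def)
    qed
    moreover have "codes c' (prepend (Suc m) \<pi>' \<pi>) (case_nat f \<rho>)"
      unfolding codes_def
    proof (intro allI impI)
      fix F k t assume t: "dir_term D t"
      show "P (prepend (Suc m) \<pi>' \<pi> (c' F k)) t \<longleftrightarrow> case_nat f \<rho> F t = k"
      proof (cases F)
        case 0
        have "P (\<pi>' (c' 0 k)) t \<longleftrightarrow> f t = k"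
        proof (cases "k \<in> ?A")
          case True
          then show ?thesis
            using h_less[OF True] h_inv[OF True] X[OF t] by (simp add: \<pi>'_def c'_def)
        next
          case False
          with f(2)[OF t] \<kappa>[OF t] show ?thesis by (auto simp: \<pi>'_def c'_def)
        qed
        moreover have "c' 0 k < Suc m" using h_less[of k] by (simp add: c'_def less_Suc_eq)
        ultimately show ?thesis using 0 by (simp add: prepend_def)
      next
        case (Suc G)
        then show ?thesis using \<rho> t by (simp add: prepend_def c'_def codes_def)
      qed
    qed
    ultimately show "\<exists>\<pi>'. good (prepend (Suc m) \<pi>' \<pi>) \<and> S \<sigma> (prepend (Suc m) \<pi>' \<pi>)"
      using S \<sigma> f(3) unfolding represents_def by blast
  next
    assume "\<exists>\<pi>'. good (prepend (Suc m) \<pi>' \<pi>) \<and> S \<sigma> (prepend (Suc m) \<pi>' \<pi>)"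
    then obtain \<pi>' where good: "good (prepend (Suc m) \<pi>' \<pi>)" and "S \<sigma> (prepend (Suc m) \<pi>' \<pi>)"
      by blast
    \<comment> \<open>The Function is read back from the partition; \<open>good\<close> leaves
      exactly one candidate for \<open>SOME\<close> at every individual.\<close>
    define f where "f t = (SOME k. k \<in> ?A \<and> P (\<pi>' (h k)) t)" for t
    have f: "f t \<in> ?A \<and> (\<forall>k. P (\<pi>' (c' 0 k)) t \<longleftrightarrow> f t = k)" if t: "dir_term D t" for t
    proof -
      from good t obtain i where i: "i < m" "P (\<pi>' i) t" "\<And>j. j \<le> m \<Longrightarrow> j \<noteq> i \<Longrightarrow> \<not> P (\<pi>' j) t"
        unfolding good_def by (fastforce simp: prepend_def)
      from h i(1) obtain k0 where k0: "k0 \<in> ?A" "h k0 = i"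
        unfolding bij_betw_def by (metis imageE lessThan_iff)
      have uniq: "k = k0" if "k \<in> ?A" "P (\<pi>' (h k)) t" for k
      proof -
        have "h k < m" using h that(1) by (auto simp: bij_betw_def)
        then have "h k = h k0" using i(3)[of "h k"] that(2) k0 by auto
        with h that(1) k0(1) show ?thesis by (auto simp: bij_betw_def inj_on_def)
      qed
      have "f t = k0" unfolding f_def
      proof (rule some_equality)
        show "k0 \<in> ?A \<and> P (\<pi>' (h k0)) t" using k0 i(2) by simp
      qed (use uniq in blast)
      moreover have "P (\<pi>' (c' 0 k)) t \<longleftrightarrow> k = k0" for k
        using uniq[of k] k0 i by (auto simp: c'_def)
      ultimately show ?thesis using k0 by auto
    qed
    have "adm f"
      unfolding adm_def predicate_def using f by blast
    moreover have "codes c' (prepend (Suc m) \<pi>' \<pi>) (case_nat f \<rho>)"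
      unfolding codes_def
    proof (intro allI impI)
      fix F k t assume t: "dir_term D t"
      show "P (prepend (Suc m) \<pi>' \<pi> (c' F k)) t \<longleftrightarrow> case_nat f \<rho> F t = k"
      proof (cases F)
        case 0
        have "c' 0 k < Suc m" using h by (auto simp: c'_def less_Suc_eq bij_betw_def)
        with 0 f[OF t] show ?thesis by (simp add: prepend_def)
      next
        case (Suc G)
        then show ?thesis using \<rho> t by (simp add: prepend_def c'_def codes_def)
      qed
    qed
    then have "fsat \<sigma> e (case_nat f \<rho>) \<phi>"
      using S \<sigma> \<open>S \<sigma> _\<close> unfolding represents_def by blast
    ultimately show "fsat \<sigma> e \<rho> (FExF K \<phi>)" using f by auto
  qed
  ultimately show ?thesis unfolding represents_def by blast
qed

text \<open>\<open>c\<close> and \<open>e\<close> are generalised in the induction because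
  \<open>FExF\<close> extends the coding and \<open>FExH\<close> the environment.\<close>

lemma ex_represents: "fso_form D \<phi> \<Longrightarrow> \<exists>R. represents R c e \<phi>"
proof (induction \<phi> arbitrary: c e)
  case (FEq t u)
  then show ?case
    using definable_sat[of "MEq t u"] by (auto simp: represents_def)
next
  case (FLess t u)
  then show ?case
    using definable_sat[of "MLess t u"] by (auto simp: represents_def)
next
  case (FFun F t M)
  then show ?case
    using definable_sat[of "MPred (c F (heval e M)) t"]
    by (intro exI[of _ "\<lambda>\<sigma> \<pi>. P (\<pi> (c F (heval e M))) (isubst \<sigma> t)"])
      (auto simp: represents_def codes_def dir_term_isubst)
next
  case (FHEq K M)
  then show ?case using definable_const by (auto simp: represents_def)
next
  case (FHIn K M)
  then show ?case using definable_const by (auto simp: represents_def)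
next
  case (FNot \<phi>)
  then obtain R where "represents R c e \<phi>" by fastforce
  then have "represents (\<lambda>\<sigma> \<pi>. \<not> R \<sigma> \<pi>) c e (FNot \<phi>)"
    by (auto simp: represents_def intro: definable_not)
  then show ?case by blast
next
  case (FOr \<phi> \<psi>)
  then obtain R S where "represents R c e \<phi>" "represents S c e \<psi>" by fastforce
  then have "represents (\<lambda>\<sigma> \<pi>. R \<sigma> \<pi> \<or> S \<sigma> \<pi>) c e (FOr \<phi> \<psi>)"
    by (auto simp: represents_def intro: definable_or)
  then show ?case by blast
next
  case (FExI \<phi>)
  then obtain R where "represents R c e \<phi>" by fastforce
  then have "represents (\<lambda>\<sigma> \<pi>. \<exists>t. dir_term D t \<and> R (case_nat t \<sigma>) \<pi>) c e (FExI \<phi>)"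
    by (auto simp: represents_def dir_term_case_nat intro: definable_exI)
  then show ?case by blast
next
  case (FExH K \<phi>)
  \<comment> \<open>One relation for each value of the bound HF-variable; the finitely many elements
    of the bound allow them to be joined by a disjunction.\<close>
  then have "\<forall>v. \<exists>R. represents R c (case_nat v e) \<phi>" by simp
  from Hilbert_Choice.choice[OF this] obtain R where R: "\<And>v. represents (R v) c (case_nat v e) \<phi>" by blast
  then have "definable (\<lambda>\<sigma> \<pi>. \<exists>v\<in>fset (elts (heval e K)). R v \<sigma> \<pi>)"
    by (intro definable_Bex) (auto simp: represents_def)
  with R have "represents (\<lambda>\<sigma> \<pi>. \<exists>v\<in>fset (elts (heval e K)). R v \<sigma> \<pi>) c e (FExH K \<phi>)"
    by (auto simp: represents_def)
  then show ?case by blast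
next
  case (FExF K \<phi>)
  then show ?case by (intro represents_FExF) simp
qed

text \<open>With HF-values and Functions as parameters, an FSO formula defines nothing beyond MSO.
  The single \<open>\<psi>\<close> works for all \<open>\<sigma>\<close>, which lets comprehension,
  induction and the equality axiom of MSO be applied to it.\<close>

lemma fsat_mso:
  assumes "fso_form D \<phi>" "\<And>F. adm (\<rho> F)"
  shows "\<exists>\<psi> \<pi>. mso_form D \<psi> \<and> (\<forall>\<sigma>. valid \<sigma> \<longrightarrow> (fsat \<sigma> e \<rho> \<phi> \<longleftrightarrow> sat \<sigma> \<pi> \<psi>))"
proof -
  from assms(2) obtain X where X: "\<And>F k t. dir_term D t \<Longrightarrow> P (X F k) t \<longleftrightarrow> \<rho> F t = k"
    unfolding adm_def predicate_def by metis
  \<comment> \<open>Pairing gives each fibre of each Function variable its own Predicate index, so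
    one assignment codes all of \<open>\<rho>\<close>.\<close>
  let ?c = "\<lambda>F k. to_nat (F, k)" and ?\<pi> = "\<lambda>n. case from_nat n of (F, k) \<Rightarrow> X F k"
  obtain R where "represents R ?c e \<phi>" using ex_represents[OF assms(1)] by blast
  moreover have "codes ?c ?\<pi> \<rho>" using X by (simp add: codes_def)
  ultimately show ?thesis
    unfolding represents_def definable_def by blast
qed

text \<open>Comprehension for FSO formulas, from which the induction scheme and the admissibility of
  choice functions follow.\<close>

lemma predicate_fsat:
  assumes "fso_form D \<phi>" "\<And>F. adm (\<rho> F)" "valid \<sigma>"
  shows "predicate (\<lambda>t. fsat (case_nat t \<sigma>) e \<rho> \<phi>)"
proof -
  obtain \<psi> \<pi> where "mso_form D \<psi>" "\<And>\<sigma>. valid \<sigma> \<Longrightarrow> fsat \<sigma> e \<rho> \<phi> \<longleftrightarrow> sat \<sigma> \<pi> \<psi>"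
    using fsat_mso[of \<phi> \<rho> e, OF assms(1,2)] by blast
  with predicate_sat[of \<psi> \<sigma> \<pi>] assms(3) show ?thesis
    by (subst predicate_cong) (auto simp: dir_term_case_nat)
qed

subsection \<open>Soundness\<close>

lemma fsat_abbrevs:
  "fsat \<sigma> e \<rho> (FAnd \<phi> \<psi>) \<longleftrightarrow> fsat \<sigma> e \<rho> \<phi> \<and> fsat \<sigma> e \<rho> \<psi>"
  "fsat \<sigma> e \<rho> (FImp \<phi> \<psi>) \<longleftrightarrow> (fsat \<sigma> e \<rho> \<phi> \<longrightarrow> fsat \<sigma> e \<rho> \<psi>)"
  "fsat \<sigma> e \<rho> (FAllI \<phi>) \<longleftrightarrow> (\<forall>t. dir_term D t \<longrightarrow> fsat (case_nat t \<sigma>) e \<rho> \<phi>)"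
  "fsat \<sigma> e \<rho> (FAllH K \<phi>) \<longleftrightarrow> (\<forall>v. v |\<in>| elts (heval e K) \<longrightarrow> fsat \<sigma> (case_nat v e) \<rho> \<phi>)"
  by auto

lemma fsat_foldr:
  "fsat \<sigma> e \<rho> (foldr (\<lambda>d. FImp (A d)) ds \<phi>) \<longleftrightarrow> ((\<forall>d\<in>set ds. fsat \<sigma> e \<rho> (A d)) \<longrightarrow> fsat \<sigma> e \<rho> \<phi>)"
  by (induction ds) auto

lemma sat_abbrevs:
  "sat \<sigma> \<pi> (MImp \<phi> \<psi>) \<longleftrightarrow> (sat \<sigma> \<pi> \<phi> \<longrightarrow> sat \<sigma> \<pi> \<psi>)"
  "sat \<sigma> \<pi> (MAllI \<phi>) \<longleftrightarrow> (\<forall>t. dir_term D t \<longrightarrow> sat (case_nat t \<sigma>) \<pi> \<phi>)"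
  "sat \<sigma> \<pi> (MAllP \<phi>) \<longleftrightarrow> (\<forall>X. sat \<sigma> (case_nat X \<pi>) \<phi>)"
  by auto

lemma sat_foldr:
  "sat \<sigma> \<pi> (foldr (\<lambda>d. MImp (A d)) ds \<phi>) \<longleftrightarrow> ((\<forall>d\<in>set ds. sat \<sigma> \<pi> (A d)) \<longrightarrow> sat \<sigma> \<pi> \<phi>)"
  by (induction ds) auto

lemma predicate_induct:
  assumes "predicate Q" "Q Root" "\<And>d t. d |\<in>| elts D \<Longrightarrow> dir_term D t \<Longrightarrow> Q t \<Longrightarrow> Q (Succ d t)"
    and "dir_term D t"
  shows "Q t"
proof -
  obtain ds where ds: "set ds = fset (elts D)" using finite_list[of "fset (elts D)"] by auto
  then have ds': "set ds \<subseteq> fset (elts D)" by simp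
  then have "mso_form D (foldr (\<lambda>d. MImp (MAllI (MImp (MPred 0 (IVar 0)) (MPred 0 (Succ d (IVar 0)))))) ds
         (MAllI (MPred 0 (IVar 0))))"
    by (induction ds) auto
  then have "sat (\<lambda>_. Root) (\<lambda>_. 0) (MAllP (MImp (MPred 0 Root)
       (foldr (\<lambda>d. MImp (MAllI (MImp (MPred 0 (IVar 0)) (MPred 0 (Succ d (IVar 0)))))) ds
         (MAllI (MPred 0 (IVar 0))))))"
    using ds by (intro sat_ax mso_ax.induction) auto
  then have *: "\<forall>X. P X Root \<longrightarrow> (\<forall>d\<in>set ds. \<forall>t. dir_term D t \<longrightarrow> P X t \<longrightarrow> P X (Succ d t)) \<longrightarrow>
      (\<forall>t. dir_term D t \<longrightarrow> P X t)"
    unfolding sat_abbrevs sat_foldr unfolding sat.simps isubst.simps nat.case .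
  from assms(1) obtain X where X: "\<And>t. dir_term D t \<Longrightarrow> P X t \<longleftrightarrow> Q t"
    unfolding predicate_def by blast
  have "P X t"
  proof (rule *[rule_format, OF _ _ assms(4)])
    show "P X Root" using X assms(2) by simp
    show "P X (Succ d t)" if "d \<in> set ds" "dir_term D t" "P X t" for d t
      using that X assms(3) ds by simp
  qed
  with X assms(4) show ?thesis by simp
qed

lemma fsat_hf_formula: "hf_formula \<phi> \<psi> \<Longrightarrow> fsat \<sigma> e \<rho> \<phi> \<longleftrightarrow> seval e \<psi>"
  by (induction arbitrary: e rule: hf_formula.induct) auto

section \<open>The replacement of \<open>F\<close> by \<open>G(k)\<close>, and admissible choice
  functions\<close>

lemma heval_HFun_cong:
  assumes "map (heval e) Ks = map (heval e') Ks'"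
  shows "heval e (HFun \<phi> Ks) = heval e' (HFun \<phi> Ks')"
proof -
  have "length Ks = length Ks'" using assms by (metis length_map)
  with assms show ?thesis by (simp only: heval.simps)
qed

text \<open>Application as an operation on values rather than terms, so that \<open>fun_repl\<close>
  can be read as an update of \<open>\<rho>\<close>.\<close>

definition happv :: "hf \<Rightarrow> hf \<Rightarrow> hf" where
  "happv f k = heval (case_nat f (\<lambda>_. k)) (happ (HVar 0) (HVar 1))"

lemma heval_happ: "heval e (happ f k) = happv (heval e f) (heval e k)"
  unfolding happv_def happ_def by (rule heval_HFun_cong) simp

text \<open>In the replaced atom the witness \<open>f\<close> is forced to be the value of
  \<open>G\<close> at \<open>t\<close>; the typing hypothesis is what puts that value into the bound
  \<open>K\<close> of the quantifier.\<close>

lemma fsat_fun_repl: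
  assumes "fso_form D \<phi>" "valid \<sigma>" "\<And>t. dir_term D t \<Longrightarrow> \<rho> n t |\<in>| elts (heval e K)"
  shows "fsat \<sigma> e \<rho> (fun_repl n K k \<phi>) \<longleftrightarrow> fsat \<sigma> e (\<rho>(n := \<lambda>t. happv (\<rho> n t) (heval e k))) \<phi>"
  using assms
proof (induction \<phi> arbitrary: \<sigma> e \<rho> n K k)
  case (FFun F t M)
  then have "\<rho> n (isubst \<sigma> t) |\<in>| elts (heval e K)" by (simp add: dir_term_isubst)
  then show ?case by (auto simp: heval_happ)
next
  case (FExI \<phi>)
  have "fsat (case_nat t \<sigma>) e \<rho> (fun_repl n K k \<phi>) \<longleftrightarrow>
      fsat (case_nat t \<sigma>) e (\<rho>(n := \<lambda>t. happv (\<rho> n t) (heval e k))) \<phi>" if "dir_term D t" for t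
    using FExI.prems that by (intro FExI.IH) (auto simp: dir_term_case_nat)
  then show ?case unfolding fun_repl.simps fsat.simps by blast
next
  case (FExH M \<phi>)
  have "fsat \<sigma> (case_nat v e) \<rho> (fun_repl n (hlift K) (hlift k) \<phi>) \<longleftrightarrow>
      fsat \<sigma> (case_nat v e) (\<rho>(n := \<lambda>t. happv (\<rho> n t) (heval (case_nat v e) (hlift k)))) \<phi>" for v
    using FExH.prems by (intro FExH.IH) auto
  then show ?case by (simp add: fun_upd_def)
next
  case (FExF M \<phi>)
  have "fsat \<sigma> e (case_nat f \<rho>) (fun_repl (Suc n) K k \<phi>) \<longleftrightarrow>
      fsat \<sigma> e ((case_nat f \<rho>)(Suc n := \<lambda>t. happv (case_nat f \<rho> (Suc n) t) (heval e k))) \<phi>" for f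
    using FExF.prems by (intro FExF.IH) auto
  moreover have "(case_nat f \<rho>)(Suc n := g) = case_nat f (\<rho>(n := g))" for f g
    by (rule ext) (auto split: nat.split)
  ultimately show ?case by (simp add: fun_upd_def)
qed auto

text \<open>An arbitrary choice need not have Predicates as fibres. Taking the suitable
  \<open>k\<close> that is least under \<open>to_nat\<close> does: the fibre over \<open>k\<close>
  is a Boolean combination of the finitely many Predicates \<open>A k'\<close>.\<close>

lemma adm_choice:
  assumes "finite K" "\<And>k. k \<in> K \<Longrightarrow> predicate (A k)" "\<And>t. dir_term D t \<Longrightarrow> \<exists>k\<in>K. A k t"
  shows "\<exists>f. adm f \<and> (\<forall>t. dir_term D t \<longrightarrow> f t \<in> K \<and> A (f t) t)"
proof -
  let ?Q = "\<lambda>k t. \<forall>k'\<in>{k' \<in> K. to_nat k' < to_nat k}. \<not> A k' t"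
  define f where "f t = (SOME k. k \<in> K \<and> A k t \<and> ?Q k t)" for t
  have f: "f t \<in> K \<and> A (f t) t \<and> ?Q (f t) t" if t: "dir_term D t" for t
  proof -
    obtain k where "k \<in> K \<and> A k t" "\<forall>k'. k' \<in> K \<and> A k' t \<longrightarrow> to_nat k \<le> to_nat k'"
      using ex_has_least_nat[of "\<lambda>k. k \<in> K \<and> A k t" _ to_nat] assms(3)[OF t] by blast
    then have "k \<in> K \<and> A k t \<and> ?Q k t" by fastforce
    then show ?thesis unfolding f_def by (rule someI)
  qed
  have f_eq: "f t = k \<longleftrightarrow> k \<in> K \<and> A k t \<and> ?Q k t" if "dir_term D t" for t k
  proof
    assume "k \<in> K \<and> A k t \<and> ?Q k t"
    with f[OF that] have "\<not> to_nat k < to_nat (f t)" "\<not> to_nat (f t) < to_nat k" by blast+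
    then have "to_nat (f t) = to_nat k" by linarith
    then show "f t = k" by simp
  qed (use f[OF that] in blast)
  have "adm f" unfolding adm_def
  proof
    fix k
    have "predicate (\<lambda>t. A k t \<and> ?Q k t)" if "k \<in> K"
      using that assms(1,2) by (intro predicate_and predicate_Ball predicate_not) auto
    then have "predicate (\<lambda>t. k \<in> K \<and> A k t \<and> ?Q k t)"
      using predicate_const[of False] by (cases "k \<in> K") auto
    then show "predicate (\<lambda>t. f t = k)"
      by (subst predicate_cong[OF f_eq])
  qed
  with f show ?thesis by blast
qed

text \<open>The fibre over a graph on \<open>K\<close> is a finite intersection of fibres of the
  \<open>F k\<close>; over any other set it is empty.\<close>

lemma adm_hgraph:
  assumes "\<And>k. k |\<in>| elts K \<Longrightarrow> adm (F k)"
  shows "adm (\<lambda>t. hgraph (\<lambda>k. F k t) K)"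
  unfolding adm_def
proof
  fix g
  show "predicate (\<lambda>t. hgraph (\<lambda>k. F k t) K = g)"
  proof (cases "\<exists>h. g = hgraph h K")
    case True
    then obtain h where "g = hgraph h K" by blast
    then have "(hgraph (\<lambda>k. F k t) K = g) \<longleftrightarrow> (\<forall>k\<in>fset (elts K). F k t = h k)" for t
      by (auto simp: hgraph_eq_iff)
    moreover have "predicate (\<lambda>t. \<forall>k\<in>fset (elts K). F k t = h k)"
      using assms by (intro predicate_Ball) (auto simp: adm_def)
    ultimately show ?thesis by simp
  next
    case False
    then have "(\<lambda>t. hgraph (\<lambda>k. F k t) K = g) = (\<lambda>t. False)" by blast
    then show ?thesis using predicate_const[of False] by simp
  qed
qed

lemma fsat_ax:
  assumes "fso_ax D \<phi>" "fso_form D \<phi>" "valid \<sigma>" "\<And>F. adm (\<rho> F)"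
  shows "fsat \<sigma> e \<rho> \<phi>"
  using assms(1,2)
proof cases
  case (eq_refl t)
  then show ?thesis using sat_ax[OF mso_ax.eq_refl, of t \<sigma>] assms by simp
next
  case (eq_subst t u \<chi>)
  with assms(2) have dir: "dir_term D t" "dir_term D u" by auto
  with eq_subst assms(2) have "fso_form D \<chi>" by simp
  \<comment> \<open>\<open>E\<close> need not be identity, so replacing equals in
    \<open>\<chi>\<close> is not immediate; it is inherited from the MSO axiom for the formula that
    represents \<open>\<chi>\<close>.\<close>
  then obtain \<psi> \<pi> where \<psi>: "mso_form D \<psi>" "\<And>\<sigma>. valid \<sigma> \<Longrightarrow> fsat \<sigma> e \<rho> \<chi> \<longleftrightarrow> sat \<sigma> \<pi> \<psi>"
    using fsat_mso[of \<chi> \<rho> e, OF _ assms(4)] by blast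
  have "sat \<sigma> \<pi> (MImp (MEq t u) (MImp (minstI t \<psi>) (minstI u \<psi>)))"
    using \<psi> dir assms(3) by (intro sat_ax mso_ax.eq_subst) auto
  with \<psi> dir assms(3) show ?thesis
    unfolding eq_subst by (simp add: valid_case_nat dir_term_isubst dir_term_case_nat)
next
  case (succ_root d t)
  then show ?thesis using sat_ax[OF mso_ax.succ_root, of d t \<sigma>] assms by simp
next
  case (succ_inj d t u)
  then show ?thesis using sat_ax[OF mso_ax.succ_inj, of d t u \<sigma>] assms by simp
next
  case (succ_distinct d d' t u)
  then show ?thesis using sat_ax[OF mso_ax.succ_distinct, of d d' t u \<sigma>] assms by simp
next
  case (less_irrefl t)
  then show ?thesis using sat_ax[OF mso_ax.less_irrefl, of t \<sigma>] assms by simp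
next
  case (less_trans t u v)
  then show ?thesis using sat_ax[OF mso_ax.less_trans, of t u v \<sigma>] assms by simp
next
  case (less_root t)
  then show ?thesis using sat_ax[OF mso_ax.less_root, of t \<sigma>] assms by simp
next
  case (less_succ t d u)
  then show ?thesis using sat_ax[OF mso_ax.less_succ, of t d u \<sigma>] assms by simp
next
  case (induction ds \<chi>)
  have "fso_form D \<chi>" using assms(2) unfolding induction by (simp add: fso_form_foldr)
  then have pred: "predicate (\<lambda>t. fsat (case_nat t \<sigma>) e \<rho> \<chi>)"
    using assms by (intro predicate_fsat)
  show ?thesis
    unfolding induction(1) fsat_abbrevs fsat_foldr
  proof (intro impI allI)
    fix t
    assume base: "fsat \<sigma> e \<rho> (finstI Root \<chi>)"
      and step: "\<forall>d\<in>set ds. \<forall>t. dir_term D t \<longrightarrow> fsat (case_nat t \<sigma>) e \<rho> \<chi> \<longrightarrow>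
        fsat (case_nat t \<sigma>) e \<rho> (fsubst (case_nat (Succ d (IVar 0)) (\<lambda>i. IVar (Suc i))) HVar id \<chi>)"
      and "dir_term D t"
    show "fsat (case_nat t \<sigma>) e \<rho> \<chi>"
      by (rule predicate_induct[OF pred _ _ \<open>dir_term D t\<close>]) (use base step induction(2) in auto)
  qed
next
  case (hf_constant \<kappa>s \<kappa> K)
  have "fsat \<sigma> e \<rho> (foldr (\<lambda>\<mu>. FOr (FHEq K (HConst \<mu>))) \<kappa>s FBot) \<longleftrightarrow> heval e K \<in> set \<kappa>s"
    by (induction \<kappa>s) auto
  with hf_constant show ?thesis by auto
next
  case (hf_skolem \<chi> \<psi> Ks)
  then show ?thesis using seval_skolem[of \<psi> Ks e] by (simp add: fsat_hf_formula)
next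
  case (choice_hf K M \<chi>)
  show ?thesis
    unfolding choice_hf fsat_abbrevs
  proof
    assume "\<forall>k. k |\<in>| elts (heval e K) \<longrightarrow> fsat \<sigma> (case_nat k e) \<rho> (FExH (hlift M) \<chi>)"
    then obtain g where g: "\<And>k. k |\<in>| elts (heval e K) \<Longrightarrow>
        g k |\<in>| elts (heval e M) \<and> fsat \<sigma> (case_nat (g k) (case_nat k e)) \<rho> \<chi>"
      by simp metis
    \<comment> \<open>Choice in the metatheory suffices, since the graph of any \<open>g\<close> on
      a finite set is hereditarily finite.\<close>
    let ?f = "hgraph g (heval e K)"
    have "happv ?f k = g k" if "k |\<in>| elts (heval e K)" for k
      using heval_happ_hgraph[of "case_nat ?f (\<lambda>_. k)" "HVar 0" g "heval e K" "HVar 1"] that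
      by (simp add: happv_def)
    with g show "fsat \<sigma> e \<rho> (FExH (hexp M K) (FAllH (hlift K) (fsubst IVar
           (case_nat (happ (HVar 1) (HVar 0)) (case_nat (HVar 0) (\<lambda>i. HVar (i + 2)))) id \<chi>)))"
      by (auto simp: hfun_hgraph heval_happ intro!: exI[of _ ?f])
  qed
next
  case (choice_fun K \<chi>)
  then have form: "fso_form D \<chi>" using assms(2) by simp
  show ?thesis
    unfolding choice_fun fsat_abbrevs
  proof
    assume *: "\<forall>t. dir_term D t \<longrightarrow> fsat (case_nat t \<sigma>) e \<rho> (FExH K \<chi>)"
    have "\<exists>f. adm f \<and> (\<forall>t. dir_term D t \<longrightarrow>
        f t \<in> fset (elts (heval e K)) \<and> fsat (case_nat t \<sigma>) (case_nat (f t) e) \<rho> \<chi>)"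
      by (rule adm_choice) (use * predicate_fsat[OF form assms(4,3)] in auto)
    then obtain f where f: "adm f"
      "\<And>t. dir_term D t \<Longrightarrow> f t \<in> fset (elts (heval e K)) \<and> fsat (case_nat t \<sigma>) (case_nat (f t) e) \<rho> \<chi>"
      by blast
    then show "fsat \<sigma> e \<rho> (FExF K (FAllI (FExH K (FAnd (FFun 0 (IVar 0) (HVar 0)) (fliftF \<chi>)))))"
      by (auto intro!: exI[of _ f])
  qed
next
  case (choice_iter K M \<chi>)
  then have form: "fso_form D \<chi>" using assms(2) by simp
  show ?thesis
    unfolding choice_iter fsat_abbrevs
  proof
    assume *: "\<forall>k. k |\<in>| elts (heval e K) \<longrightarrow> fsat \<sigma> (case_nat k e) \<rho> (FExF (hlift M) \<chi>)"
    then obtain F where F: "\<And>k. k |\<in>| elts (heval e K) \<Longrightarrow> adm (F k) \<and>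
        (\<forall>t. dir_term D t \<longrightarrow> F k t |\<in>| elts (heval e M)) \<and> fsat \<sigma> (case_nat k e) (case_nat (F k) \<rho>) \<chi>"
      by simp metis
    \<comment> \<open>The \<open>F k\<close> may be chosen arbitrarily: only finitely many enter,
      and \<open>adm_hgraph\<close> keeps their tuple admissible.\<close>
    define G where "G t = hgraph (\<lambda>k. F k t) (heval e K)" for t
    have "adm G" unfolding G_def using F by (intro adm_hgraph) auto
    moreover have G: "G t |\<in>| elts (heval e (hexp M K))" if "dir_term D t" for t
      using F that by (auto simp: G_def intro!: hfun_hgraph)
    moreover have "fsat \<sigma> (case_nat k e) (case_nat G \<rho>) (fun_repl 0 (hlift (hexp M K)) (HVar 0) \<chi>)"
      if k: "k |\<in>| elts (heval e K)" for k
    proof -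
      have "happv (G t) k = F k t" for t
        using heval_happ_hgraph[of "case_nat (G t) (\<lambda>_. k)" "HVar 0" "\<lambda>k. F k t" "heval e K" "HVar 1"] k
        by (simp add: happv_def G_def)
      moreover have "(case_nat G \<rho>)(0 := g) = case_nat g \<rho>" for g
        by (rule ext) (auto split: nat.split)
      ultimately show ?thesis
        using fsat_fun_repl[OF form assms(3), of "case_nat G \<rho>" 0 "case_nat k e" "hlift (hexp M K)" "HVar 0"] F[OF k] G
        by simp
    qed
    ultimately show "fsat \<sigma> e \<rho> (FExF (hexp M K) (FAllH K (fun_repl 0 (hlift (hexp M K)) (HVar 0) \<chi>)))"
      by auto
  qed
qed auto

lemma fsat_FTyped:
  "fsat \<sigma> e \<rho> (FTyped F K) \<longleftrightarrow> (\<forall>t. dir_term D t \<longrightarrow> \<rho> F t |\<in>| elts (heval e K))"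
  by (auto simp: FTyped_def)

theorem fso_sound:
  "fso_prf D \<Gamma> \<phi> \<Longrightarrow> valid \<sigma> \<Longrightarrow> (\<And>F. adm (\<rho> F)) \<Longrightarrow> (\<And>\<psi>. \<psi> \<in> set \<Gamma> \<Longrightarrow> fsat \<sigma> e \<rho> \<psi>) \<Longrightarrow>
    fsat \<sigma> e \<rho> \<phi>"
proof (induction arbitrary: \<sigma> e \<rho> rule: fso_prf.induct)
  case (ax \<phi> \<Gamma>)
  then show ?case by (intro fsat_ax)
next
  case (orE \<Gamma> \<phi> \<psi> \<chi>)
  from orE.IH(1)[OF orE.prems] show ?case
    using orE.IH(2,3)[of \<sigma> \<rho> e] orE.prems by auto
next
  case (notI \<phi> \<Gamma> \<psi>)
  then show ?case by (metis fsat.simps(6) set_ConsD)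
next
  case (ccontr \<phi> \<Gamma> \<psi>)
  then show ?case by (metis fsat.simps(6) set_ConsD)
next
  case (exI_I t \<Gamma> \<phi>)
  have "fsat \<sigma> e \<rho> (finstI t \<phi>)" using exI_I by blast
  moreover have "dir_term D (isubst \<sigma> t)" using exI_I by (simp add: dir_term_isubst)
  ultimately show ?case by auto
next
  case (exI_E \<Gamma> \<phi> \<psi>)
  from exI_E.IH(1)[OF exI_E.prems] obtain t where t: "dir_term D t" "fsat (case_nat t \<sigma>) e \<rho> \<phi>"
    by auto
  have "fsat (case_nat t \<sigma>) e \<rho> (fliftI \<psi>)"
    by (rule exI_E.IH(2)) (use t exI_E.prems in \<open>auto simp: dir_term_case_nat\<close>)
  then show ?case by simp
next
  case (exH_I \<Gamma> K M \<phi>)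
  have "fsat \<sigma> e \<rho> (finstH K \<phi>)" "fsat \<sigma> e \<rho> (FHIn K M)" using exH_I by blast+
  then show ?case by auto
next
  case (exH_E \<Gamma> M \<phi> \<psi>)
  from exH_E.IH(1)[OF exH_E.prems] obtain v where v: "v |\<in>| elts (heval e M)" "fsat \<sigma> (case_nat v e) \<rho> \<phi>"
    by auto
  have "fsat \<sigma> (case_nat v e) \<rho> (fliftH \<psi>)"
    by (rule exH_E.IH(2)) (use v exH_E.prems in auto)
  then show ?case by simp
next
  case (exF_I \<Gamma> F M \<phi>)
  have "fsat \<sigma> e \<rho> (FTyped F M)" "fsat \<sigma> e \<rho> (finstF F \<phi>)" using exF_I by blast+
  then show ?case using exF_I.prems(2)[of F] by (auto simp: fsat_FTyped case_nat_comp[of \<rho>])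
next
  case (exF_E \<Gamma> M \<phi> \<psi>)
  from exF_E.IH(1)[OF exF_E.prems] obtain f where f: "adm f"
    "\<forall>t. dir_term D t \<longrightarrow> f t |\<in>| elts (heval e M)" "fsat \<sigma> e (case_nat f \<rho>) \<phi>"
    by auto
  have "adm (case_nat f \<rho> F)" for F using f(1) exF_E.prems(2) by (cases F) auto
  then have "fsat \<sigma> e (case_nat f \<rho>) (fliftF \<psi>)"
    by (intro exF_E.IH(2)) (use f exF_E.prems in \<open>auto simp: fsat_FTyped\<close>)
  then show ?case by simp
qed auto

section \<open>Predicates as characteristic functions, and the translation in the model\<close>

definition charf :: "nat \<Rightarrow> iterm \<Rightarrow> hf" where
  "charf X t = (if P X t then hf_one else hf_zero)"

lemma hf_one_neq_zero [simp]: "hf_one \<noteq> hf_zero" "hf_zero \<noteq> hf_one"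
  by (auto simp: hf_one_def hf_zero_def)

lemma adm_charf: "adm (charf X)"
  unfolding adm_def
proof
  fix k
  have X: "predicate (P X)" unfolding predicate_def by blast
  consider "k = hf_one" | "k = hf_zero" | "k \<noteq> hf_one" "k \<noteq> hf_zero" by blast
  then show "predicate (\<lambda>t. charf X t = k)"
  proof cases
    case 1
    with X show ?thesis by (simp add: charf_def if_distrib[of "\<lambda>x. x = _"] cong: if_cong)
  next
    case 2
    with predicate_not[OF X] show ?thesis by (simp add: charf_def)
  next
    case 3
    then have "(\<lambda>t. charf X t = k) = (\<lambda>t. False)" by (auto simp: charf_def)
    with predicate_const[of False] show ?thesis by simp
  qed
qed

text \<open>The translation only sees the fibre over \<open>hf_one\<close>. For an admissible
  function this fibre is a Predicate, and a Predicate is the fibre of its characteristic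
  function.\<close>

lemma fsat_mso_to_fso:
  assumes "mso_form D \<phi>" "valid \<sigma>" "\<And>X t. dir_term D t \<Longrightarrow> P (\<pi> X) t \<longleftrightarrow> \<rho> X t = hf_one"
  shows "fsat \<sigma> e \<rho> (mso_to_fso \<phi>) \<longleftrightarrow> sat \<sigma> \<pi> \<phi>"
  using assms
proof (induction \<phi> arbitrary: \<sigma> \<pi> \<rho>)
  case (MPred X t)
  then show ?case by (simp add: dir_term_isubst)
next
  case (MOr \<phi> \<psi>)
  have "fsat \<sigma> e \<rho> (mso_to_fso \<phi>) \<longleftrightarrow> sat \<sigma> \<pi> \<phi>" "fsat \<sigma> e \<rho> (mso_to_fso \<psi>) \<longleftrightarrow> sat \<sigma> \<pi> \<psi>"
    by (rule MOr.IH; use MOr.prems in auto)+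
  then show ?case by simp
next
  case (MExI \<phi>)
  have "fsat (case_nat t \<sigma>) e \<rho> (mso_to_fso \<phi>) \<longleftrightarrow> sat (case_nat t \<sigma>) \<pi> \<phi>" if "dir_term D t" for t
    by (rule MExI.IH) (use MExI.prems that in \<open>auto simp: dir_term_case_nat\<close>)
  then show ?case by auto
next
  case (MExP \<phi>)
  have IH: "fsat \<sigma> e (case_nat f \<rho>) (mso_to_fso \<phi>) \<longleftrightarrow> sat \<sigma> (case_nat X \<pi>) \<phi>"
    if "\<And>t. dir_term D t \<Longrightarrow> P X t \<longleftrightarrow> f t = hf_one" for X f
    by (rule MExP.IH) (use MExP.prems that in \<open>auto split: nat.split\<close>)
  show ?case
  proof
    assume "fsat \<sigma> e \<rho> (mso_to_fso (MExP \<phi>))"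
    then obtain f where f: "adm f" "fsat \<sigma> e (case_nat f \<rho>) (mso_to_fso \<phi>)" by auto
    from f(1) obtain X where "\<And>t. dir_term D t \<Longrightarrow> P X t \<longleftrightarrow> f t = hf_one"
      unfolding adm_def predicate_def by blast
    with IH f(2) show "sat \<sigma> \<pi> (MExP \<phi>)" by auto
  next
    assume "sat \<sigma> \<pi> (MExP \<phi>)"
    then obtain X where "sat \<sigma> (case_nat X \<pi>) \<phi>" by auto
    then have "fsat \<sigma> e (case_nat (charf X) \<rho>) (mso_to_fso \<phi>)"
      by (subst IH) (auto simp: charf_def)
    moreover have "charf X t |\<in>| elts hf_two" for t by (simp add: charf_def hf_two_def)
    ultimately show "fsat \<sigma> e \<rho> (mso_to_fso (MExP \<phi>))" using adm_charf by auto
  qed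
qed auto

end

theorem fso_imp_mso:
  assumes "mso_form D \<phi>" "fso_prf D [] (mso_to_fso \<phi>)"
  shows "mso_prf D [] \<phi>"
proof (rule HOL.ccontr)
  assume "\<not> mso_prf D [] \<phi>"
  with assms(1) obtain P E L where "term_model D P E L" and neg: "\<not> term_structure.sat D P E L IVar id \<phi>"
    by (rule mso_completeness)
  then interpret term_model D P E L by simp
  \<comment> \<open>Each free Function variable denotes the characteristic function of the Predicate
    with the same index, in agreement with the assignment \<open>id\<close>.\<close>
  have "fsat IVar (\<lambda>_. hf_zero) charf (mso_to_fso \<phi>)"
    by (rule fso_sound[OF assms(2)]) (auto simp: adm_charf)
  then have "sat IVar id \<phi>"
    by (subst (asm) fsat_mso_to_fso[of _ _ id]) (auto simp: assms(1) charf_def)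
  with neg show False by simp
qed

section \<open>Natural deduction in FSO\<close>

lemma fso_prf_form: "fso_prf D \<Gamma> \<phi> \<Longrightarrow> fso_form D \<phi> \<and> (\<forall>\<psi> \<in> set \<Gamma>. fso_form D \<psi>)"
  by (induction rule: fso_prf.induct) (auto simp: FTyped_def)

lemma fso_prf_mono:
  "fso_prf D \<Gamma> \<phi> \<Longrightarrow> set \<Gamma> \<subseteq> set \<Delta> \<Longrightarrow> \<forall>\<psi> \<in> set \<Delta>. fso_form D \<psi> \<Longrightarrow> fso_prf D \<Delta> \<phi>"
proof (induction arbitrary: \<Delta> rule: fso_prf.induct)
  case (hyp \<phi> \<Gamma>)
  then show ?case by (auto intro: fso_prf.hyp)
next
  case (ax \<phi> \<Gamma>)
  then show ?case by (auto intro: fso_prf.ax)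
next
  case (orI1 \<Gamma> \<phi> \<psi>)
  then show ?case by (auto intro: fso_prf.orI1)
next
  case (orI2 \<Gamma> \<phi> \<psi>)
  then show ?case by (auto intro: fso_prf.orI2)
next
  case (orE \<Gamma> \<phi> \<psi> \<chi>)
  then have "fso_form D \<phi>" "fso_form D \<psi>" using fso_prf_form by fastforce+
  with orE.prems show ?case
    by (intro fso_prf.orE[OF orE.IH(1) orE.IH(2) orE.IH(3)]) auto
next
  case (notI \<phi> \<Gamma> \<psi>)
  then have "fso_form D \<phi>" using fso_prf_form by fastforce
  with notI.prems show ?case
    by (intro fso_prf.notI[OF notI.IH]) auto
next
  case (ccontr \<phi> \<Gamma> \<psi>)
  then have "fso_form D \<phi>" using fso_prf_form by fastforce
  with ccontr.prems show ?case
    by (intro fso_prf.ccontr[OF ccontr.IH]) auto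
next
  case (exI_I t \<Gamma> \<phi>)
  then show ?case by (auto intro: fso_prf.exI_I)
next
  case (exI_E \<Gamma> \<phi> \<psi>)
  then have "fso_form D \<phi>" using fso_prf_form by fastforce
  with exI_E.prems show ?case
    by (intro fso_prf.exI_E[OF exI_E.IH]) auto
next
  case (exH_I \<Gamma> K M \<phi>)
  then show ?case by (auto intro: fso_prf.exH_I)
next
  case (exH_E \<Gamma> M \<phi> \<psi>)
  then have "fso_form D \<phi>" "hf_term M" using fso_prf_form by fastforce+
  with exH_E.prems show ?case
    by (intro fso_prf.exH_E[OF exH_E.IH]) (auto simp: hf_term_hsubst)
next
  case (exF_I \<Gamma> F M \<phi>)
  then show ?case by (auto intro: fso_prf.exF_I)
next
  case (exF_E \<Gamma> M \<phi> \<psi>)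
  then have "fso_form D \<phi>" "hf_term M" using fso_prf_form by fastforce+
  with exF_E.prems show ?case
    by (intro fso_prf.exF_E[OF exF_E.IH]) (auto simp: FTyped_def hf_term_hsubst)
qed

lemma fso_prf_Cons: "fso_prf D \<Gamma> \<phi> \<Longrightarrow> fso_form D \<psi> \<Longrightarrow> fso_prf D (\<psi> # \<Gamma>) \<phi>"
  by (rule fso_prf_mono) (auto dest: fso_prf_form)

definition fso_ctxt :: "hf \<Rightarrow> fso list \<Rightarrow> bool" where
  "fso_ctxt D \<Gamma> \<longleftrightarrow> (\<forall>\<psi> \<in> set \<Gamma>. fso_form D \<psi>)"

lemma fso_ctxt_simps [simp]:
  "fso_ctxt D []"
  "fso_ctxt D (\<phi> # \<Gamma>) \<longleftrightarrow> fso_form D \<phi> \<and> fso_ctxt D \<Gamma>"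
  "fso_ctxt D (\<Gamma> @ \<Delta>) \<longleftrightarrow> fso_ctxt D \<Gamma> \<and> fso_ctxt D \<Delta>"
  "fso_ctxt D (map fliftI \<Gamma>) \<longleftrightarrow> fso_ctxt D \<Gamma>"
  "fso_ctxt D (map fliftH \<Gamma>) \<longleftrightarrow> fso_ctxt D \<Gamma>"
  "fso_ctxt D (map fliftF \<Gamma>) \<longleftrightarrow> fso_ctxt D \<Gamma>"
  by (auto simp: fso_ctxt_def)

lemma fso_hyp: "\<phi> \<in> set \<Gamma> \<Longrightarrow> fso_ctxt D \<Gamma> \<Longrightarrow> fso_prf D \<Gamma> \<phi>"
  by (auto simp: fso_ctxt_def intro: fso_prf.hyp)

lemma fso_axI: "fso_ax D \<phi> \<Longrightarrow> fso_form D \<phi> \<Longrightarrow> fso_ctxt D \<Gamma> \<Longrightarrow> fso_prf D \<Gamma> \<phi>"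
  by (auto simp: fso_ctxt_def intro: fso_prf.ax)

lemma fso_prf_ctxt: "fso_prf D \<Gamma> \<phi> \<Longrightarrow> fso_ctxt D \<Gamma>"
  by (auto simp: fso_ctxt_def dest: fso_prf_form)

lemma fso_prf_formD: "fso_prf D \<Gamma> \<phi> \<Longrightarrow> fso_form D \<phi>"
  by (auto dest: fso_prf_form)

lemma fso_explosion:
  assumes "fso_prf D \<Gamma> \<psi>" "fso_prf D \<Gamma> (FNot \<psi>)" "fso_form D \<chi>"
  shows "fso_prf D \<Gamma> \<chi>"
  using assms by (intro fso_prf.ccontr[of D \<chi> \<Gamma> \<psi>] fso_prf_Cons) simp_all

lemma fso_cases:
  assumes "fso_prf D (\<phi> # \<Gamma>) \<chi>" "fso_prf D (FNot \<phi> # \<Gamma>) \<chi>"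
  shows "fso_prf D \<Gamma> \<chi>"
proof (rule fso_prf.orE[OF _ assms])
  have f: "fso_form D \<phi>" "fso_ctxt D \<Gamma>" using fso_prf_ctxt[OF assms(1)] by simp_all
  let ?em = "FOr \<phi> (FNot \<phi>)"
  show "fso_prf D \<Gamma> ?em"
  proof (rule fso_prf.ccontr)
    show "fso_prf D (FNot ?em # \<Gamma>) ?em"
    proof (rule fso_prf.orI2[OF fso_prf.notI])
      show "fso_prf D (\<phi> # FNot ?em # \<Gamma>) ?em"
        using f by (intro fso_prf.orI1 fso_hyp) auto
      show "fso_prf D (\<phi> # FNot ?em # \<Gamma>) (FNot ?em)"
        using f by (intro fso_hyp) auto
    qed (use f in simp)
    show "fso_prf D (FNot ?em # \<Gamma>) (FNot ?em)"
      using f by (intro fso_hyp) auto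
  qed
qed

lemma fso_impE:
  assumes "fso_prf D \<Gamma> (FImp \<phi> \<psi>)" "fso_prf D \<Gamma> \<phi>"
  shows "fso_prf D \<Gamma> \<psi>"
proof (rule fso_prf.orE[OF assms(1)])
  have f: "fso_form D \<phi>" "fso_form D \<psi>" "fso_ctxt D \<Gamma>"
    using fso_prf_formD[OF assms(1)] fso_prf_ctxt[OF assms(1)] by simp_all
  show "fso_prf D (FNot \<phi> # \<Gamma>) \<psi>"
    by (rule fso_explosion[of D _ \<phi>]) (use f assms(2) in \<open>auto intro: fso_prf_Cons fso_hyp\<close>)
  show "fso_prf D (\<psi> # \<Gamma>) \<psi>"
    using f by (intro fso_hyp) auto
qed

lemma fso_andI:
  assumes "fso_prf D \<Gamma> \<phi>" "fso_prf D \<Gamma> \<psi>"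
  shows "fso_prf D \<Gamma> (FAnd \<phi> \<psi>)"
proof (rule fso_prf.notI)
  let ?H = "FOr (FNot \<phi>) (FNot \<psi>)"
  have f: "fso_form D \<phi>" "fso_form D \<psi>" "fso_ctxt D \<Gamma>"
    using assms by (auto dest: fso_prf_formD fso_prf_ctxt)
  then show "fso_prf D (?H # \<Gamma>) \<phi>" using assms by (intro fso_prf_Cons) auto
  show "fso_prf D (?H # \<Gamma>) (FNot \<phi>)"
  proof (rule fso_prf.orE)
    show "fso_prf D (?H # \<Gamma>) ?H" "fso_prf D (FNot \<phi> # ?H # \<Gamma>) (FNot \<phi>)"
      using f by (auto intro: fso_hyp)
    show "fso_prf D (FNot \<psi> # ?H # \<Gamma>) (FNot \<phi>)"
    proof (rule fso_explosion)
      show "fso_prf D (FNot \<psi> # ?H # \<Gamma>) \<psi>"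
        using f assms by (intro fso_prf_Cons) auto
      show "fso_prf D (FNot \<psi> # ?H # \<Gamma>) (FNot \<psi>)"
        using f by (intro fso_hyp) auto
    qed (use f in simp)
  qed
qed

lemma fso_andE1:
  assumes "fso_prf D \<Gamma> (FAnd \<phi> \<psi>)"
  shows "fso_prf D \<Gamma> \<phi>"
proof (rule fso_prf.ccontr)
  have f: "fso_form D \<phi>" "fso_form D \<psi>" "fso_ctxt D \<Gamma>"
    using assms by (auto dest: fso_prf_formD fso_prf_ctxt)
  then show "fso_prf D (FNot \<phi> # \<Gamma>) (FOr (FNot \<phi>) (FNot \<psi>))"
    by (intro fso_prf.orI1 fso_hyp) auto
  show "fso_prf D (FNot \<phi> # \<Gamma>) (FAnd \<phi> \<psi>)"
    using f assms by (intro fso_prf_Cons) auto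
qed

lemma fso_andE2:
  assumes "fso_prf D \<Gamma> (FAnd \<phi> \<psi>)"
  shows "fso_prf D \<Gamma> \<psi>"
proof (rule fso_prf.ccontr)
  have f: "fso_form D \<phi>" "fso_form D \<psi>" "fso_ctxt D \<Gamma>"
    using assms by (auto dest: fso_prf_formD fso_prf_ctxt)
  then show "fso_prf D (FNot \<psi> # \<Gamma>) (FOr (FNot \<phi>) (FNot \<psi>))"
    by (intro fso_prf.orI2 fso_hyp) auto
  show "fso_prf D (FNot \<psi> # \<Gamma>) (FAnd \<phi> \<psi>)"
    using f assms by (intro fso_prf_Cons) auto
qed

lemma fso_iffI_true:
  assumes "fso_prf D \<Gamma> \<phi>" "fso_prf D \<Gamma> \<psi>"
  shows "fso_prf D \<Gamma> (FIff \<phi> \<psi>)"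
  using assms fso_prf_formD by (intro fso_andI fso_prf.orI2) auto

lemma fso_iffI_false:
  assumes "fso_prf D \<Gamma> (FNot \<phi>)" "fso_prf D \<Gamma> (FNot \<psi>)"
  shows "fso_prf D \<Gamma> (FIff \<phi> \<psi>)"
  using assms fso_prf_formD by (intro fso_andI fso_prf.orI1) fastforce+

lemma fso_allI:
  assumes "fso_prf D (map fliftI \<Gamma>) \<phi>"
  shows "fso_prf D \<Gamma> (FAllI \<phi>)"
proof (rule fso_prf.notI)
  let ?H = "FExI (FNot \<phi>)"
  have f: "fso_form D \<phi>" "fso_ctxt D \<Gamma>"
    using assms by (auto dest: fso_prf_formD fso_prf_ctxt)
  \<comment> \<open>\<open>exI_E\<close> exports only formulas without the eigenvariable. Everything
    is derivable from \<open>?H\<close>, so a closed contradictory pair can be picked at the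
    end.\<close>
  have "fso_prf D (?H # \<Gamma>) \<chi>" if \<chi>: "fso_form D \<chi>" for \<chi>
  proof (rule fso_prf.exI_E)
    show "fso_prf D (?H # \<Gamma>) ?H" using f by (intro fso_hyp) auto
    have "fso_prf D (FNot \<phi> # map fliftI (?H # \<Gamma>)) \<phi>"
      by (rule fso_prf_mono[OF assms]) (use f in \<open>auto simp: fso_ctxt_def fso_form_fsubst dir_term_iup\<close>)
    moreover have "fso_prf D (FNot \<phi> # map fliftI (?H # \<Gamma>)) (FNot \<phi>)"
      using f fso_prf_ctxt[OF calculation] by (intro fso_hyp) auto
    ultimately show "fso_prf D (FNot \<phi> # map fliftI (?H # \<Gamma>)) (fliftI \<chi>)"
      by (rule fso_explosion) (use \<chi> in simp)
  qed
  then show "fso_prf D (?H # \<Gamma>) (FEq Root Root)" "fso_prf D (?H # \<Gamma>) (FNot (FEq Root Root))"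
    by auto
qed

lemma fso_allE:
  assumes "fso_prf D \<Gamma> (FAllI \<phi>)" "dir_term D t"
  shows "fso_prf D \<Gamma> (finstI t \<phi>)"
proof (rule fso_prf.ccontr)
  have f: "fso_form D \<phi>" "fso_ctxt D \<Gamma>"
    using assms(1) by (auto dest: fso_prf_formD fso_prf_ctxt)
  show "fso_prf D (FNot (finstI t \<phi>) # \<Gamma>) (FExI (FNot \<phi>))"
    by (rule fso_prf.exI_I[OF assms(2)]) (use f assms(2) in \<open>auto intro: fso_hyp\<close>)
  show "fso_prf D (FNot (finstI t \<phi>) # \<Gamma>) (FAllI \<phi>)"
    using f assms by (intro fso_prf_Cons) auto
qed

lemma fso_form_FTyped [simp]: "fso_form D (FTyped F K) \<longleftrightarrow> hf_term K"
  by (simp add: FTyped_def)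

lemma fsubst_FTyped [simp]: "fsubst \<sigma> HVar \<rho> (FTyped F (HConst \<kappa>)) = FTyped (\<rho> F) (HConst \<kappa>)"
  by (simp add: FTyped_def hup_def)

text \<open>Needed for the translated induction axiom, where \<open>MAllP\<close> has become a
  negated existential over Functions.\<close>

lemma fso_allF:
  assumes "fso_prf D (FTyped 0 (HConst \<kappa>) # map fliftF \<Gamma>) \<phi>"
  shows "fso_prf D \<Gamma> (FNot (FExF (HConst \<kappa>) (FNot \<phi>)))"
proof (rule fso_prf.notI)
  let ?H = "FExF (HConst \<kappa>) (FNot \<phi>)"
  have f: "fso_form D \<phi>" "fso_ctxt D \<Gamma>"
    using assms by (auto dest: fso_prf_formD fso_prf_ctxt)
  have "fso_prf D (?H # \<Gamma>) \<chi>" if \<chi>: "fso_form D \<chi>" for \<chi>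
  proof (rule fso_prf.exF_E)
    let ?\<Delta> = "FTyped 0 (HConst \<kappa>) # FNot \<phi> # map fliftF (?H # \<Gamma>)"
    show "fso_prf D (?H # \<Gamma>) ?H" using f by (intro fso_hyp) auto
    have "fso_prf D ?\<Delta> \<phi>"
      by (rule fso_prf_mono[OF assms]) (use f in \<open>auto simp: fso_ctxt_def\<close>)
    moreover have "fso_prf D ?\<Delta> (FNot \<phi>)"
      using f fso_prf_ctxt[OF calculation] by (intro fso_hyp) auto
    ultimately show "fso_prf D ?\<Delta> (fliftF \<chi>)"
      by (rule fso_explosion) (use \<chi> in simp)
  qed
  then show "fso_prf D (?H # \<Gamma>) (FEq Root Root)" "fso_prf D (?H # \<Gamma>) (FNot (FEq Root Root))"
    by auto
qed

subsection \<open>The sets 0, 1 and 2\<close>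

lemma fso_hf_refl: "fso_ctxt D \<Gamma> \<Longrightarrow> hf_term K \<Longrightarrow> fso_prf D \<Gamma> (FHEq K K)"
  by (rule fso_axI) (auto intro: fso_ax.hf_eq_refl)

lemma fso_hf_subst:
  assumes "fso_prf D \<Gamma> (FHEq K M)" "fso_prf D \<Gamma> (finstH K \<phi>)"
  shows "fso_prf D \<Gamma> (finstH M \<phi>)"
proof -
  have f: "hf_term K" "hf_term M" "fso_ctxt D \<Gamma>"
    using assms(1) by (auto dest: fso_prf_formD fso_prf_ctxt)
  with assms(2) have "fso_form D \<phi>" using fso_prf_formD[OF assms(2)] by simp
  with f have "fso_prf D \<Gamma> (FImp (FHEq K M) (FImp (finstH K \<phi>) (finstH M \<phi>)))"
    by (intro fso_axI fso_ax.hf_eq_subst) auto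
  with assms show ?thesis by (blast intro: fso_impE)
qed

abbreviation h0 :: hterm where "h0 \<equiv> HConst hf_zero"
abbreviation h1 :: hterm where "h1 \<equiv> HConst hf_one"
abbreviation h2 :: hterm where "h2 \<equiv> HConst hf_two"

lemma fso_zero_in_one: "fso_ctxt D \<Gamma> \<Longrightarrow> fso_prf D \<Gamma> (FHIn h0 h1)"
proof -
  assume \<Gamma>: "fso_ctxt D \<Gamma>"
  have "fso_prf D \<Gamma> (FIff (FHIn h0 h1) (foldr (\<lambda>\<mu>. FOr (FHEq h0 (HConst \<mu>))) [hf_zero] FBot))"
    using \<Gamma> by (intro fso_axI fso_ax.hf_constant) (auto simp: hf_one_def)
  from fso_andE2[OF this] show ?thesis
    using \<Gamma> by (elim fso_impE) (auto intro!: fso_prf.orI1 fso_hf_refl)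
qed

lemma fso_in_two: "fso_ctxt D \<Gamma> \<Longrightarrow> fso_prf D \<Gamma> (FHIn h0 h2)" "fso_ctxt D \<Gamma> \<Longrightarrow> fso_prf D \<Gamma> (FHIn h1 h2)"
proof -
  assume \<Gamma>: "fso_ctxt D \<Gamma>"
  have "fso_prf D \<Gamma> (FIff (FHIn K h2) (foldr (\<lambda>\<mu>. FOr (FHEq K (HConst \<mu>))) [hf_zero, hf_one] FBot))"
    if "hf_term K" for K
    using \<Gamma> that by (intro fso_axI fso_ax.hf_constant) (auto simp: hf_two_def)
  note * = fso_andE2[OF this]
  show "fso_prf D \<Gamma> (FHIn h0 h2)"
    by (rule fso_impE[OF *]) (auto intro!: fso_prf.orI1 fso_hf_refl \<Gamma>)
  show "fso_prf D \<Gamma> (FHIn h1 h2)"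
    by (rule fso_impE[OF *]) (auto intro!: fso_prf.orI2[OF fso_prf.orI1] fso_hf_refl \<Gamma>)
qed

lemma fso_one_neq_zero: "fso_ctxt D \<Gamma> \<Longrightarrow> fso_prf D \<Gamma> (FNot (FHEq h1 h0))"
proof (rule fso_prf.notI)
  assume \<Gamma>: "fso_ctxt D \<Gamma>"
  let ?\<Gamma> = "FHEq h1 h0 # \<Gamma>"
  have \<Gamma>': "fso_ctxt D ?\<Gamma>" using \<Gamma> by simp
  show "fso_prf D ?\<Gamma> (FHEq h0 h0)" using \<Gamma>' by (intro fso_hf_refl) auto
  have "fso_prf D ?\<Gamma> (FIff (FHIn h0 h0) (foldr (\<lambda>\<mu>. FOr (FHEq h0 (HConst \<mu>))) [] FBot))"
    using \<Gamma>' by (intro fso_axI fso_ax.hf_constant) (auto simp: hf_zero_def)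
  from fso_andE1[OF this] have "fso_prf D ?\<Gamma> (FImp (FHIn h0 h0) FBot)"
    by simp
  \<comment> \<open>Replacing \<open>1\<close> by \<open>0\<close> in \<open>0 \<in> 1\<close>
    yields \<open>0 \<in> 0\<close>, against the empty enumeration of
    \<open>hf_zero\<close>.\<close>
  moreover have "fso_prf D ?\<Gamma> (finstH h0 (FHIn h0 (HVar 0)))"
    by (rule fso_hf_subst[of D _ h1]) (use \<Gamma>' in \<open>auto intro: fso_hyp fso_zero_in_one\<close>)
  ultimately show "fso_prf D ?\<Gamma> FBot"
    by (auto intro: fso_impE)
qed

section \<open>The translation preserves provability\<close>

lemma fsubst_mso_to_fso [simp]: "fsubst \<sigma> \<tau> \<rho> (mso_to_fso \<phi>) = mso_to_fso (msubst \<sigma> \<rho> \<phi>)"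
  by (induction \<phi> arbitrary: \<sigma> \<rho>) auto

lemma fso_form_mso_to_fso [simp]: "fso_form D (mso_to_fso \<phi>) \<longleftrightarrow> mso_form D \<phi>"
  by (induction \<phi>) auto

lemma fso_comprehension:
  assumes \<Gamma>: "fso_ctxt D \<Gamma>" and \<phi>: "mso_form D \<phi>"
  shows "fso_prf D \<Gamma> (mso_to_fso (MExP (MAllI (MIff (MPred 0 (IVar 0)) (mliftP \<phi>)))))"
proof -
  \<comment> \<open>The graph of the characteristic function of \<open>\<psi>\<close>, with HF-index
    \<open>0\<close> as its value. It is needed for \<open>\<phi>\<close> in the premise of choice
    and for \<open>mliftP \<phi>\<close> under the new Function binder.\<close>
  let ?\<chi> = "\<lambda>\<psi>. FOr (FAnd (FHEq (HVar 0) h1) (mso_to_fso \<psi>)) (FAnd (FHEq (HVar 0) h0) (FNot (mso_to_fso \<psi>)))"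
  let ?graph = "FFun 0 (IVar 0) (HVar 0)"
  let ?body = "FExH h2 (FAnd ?graph (?\<chi> (mliftP \<phi>)))"
  let ?goal = "MIff (MPred 0 (IVar 0)) (mliftP \<phi>)"
  \<comment> \<open>Totality of the graph, by excluded middle on \<open>\<phi>\<close>.\<close>
  have "fso_prf D \<Gamma> (FAllI (FExH h2 (?\<chi> \<phi>)))"
  proof (rule fso_allI, rule fso_cases[of D "mso_to_fso \<phi>"])
    let ?\<Gamma> = "mso_to_fso \<phi> # map fliftI \<Gamma>"
    have \<Gamma>': "fso_ctxt D ?\<Gamma>" using \<Gamma> \<phi> by simp
    have "fso_prf D ?\<Gamma> (finstH h1 (?\<chi> \<phi>))"
      using \<Gamma>' \<phi> by (simp, intro fso_prf.orI1 fso_andI fso_hf_refl fso_hyp) auto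
    with \<Gamma>' show "fso_prf D ?\<Gamma> (FExH h2 (?\<chi> \<phi>))"
      by (intro fso_prf.exH_I[OF fso_in_two(2)])
  next
    let ?\<Gamma> = "FNot (mso_to_fso \<phi>) # map fliftI \<Gamma>"
    have \<Gamma>': "fso_ctxt D ?\<Gamma>" using \<Gamma> \<phi> by simp
    have "fso_prf D ?\<Gamma> (finstH h0 (?\<chi> \<phi>))"
      using \<Gamma>' \<phi> by (simp, intro fso_prf.orI2 fso_andI fso_hf_refl fso_hyp) auto
    with \<Gamma>' show "fso_prf D ?\<Gamma> (FExH h2 (?\<chi> \<phi>))"
      by (intro fso_prf.exH_I[OF fso_in_two(1)])
  qed
  moreover have "fso_prf D \<Gamma> (FImp (FAllI (FExH h2 (?\<chi> \<phi>))) (FExF h2 (FAllI ?body)))"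
    using fso_ax.choice_fun[of D h2 "?\<chi> \<phi>"] \<phi> \<Gamma> by (intro fso_axI) simp_all
  ultimately have "fso_prf D \<Gamma> (FExF h2 (FAllI ?body))"
    by (blast intro: fso_impE)
  then show ?thesis
  proof (rule fso_prf.exF_E)
    let ?\<Delta> = "FTyped 0 h2 # FAllI ?body # map fliftF \<Gamma>"
    have \<Delta>: "fso_ctxt D ?\<Delta>" using \<Gamma> \<phi> by simp
    have "fso_prf D (map fliftI ?\<Delta>) (mso_to_fso ?goal)"
    proof (rule fso_prf.exH_E)
      have \<Delta>': "fso_ctxt D (map fliftI ?\<Delta>)"
        using \<Delta> by (simp only: fso_ctxt_simps)
      have "fso_prf D (map fliftI ?\<Delta>) (fliftI (FAllI ?body))"
        by (rule fso_hyp[OF _ \<Delta>']) simp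
      \<comment> \<open>\<open>IVar 0\<close> is the generic Individual introduced by the goal;
        instantiating the lifted hypothesis at it gives back \<open>?body\<close>.\<close>
      then have "fso_prf D (map fliftI ?\<Delta>) (finstI (IVar 0) (fsubst (iup (\<lambda>i. IVar (Suc i))) HVar id ?body))"
        by (intro fso_allE) simp_all
      moreover have "case_nat (IVar 0) (\<lambda>i. IVar (Suc i)) = IVar"
        by (rule ext) (simp split: nat.split)
      then have "finstI (IVar 0) (fsubst (iup (\<lambda>i. IVar (Suc i))) HVar id ?body) = ?body"
        by simp
      ultimately show "fso_prf D (map fliftI ?\<Delta>) ?body"
        by (simp only:)
      let ?\<Theta> = "FHIn (HVar 0) (hlift h2) # FAnd ?graph (?\<chi> (mliftP \<phi>)) # map fliftH (map fliftI ?\<Delta>)"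
      have \<Theta>: "fso_ctxt D ?\<Theta>"
        using \<Delta> \<phi> by (simp only: fso_ctxt_simps) simp
      have conj: "fso_prf D ?\<Theta> (FAnd ?graph (?\<chi> (mliftP \<phi>)))"
        using \<Theta> by (intro fso_hyp) auto
      note graph = fso_andE1[OF conj]
      show "fso_prf D ?\<Theta> (fliftH (mso_to_fso ?goal))"
      proof (rule fso_prf.orE[OF fso_andE2[OF conj]])
        let ?c = "FAnd (FHEq (HVar 0) h1) (mso_to_fso (mliftP \<phi>))"
        have c: "fso_prf D (?c # ?\<Theta>) ?c" using \<Theta> \<phi> by (intro fso_hyp) auto
        have "fso_prf D (?c # ?\<Theta>) (finstH h1 ?graph)"
          by (rule fso_hf_subst[OF fso_andE1[OF c]]) (use graph \<phi> in \<open>auto intro: fso_prf_Cons\<close>)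
        then show "fso_prf D (?c # ?\<Theta>) (fliftH (mso_to_fso ?goal))"
          using fso_iffI_true[OF _ fso_andE2[OF c]] by simp
      next
        let ?c = "FAnd (FHEq (HVar 0) h0) (FNot (mso_to_fso (mliftP \<phi>)))"
        let ?A = "FFun 0 (IVar 0) h1"
        have c: "fso_prf D (?c # ?\<Theta>) ?c" using \<Theta> \<phi> by (intro fso_hyp) auto
        \<comment> \<open>The value \<open>HVar 0\<close> is \<open>0\<close> by \<open>?c\<close>;
          if \<open>?A\<close> held as well, functionality would make it \<open>1\<close>.\<close>
        have "fso_prf D (?c # ?\<Theta>) (FNot ?A)"
        proof (rule fso_prf.notI)
          let ?\<Xi> = "?A # ?c # ?\<Theta>"
          have \<Xi>: "fso_ctxt D ?\<Xi>" using \<Theta> \<phi> by simp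
          have "fso_prf D ?\<Xi> (FImp ?graph (FImp ?A (FHEq (HVar 0) h1)))"
            using \<Xi> by (intro fso_axI fso_ax.fun_eq) auto
          moreover have "fso_prf D ?\<Xi> ?graph"
            by (rule fso_prf_mono[OF graph]) (use \<Xi> in \<open>auto simp: fso_ctxt_def\<close>)
          moreover have "fso_prf D ?\<Xi> ?A" using \<Xi> by (intro fso_hyp) auto
          ultimately have eq1: "fso_prf D ?\<Xi> (FHEq (HVar 0) h1)"
            by (blast intro: fso_impE)
          have "fso_prf D ?\<Xi> (FHEq (HVar 0) h0)"
            by (rule fso_prf_Cons[OF fso_andE1[OF c]]) simp
          then have "fso_prf D ?\<Xi> (finstH h1 (FHEq (HVar 0) h0))"
            by (intro fso_hf_subst[OF eq1]) simp
          then show "fso_prf D ?\<Xi> (FHEq h1 h0)" by simp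
          show "fso_prf D ?\<Xi> (FNot (FHEq h1 h0))" using \<Xi> by (rule fso_one_neq_zero)
        qed
        then show "fso_prf D (?c # ?\<Theta>) (fliftH (mso_to_fso ?goal))"
          using fso_iffI_false[OF _ fso_andE2[OF c]] by simp
      qed
    qed
    then have "fso_prf D ?\<Delta> (mso_to_fso (MAllI ?goal))"
      using fso_allI by simp
    moreover have "fso_prf D ?\<Delta> (FTyped 0 h2)"
      using \<Delta> by (intro fso_hyp) auto
    ultimately show "fso_prf D ?\<Delta> (fliftF (mso_to_fso (MExP (MAllI ?goal))))"
      using fso_prf.exF_I[of D ?\<Delta> 0 h2 "mso_to_fso (msubst IVar (rup Suc) (MAllI ?goal))"] by simp
  qed
qed

lemma mso_to_fso_foldr:
  "mso_to_fso (foldr (\<lambda>d. MImp (A d)) ds \<phi>) = foldr (\<lambda>d. FImp (mso_to_fso (A d))) ds (mso_to_fso \<phi>)"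
  by (induction ds) auto

lemma fso_ctxt_mso_to_fso [simp]: "fso_ctxt D (map mso_to_fso \<Gamma>) \<longleftrightarrow> (\<forall>\<psi> \<in> set \<Gamma>. mso_form D \<psi>)"
  by (simp add: fso_ctxt_def)

text \<open>Two axioms are not sent to FSO axioms: comprehension, which comes from choice, and
  induction, which quantifies over a Predicate where FSO has a scheme. The scheme is taken at
  \<open>F(x) = 1\<close> and generalised over \<open>F\<close>.\<close>

lemma fso_prf_mso_ax:
  assumes "mso_ax D \<phi>" "mso_form D \<phi>" and \<Gamma>: "fso_ctxt D \<Gamma>"
  shows "fso_prf D \<Gamma> (mso_to_fso \<phi>)"
  using assms(1)
proof cases
  case (comprehension \<psi>)
  with assms(2) show ?thesis by (simp only: fso_comprehension[OF \<Gamma>] mso_form.simps mso_form_lift_inst)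
next
  case (induction ds)
  have "fso_prf D (FTyped 0 h2 # map fliftF \<Gamma>)
      (mso_to_fso (MImp (MPred 0 Root)
       (foldr (\<lambda>d. MImp (MAllI (MImp (MPred 0 (IVar 0)) (MPred 0 (Succ d (IVar 0)))))) ds
         (MAllI (MPred 0 (IVar 0))))))" (is "fso_prf D _ ?\<psi>")
  proof (rule fso_axI)
    show "fso_ax D ?\<psi>"
      using fso_ax.induction[OF induction(2), of "FFun 0 (IVar 0) h1"] by (simp add: mso_to_fso_foldr)
    show "fso_form D ?\<psi>" using assms(2) unfolding induction(1) by simp
  qed (use \<Gamma> in simp)
  from fso_allF[OF this] show ?thesis unfolding induction(1) by simp
next
  case (eq_subst t u \<psi>)
  have "fso_ax D (mso_to_fso \<phi>)"
    using fso_ax.eq_subst[of D t u "mso_to_fso \<psi>"] eq_subst by simp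
  with assms(2) \<Gamma> show ?thesis by (intro fso_axI) auto
qed (use assms in \<open>auto intro!: fso_axI fso_ax.intros\<close>)

section \<open>Derivations under typing assumptions, and their discharge\<close>

definition typings :: "nat \<Rightarrow> fso list" where
  "typings n = map (\<lambda>F. FTyped F h2) [0..<n]"

text \<open>Matches the context of \<open>exF_E\<close>: the bound Function takes index
  \<open>0\<close> and the earlier typings are lifted.\<close>

lemma typings_Suc: "typings (Suc n) = FTyped 0 h2 # map fliftF (typings n)"
  unfolding typings_def by (simp add: upt_conv_Cons map_Suc_upt[symmetric] del: upt_Suc)

lemma fso_ctxt_typings [simp]: "fso_ctxt D (typings n)"
  by (auto simp: typings_def fso_ctxt_def)

text \<open>The number of typings depends on the whole derivation, not on its end formula. Requiring
  all sufficiently large \<open>n\<close> lets rules with several premises combine their thresholds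
  by \<open>max\<close>.\<close>

lemma fso_prf_translation:
  "mso_prf D \<Gamma> \<phi> \<Longrightarrow> \<exists>m. \<forall>n\<ge>m. fso_prf D (typings n @ map mso_to_fso \<Gamma>) (mso_to_fso \<phi>)"
proof (induction rule: mso_prf.induct)
  case (hyp \<phi> \<Gamma>)
  then show ?case by (intro exI[of _ 0] allI impI fso_hyp) auto
next
  case (ax \<phi> \<Gamma>)
  then show ?case by (intro exI[of _ 0] allI impI fso_prf_mso_ax) auto
next
  case (orI1 \<Gamma> \<phi> \<psi>)
  then obtain m where "\<forall>n\<ge>m. fso_prf D (typings n @ map mso_to_fso \<Gamma>) (mso_to_fso \<phi>)" by blast
  with orI1.hyps show ?case by (intro exI[of _ m]) (simp add: fso_prf.orI1)
next
  case (orI2 \<Gamma> \<phi> \<psi>)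
  then obtain m where "\<forall>n\<ge>m. fso_prf D (typings n @ map mso_to_fso \<Gamma>) (mso_to_fso \<phi>)" by blast
  with orI2.hyps show ?case by (intro exI[of _ m]) (simp add: fso_prf.orI2)
next
  case (orE \<Gamma> \<phi> \<psi> \<chi>)
  then obtain m1 m2 m3 where
    1: "\<And>n. n \<ge> m1 \<Longrightarrow> fso_prf D (typings n @ map mso_to_fso \<Gamma>) (mso_to_fso (MOr \<phi> \<psi>))" and
    2: "\<And>n. n \<ge> m2 \<Longrightarrow> fso_prf D (typings n @ map mso_to_fso (\<phi> # \<Gamma>)) (mso_to_fso \<chi>)" and
    3: "\<And>n. n \<ge> m3 \<Longrightarrow> fso_prf D (typings n @ map mso_to_fso (\<psi> # \<Gamma>)) (mso_to_fso \<chi>)"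
    by blast
  show ?case
  proof (intro exI[of _ "max m1 (max m2 m3)"] allI impI)
    fix n assume n: "max m1 (max m2 m3) \<le> n"
    let ?\<Gamma> = "typings n @ map mso_to_fso \<Gamma>"
    have "fso_prf D (mso_to_fso \<phi> # ?\<Gamma>) (mso_to_fso \<chi>)"
      by (rule fso_prf_mono[OF 2[of n]]) (use n fso_prf_ctxt[OF 2[of n]] in \<open>auto simp: fso_ctxt_def\<close>)
    moreover have "fso_prf D (mso_to_fso \<psi> # ?\<Gamma>) (mso_to_fso \<chi>)"
      by (rule fso_prf_mono[OF 3[of n]]) (use n fso_prf_ctxt[OF 3[of n]] in \<open>auto simp: fso_ctxt_def\<close>)
    ultimately show "fso_prf D ?\<Gamma> (mso_to_fso \<chi>)"
      using 1[of n] n by (auto intro: fso_prf.orE)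
  qed
next
  case (notI \<phi> \<Gamma> \<psi>)
  then obtain m1 m2 where
    1: "\<And>n. n \<ge> m1 \<Longrightarrow> fso_prf D (typings n @ map mso_to_fso (\<phi> # \<Gamma>)) (mso_to_fso \<psi>)" and
    2: "\<And>n. n \<ge> m2 \<Longrightarrow> fso_prf D (typings n @ map mso_to_fso (\<phi> # \<Gamma>)) (mso_to_fso (MNot \<psi>))"
    by blast
  show ?case
  proof (intro exI[of _ "max m1 m2"] allI impI)
    fix n assume n: "max m1 m2 \<le> n"
    let ?\<Gamma> = "mso_to_fso \<phi> # typings n @ map mso_to_fso \<Gamma>"
    have "fso_prf D ?\<Gamma> (mso_to_fso \<psi>)"
      by (rule fso_prf_mono[OF 1[of n]]) (use n fso_prf_ctxt[OF 1[of n]] in \<open>auto simp: fso_ctxt_def\<close>)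
    moreover have "fso_prf D ?\<Gamma> (mso_to_fso (MNot \<psi>))"
      by (rule fso_prf_mono[OF 2[of n]]) (use n fso_prf_ctxt[OF 2[of n]] in \<open>auto simp: fso_ctxt_def\<close>)
    ultimately show "fso_prf D (typings n @ map mso_to_fso \<Gamma>) (mso_to_fso (MNot \<phi>))"
      by (auto intro: fso_prf.notI)
  qed
next
  case (ccontr \<phi> \<Gamma> \<psi>)
  then obtain m1 m2 where
    1: "\<And>n. n \<ge> m1 \<Longrightarrow> fso_prf D (typings n @ map mso_to_fso (MNot \<phi> # \<Gamma>)) (mso_to_fso \<psi>)" and
    2: "\<And>n. n \<ge> m2 \<Longrightarrow> fso_prf D (typings n @ map mso_to_fso (MNot \<phi> # \<Gamma>)) (mso_to_fso (MNot \<psi>))"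
    by blast
  show ?case
  proof (intro exI[of _ "max m1 m2"] allI impI)
    fix n assume n: "max m1 m2 \<le> n"
    let ?\<Gamma> = "FNot (mso_to_fso \<phi>) # typings n @ map mso_to_fso \<Gamma>"
    have "fso_prf D ?\<Gamma> (mso_to_fso \<psi>)"
      by (rule fso_prf_mono[OF 1[of n]]) (use n fso_prf_ctxt[OF 1[of n]] in \<open>auto simp: fso_ctxt_def\<close>)
    moreover have "fso_prf D ?\<Gamma> (mso_to_fso (MNot \<psi>))"
      by (rule fso_prf_mono[OF 2[of n]]) (use n fso_prf_ctxt[OF 2[of n]] in \<open>auto simp: fso_ctxt_def\<close>)
    ultimately show "fso_prf D (typings n @ map mso_to_fso \<Gamma>) (mso_to_fso \<phi>)"
      by (auto intro: fso_prf.ccontr)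
  qed
next
  case (exI_I t \<Gamma> \<phi>)
  then obtain m where m: "\<And>n. n \<ge> m \<Longrightarrow> fso_prf D (typings n @ map mso_to_fso \<Gamma>) (mso_to_fso (minstI t \<phi>))"
    by blast
  show ?case
  proof (intro exI[of _ m] allI impI)
    fix n assume "m \<le> n"
    from m[OF this] show "fso_prf D (typings n @ map mso_to_fso \<Gamma>) (mso_to_fso (MExI \<phi>))"
      using exI_I.hyps(1) fso_prf.exI_I[of D t _ "mso_to_fso \<phi>"] by simp
  qed
next
  case (exI_E \<Gamma> \<phi> \<psi>)
  then obtain m1 m2 where
    1: "\<And>n. n \<ge> m1 \<Longrightarrow> fso_prf D (typings n @ map mso_to_fso \<Gamma>) (mso_to_fso (MExI \<phi>))" and
    2: "\<And>n. n \<ge> m2 \<Longrightarrow> fso_prf D (typings n @ map mso_to_fso (\<phi> # map mliftI \<Gamma>)) (mso_to_fso (mliftI \<psi>))"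
    by blast
  show ?case
  proof (intro exI[of _ "max m1 m2"] allI impI)
    fix n assume n: "max m1 m2 \<le> n"
    have "map fliftI (typings n) = typings n" by (simp add: typings_def)
    then have "fso_prf D (mso_to_fso \<phi> # map fliftI (typings n @ map mso_to_fso \<Gamma>)) (fliftI (mso_to_fso \<psi>))"
      unfolding map_append fsubst_mso_to_fso
      by (intro fso_prf_mono[OF 2[of n]]) (use n fso_prf_ctxt[OF 2[of n]] in \<open>auto simp: fso_ctxt_def\<close>)
    moreover have "fso_prf D (typings n @ map mso_to_fso \<Gamma>) (FExI (mso_to_fso \<phi>))"
      using 1[of n] n by simp
    ultimately show "fso_prf D (typings n @ map mso_to_fso \<Gamma>) (mso_to_fso \<psi>)"
      by (blast intro: fso_prf.exI_E)
  qed
next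
  case (exP_I \<Gamma> X \<phi>)
  then obtain m where m: "\<And>n. n \<ge> m \<Longrightarrow> fso_prf D (typings n @ map mso_to_fso \<Gamma>) (mso_to_fso (minstP X \<phi>))"
    by blast
  show ?case
  \<comment> \<open>The threshold is raised above \<open>X\<close> so that
    \<open>FTyped X h2\<close> is among the hypotheses even if \<open>X\<close> does not occur
    elsewhere.\<close>
  proof (intro exI[of _ "max m (Suc X)"] allI impI)
    fix n assume n: "max m (Suc X) \<le> n"
    then have deriv: "fso_prf D (typings n @ map mso_to_fso \<Gamma>) (mso_to_fso (minstP X \<phi>))"
      using m by simp
    have "fso_prf D (typings n @ map mso_to_fso \<Gamma>) (FTyped X h2)"
      using n fso_prf_ctxt[OF deriv] by (intro fso_hyp) (auto simp: typings_def)
    with deriv show "fso_prf D (typings n @ map mso_to_fso \<Gamma>) (mso_to_fso (MExP \<phi>))"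
      using fso_prf.exF_I[of D _ X h2 "mso_to_fso \<phi>"] by simp
  qed
next
  case (exP_E \<Gamma> \<phi> \<psi>)
  then obtain m1 m2 where
    1: "\<And>n. n \<ge> m1 \<Longrightarrow> fso_prf D (typings n @ map mso_to_fso \<Gamma>) (mso_to_fso (MExP \<phi>))" and
    2: "\<And>n. n \<ge> m2 \<Longrightarrow> fso_prf D (typings n @ map mso_to_fso (\<phi> # map mliftP \<Gamma>)) (mso_to_fso (mliftP \<psi>))"
    by blast
  show ?case
  proof (intro exI[of _ "max m1 m2"] allI impI)
    fix n assume n: "max m1 m2 \<le> n"
    \<comment> \<open>The premise is used at \<open>Suc n\<close>: elimination supplies the typing
      of Function \<open>0\<close>, and the lifted \<open>n\<close> typings account for the
      rest.\<close>
    have "fso_prf D (FTyped 0 h2 # mso_to_fso \<phi> # map fliftF (typings n @ map mso_to_fso \<Gamma>))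
        (fliftF (mso_to_fso \<psi>))"
      unfolding fsubst_mso_to_fso
      by (rule fso_prf_mono[OF 2[of "Suc n"]])
        (use n fso_prf_ctxt[OF 2[of "Suc n"]] in \<open>auto simp: typings_Suc fso_ctxt_def\<close>)
    moreover have "fso_prf D (typings n @ map mso_to_fso \<Gamma>) (FExF h2 (mso_to_fso \<phi>))"
      using 1[of n] n by simp
    ultimately show "fso_prf D (typings n @ map mso_to_fso \<Gamma>) (mso_to_fso \<psi>)"
      by (blast intro: fso_prf.exF_E)
  qed
qed

text \<open>A typing of index \<open>0\<close> can be removed by eliminating any existential over
  Functions into \<open>2\<close>; as \<open>\<phi>\<close> does not change under lifting, it passes
  out of that elimination.\<close>

lemma fso_discharge_typings:
  assumes "mliftP \<phi> = \<phi>"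
  shows "fso_prf D (typings n) (mso_to_fso \<phi>) \<Longrightarrow> fso_prf D [] (mso_to_fso \<phi>)"
proof (induction n)
  case (Suc n)
  \<comment> \<open>Comprehension for a closed formula merely shows the type \<open>2\<close> to be
    inhabited; the defining property of the Function is then weakened in as an extra
    hypothesis.\<close>
  let ?\<psi> = "mso_to_fso (MAllI (MIff (MPred 0 (IVar 0)) (mliftP MTrue)))"
  have "fso_prf D (typings n) (FExF h2 ?\<psi>)"
    using fso_comprehension[of D "typings n" MTrue] by simp
  moreover have "fso_prf D (FTyped 0 h2 # ?\<psi> # map fliftF (typings n)) (fliftF (mso_to_fso \<phi>))"
    unfolding fsubst_mso_to_fso assms
    by (rule fso_prf_mono[OF Suc.prems])
      (use fso_prf_ctxt[OF Suc.prems] in \<open>auto simp: typings_Suc fso_ctxt_def\<close>)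
  ultimately have "fso_prf D (typings n) (mso_to_fso \<phi>)"
    by (rule fso_prf.exF_E)
  then show ?case by (rule Suc.IH)
qed (simp add: typings_def)

theorem theorem3p26:
  fixes D :: hf and \<phi> :: mso
  assumes "elts D \<noteq> {||}"
    and "mso_form D \<phi>"
    and "mso_closed \<phi>"
  shows "fso_provable D (mso_to_fso \<phi>) \<longleftrightarrow> mso_provable D \<phi>"
proof
  assume "fso_provable D (mso_to_fso \<phi>)"
  then show "mso_provable D \<phi>"
    using fso_imp_mso assms(2) unfolding fso_provable_def mso_provable_def by blast
next
  assume "mso_provable D \<phi>"
  then obtain n where "fso_prf D (typings n) (mso_to_fso \<phi>)"
    using fso_prf_translation[of D "[]" \<phi>] unfolding mso_provable_def by auto
  \<comment> \<open>With no free indices, lifting agrees with the identity substitution, as the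
    discharge of the typings demands.\<close>
  moreover have "mliftP \<phi> = msubst IVar id \<phi>"
    using assms(3) unfolding mso_closed_def by (rule msubst_cong) auto
  ultimately show "fso_provable D (mso_to_fso \<phi>)"
    unfolding fso_provable_def by (intro fso_discharge_typings) auto
qed

end
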